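(* Let $F:\mathbb{R}\to\mathbb{R}$ and let $J(u,v)=(0,F\circ u)$. 1. For the conditions $J(0)=0$, $(H_0^L)$ and $(H_1^L)$ (see context) to be satisfied: (a) it is necessary that $F(0)=0$; (b) it is sufficient that $F(0)=0$ and that, for all $(u,v)\in D(A)^2$, $$\|F\circ u-F\circ v\|_2\le C(\|u\|_2,\|u_x\|_2,\|v\|_2,\|v_x\|_2)\,\|\sqrt Au-\sqrt Av\|_2,$$ $$\|\sqrt A(F\circ u-F\circ v)\|_2\le C(\|u\|_2,\|u_x\|_2,\|v\|_2,\|v_x\|_2)\,\|A(u-v)\|_2,$$ where $C$ is a (finite) monotone increasing function of all its arguments. 2. Suppose the sufficient conditions in 1(b) hold. Assume moreover that $F\in C^0(\mathbb{R})$ and that for any $(u,v)\in(L^2(\Omega_1)\times L^2(\Omega_2))^2$ $$\|F\circ u-F\circ v\|_2\le C(\|u\|_2,\|v\|_2)\,\|u-v\|_2,$$ with $C$ a monotone increasing function of all its arguments. If $G$, defined on $\mathbb{R}$ by $G(w)=\int_0^wF(\xi)\,d\xi$, takes only non-positive values, and if $G\circ u\in L^1(\Omega)$ for $u\in H^2(\Omega)$ ($\Omega$ being an interval of $\mathbb{R}$, possibly unbounded), then, for every $\Phi\in D(A)$, the unique local solution $\varphi=(u,u_t)$ of Problem (P) has the property that $\|\varphi(t)\|$ is bounded from above on any finite interval of existence. Thus it defines a global solution of (P), i.e. a strongly differentiable $D(\mathcal A)$-valued function on $[0,+\infty)$ that satisfies Problem (P).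
   Context: Fix positive constants $c,a_1,a_2$ with $a_2>a_1$, and let $\Omega_1=\Omega_2=(0,+\infty)$. All functions are real-valued. Let $H=L^2(\Omega_1)\times L^2(\Omega_2)$ with norm $\|u\|_2=(\sum_{k}\int_{\Omega_k}|u_k|^2dx)^{1/2}$; $u_x$ denotes $(u_1',u_2')$. Let $D(A)=\{v\in H^2(\Omega_1)\times H^2(\Omega_2): v_1(0)=v_2(0),\ v_1'(0^+)+v_2'(0^+)=0\}$ and $Av=(-c^2v_k''+a_kv_k)_{k=1,2}$. $A$ is a positive self-adjoint operator in $H$, and $D(\sqrt A)=\{v\in H^1(\Omega_1)\times H^1(\Omega_2): v_1(0)=v_2(0)\}$. For $u=(u_1,u_2)$, $F\circ u=(F\circ u_1,F\circ u_2)$. An inequality bounding $\|F\circ u-F\circ v\|_2$ or $\|\sqrt A(F\circ u-F\circ v)\|_2$ includes the assertion that the function lies in $H$, resp. in $D(\sqrt A)$. Problem (P): find $u$ with values in $D(A)$, $u\in C^2$ in time with values in $H$, such that $\frac{d^2u}{dt^2}(t)+Au(t)=F\circ u(t)$ in $H$, $u(0)=\Phi\in D(A)$, $\frac{du}{dt}(0)=0$. First-order form (Q): for $\varphi=(u,v)\in D(\sqrt A)\oplus H$ put $\|\varphi\|=(\|\sqrt Au\|_2^2+\|v\|_2^2)^{1/2}$. Let $\mathcal A=i\begin{pmatrix}0&I\\-A&0\end{pmatrix}$, $D(\mathcal A)=D(A)\oplus D(\sqrt A)$, so $\|\mathcal A\varphi\|=(\|\sqrt Av\|_2^2+\|Au\|_2^2)^{1/2}$,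 $\|J(\varphi)\|=\|F\circ u\|_2$, $\|\mathcal AJ(\varphi)\|=\|\sqrt A(F\circ u)\|_2$. Then (Q) is $\frac{d\varphi}{dt}+i\mathcal A\varphi=J(\varphi)$, $\varphi(0)=(\Phi,0)$, i.e. $\frac{d}{dt}(u,v)=(v,-Au+F\circ u)$. Conditions: for all $\varphi,\psi\in D(\mathcal A)$, $(H_0^L)$: $\|J(\varphi)-J(\psi)\|\le C(\|\varphi\|,\|\psi\|)\,\|\varphi-\psi\|$; $(H_1^L)$: $\|\mathcal A(J(\varphi)-J(\psi))\|\le C(\|\varphi\|,\|\mathcal A\varphi\|,\|\psi\|,\|\mathcal A\psi\|)\,\|\mathcal A\varphi-\mathcal A\psi\|$, where each $C$ is an everywhere finite function, monotone increasing in each argument. Known fact (Reed–Simon): if $J$ maps $D(\mathcal A)$ to $D(\mathcal A)$ and $J(0)=0$, $(H_0^L)$, $(H_1^L)$ hold, then (Q) has for each $\varphi_0\in D(\mathcal A)$ a unique continuously differentiable solution on some interval $[0,T)$, $T>0$; this is the "local solution". *)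

theory Defs
  imports "HOL-Analysis.Analysis"
begin

section \<open>Square integrable functions and the space L2 of the half line\<close>

definition sqint :: "real set \<Rightarrow> (real \<Rightarrow> real) \<Rightarrow> bool" where
  "sqint \<Omega> f \<longleftrightarrow> f \<in> borel_measurable (lebesgue_on \<Omega>) \<and>
     integrable (lebesgue_on \<Omega>) (\<lambda>x. (f x)\<^sup>2)"

lemma sqint_zero [simp]: "sqint \<Omega> (\<lambda>x. 0)"
  by (simp add: sqint_def)

lemma sqint_scale: "sqint \<Omega> f \<Longrightarrow> sqint \<Omega> (\<lambda>x. r * f x)"
  by (auto simp: sqint_def power_mult_distrib)

lemma sqint_mult_integrable:
  assumes "sqint \<Omega> f" "sqint \<Omega> g"
  shows "integrable (lebesgue_on \<Omega>) (\<lambda>x. f x * g x)"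
proof (rule Bochner_Integration.integrable_bound)
  show "integrable (lebesgue_on \<Omega>) (\<lambda>x. (f x)\<^sup>2 + (g x)\<^sup>2)"
    using assms by (auto simp: sqint_def)
  show "(\<lambda>x. f x * g x) \<in> borel_measurable (lebesgue_on \<Omega>)"
    using assms by (auto simp: sqint_def)
  have "norm (f x * g x) \<le> norm ((f x)\<^sup>2 + (g x)\<^sup>2)" for x
  proof -
    have "2 * (\<bar>f x\<bar> * \<bar>g x\<bar>) \<le> (f x)\<^sup>2 + (g x)\<^sup>2"
      using sum_squares_bound[of "\<bar>f x\<bar>" "\<bar>g x\<bar>"] by simp
    moreover have "0 \<le> \<bar>f x\<bar> * \<bar>g x\<bar>" by simp
    ultimately have "\<bar>f x\<bar> * \<bar>g x\<bar> \<le> (f x)\<^sup>2 + (g x)\<^sup>2" by linarith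
    then show ?thesis by (simp add: abs_mult)
  qed
  then show "AE x in lebesgue_on \<Omega>. norm (f x * g x) \<le> norm ((f x)\<^sup>2 + (g x)\<^sup>2)"
    by simp
qed

lemma sqint_add:
  assumes "sqint \<Omega> f" "sqint \<Omega> g"
  shows "sqint \<Omega> (\<lambda>x. f x + g x)"
proof -
  have "integrable (lebesgue_on \<Omega>) (\<lambda>x. (f x)\<^sup>2 + (g x)\<^sup>2 + 2 * (f x * g x))"
    using assms sqint_mult_integrable[OF assms] by (auto simp: sqint_def)
  then have "integrable (lebesgue_on \<Omega>) (\<lambda>x. (f x + g x)\<^sup>2)"
    by (simp add: power2_sum mult.assoc)
  then show ?thesis using assms by (auto simp: sqint_def)
qed

lemma sqint_uminus: "sqint \<Omega> f \<Longrightarrow> sqint \<Omega> (\<lambda>x. - f x)"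
  by (auto simp: sqint_def)

lemma sqint_diff: "sqint \<Omega> f \<Longrightarrow> sqint \<Omega> g \<Longrightarrow> sqint \<Omega> (\<lambda>x. f x - g x)"
  using sqint_add[OF _ sqint_uminus, of \<Omega> f g] by simp

abbreviation half_line :: "real set" where
  "half_line \<equiv> {0<..}"

definition l2_rel :: "(real \<Rightarrow> real) \<Rightarrow> (real \<Rightarrow> real) \<Rightarrow> bool" where
  "l2_rel f g \<longleftrightarrow> sqint half_line f \<and> sqint half_line g \<and>
     (AE x in lebesgue_on half_line. f x = g x)"

quotient_type l2 = "real \<Rightarrow> real" / partial: l2_rel
proof (rule part_equivpI)
  show "\<exists>f. l2_rel f f"
    by (rule exI[of _ "\<lambda>x. 0"]) (simp add: l2_rel_def)
  show "symp l2_rel"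
    by (rule sympI) (auto simp: l2_rel_def)
  show "transp l2_rel"
  proof (rule transpI)
    fix f g h assume "l2_rel f g" "l2_rel g h"
    then show "l2_rel f h" unfolding l2_rel_def by fastforce
  qed
qed

lemma l2_rel_rep: "l2_rel (rep_l2 u) (rep_l2 u)"
  using Quotient_l2 by (rule Quotient_rep_reflp)

lemma sqint_rep_l2 [simp]: "sqint half_line (rep_l2 u)"
  using l2_rel_rep[of u] by (simp add: l2_rel_def)

lemma l2_rel_rep_abs: "sqint half_line f \<Longrightarrow> l2_rel (rep_l2 (abs_l2 f)) f"
  using Quotient_l2 by (rule Quotient_rep_abs) (simp add: l2_rel_def)

instantiation l2 :: real_vector
begin

lift_definition zero_l2 :: l2 is "\<lambda>x. 0"
  by (simp add: l2_rel_def)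

lift_definition plus_l2 :: "l2 \<Rightarrow> l2 \<Rightarrow> l2" is "\<lambda>f g x. f x + g x"
  by (auto simp: l2_rel_def sqint_add)

lift_definition uminus_l2 :: "l2 \<Rightarrow> l2" is "\<lambda>f x. - f x"
  by (auto simp: l2_rel_def sqint_uminus)

lift_definition minus_l2 :: "l2 \<Rightarrow> l2 \<Rightarrow> l2" is "\<lambda>f g x. f x - g x"
  by (auto simp: l2_rel_def sqint_diff)

lift_definition scaleR_l2 :: "real \<Rightarrow> l2 \<Rightarrow> l2" is "\<lambda>r f x. r * f x"
  by (auto simp: l2_rel_def sqint_scale)

instance
proof
  fix u v w :: l2 and r s :: real
  show "u + v + w = u + (v + w)"
    by transfer (auto simp: l2_rel_def sqint_add add.assoc)
  show "u + v = v + u"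
    by transfer (auto simp: l2_rel_def sqint_add add.commute)
  show "0 + u = u"
    by transfer (auto simp: l2_rel_def)
  show "- u + u = 0"
    by transfer (auto simp: l2_rel_def)
  show "u - v = u + - v"
    by transfer (auto simp: l2_rel_def sqint_diff)
  show "r *\<^sub>R (u + v) = r *\<^sub>R u + r *\<^sub>R v"
    by transfer (auto simp: l2_rel_def distrib_left intro!: sqint_add sqint_scale)
  show "(r + s) *\<^sub>R u = r *\<^sub>R u + s *\<^sub>R u"
    by transfer (auto simp: l2_rel_def distrib_right intro!: sqint_add sqint_scale)
  show "r *\<^sub>R s *\<^sub>R u = (r * s) *\<^sub>R u"
    by transfer (auto simp: l2_rel_def mult.assoc intro!: sqint_scale)
  show "1 *\<^sub>R u = u"
    by transfer (auto simp: l2_rel_def)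
qed

end

instantiation l2 :: real_inner
begin

lift_definition inner_l2 :: "l2 \<Rightarrow> l2 \<Rightarrow> real"
  is "\<lambda>f g. \<integral>x. f x * g x \<partial>lebesgue_on half_line"
  unfolding l2_rel_def
  by (rule integral_cong_AE) (auto simp: sqint_def)

definition norm_l2 :: "l2 \<Rightarrow> real" where
  "norm_l2 u = sqrt (inner u u)"

definition dist_l2 :: "l2 \<Rightarrow> l2 \<Rightarrow> real" where
  "dist_l2 u v = norm (u - v)"

definition sgn_l2 :: "l2 \<Rightarrow> l2" where
  "sgn_l2 u = u /\<^sub>R norm u"

definition uniformity_l2 :: "(l2 \<times> l2) filter" where
  "uniformity_l2 = (INF e\<in>{0<..}. principal {(u, v). dist u v < e})"

definition open_l2 :: "l2 set \<Rightarrow> bool" where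
  "open_l2 U \<longleftrightarrow> (\<forall>u\<in>U. \<forall>\<^sub>F (u', v) in uniformity. u' = u \<longrightarrow> v \<in> U)"

instance
proof
  fix u v w :: l2 and r :: real and U :: "l2 set"
  show "dist u v = norm (u - v)" by (rule dist_l2_def)
  show "sgn u = u /\<^sub>R norm u" by (rule sgn_l2_def)
  show "uniformity = (INF e\<in>{0<..}. principal {(u :: l2, v). dist u v < e})"
    by (rule uniformity_l2_def)
  show "open U \<longleftrightarrow> (\<forall>u\<in>U. \<forall>\<^sub>F (u', v) in uniformity. u' = u \<longrightarrow> v \<in> U)"
    by (rule open_l2_def)
  show "inner u v = inner v u"
    by transfer (simp add: mult.commute)
  show "inner (u + v) w = inner u w + inner v w"
    by transfer
      (auto simp: l2_rel_def distrib_right sqint_mult_integrable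
        intro!: Bochner_Integration.integral_add)
  show "inner (r *\<^sub>R u) v = r * inner u v"
    by transfer (simp add: mult.assoc)
  show "0 \<le> inner u u"
    by transfer (auto intro!: Bochner_Integration.integral_nonneg)
  show "inner u u = 0 \<longleftrightarrow> u = 0"
  proof transfer
    fix f assume f: "l2_rel f f"
    then have s: "sqint half_line f" by (simp add: l2_rel_def)
    have "(\<integral>x. f x * f x \<partial>lebesgue_on half_line) = 0 \<longleftrightarrow>
        (AE x in lebesgue_on half_line. f x * f x = 0)"
      by (rule integral_nonneg_eq_0_iff_AE) (auto intro: sqint_mult_integrable[OF s s])
    then show "(\<integral>x. f x * f x \<partial>lebesgue_on half_line) = 0 \<longleftrightarrow> l2_rel f (\<lambda>x. 0)"
      using s by (simp add: l2_rel_def)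
  qed
  show "norm u = sqrt (inner u u)" by (rule norm_l2_def)
qed

end

text \<open>The product norm of HOL-Analysis on \<open>l2 \<times> l2\<close> is
  \<open>sqrt ((norm u1)\<^sup>2 + (norm u2)\<^sup>2)\<close>, the norm of \<open>H\<close>.\<close>

type_synonym H = "l2 \<times> l2"


section \<open>Sobolev spaces\<close>

definition test_fun :: "real set \<Rightarrow> (real \<Rightarrow> real) \<Rightarrow> bool" where
  "test_fun \<Omega> \<phi> \<longleftrightarrow> (\<forall>n x. ((deriv ^^ n) \<phi>) differentiable (at x)) \<and>
     (\<exists>K. compact K \<and> K \<subseteq> \<Omega> \<and> (\<forall>x. x \<notin> K \<longrightarrow> \<phi> x = 0))"

definition weak_deriv :: "real set \<Rightarrow> (real \<Rightarrow> real) \<Rightarrow> (real \<Rightarrow> real) \<Rightarrow> bool" where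
  "weak_deriv \<Omega> f g \<longleftrightarrow> (\<forall>\<phi>. test_fun \<Omega> \<phi> \<longrightarrow>
     (\<integral>x. f x * deriv \<phi> x \<partial>lebesgue_on \<Omega>) = - (\<integral>x. g x * \<phi> x \<partial>lebesgue_on \<Omega>))"

definition sobolev1 :: "real set \<Rightarrow> (real \<Rightarrow> real) \<Rightarrow> bool" where
  "sobolev1 \<Omega> f \<longleftrightarrow> sqint \<Omega> f \<and> (\<exists>g. sqint \<Omega> g \<and> weak_deriv \<Omega> f g)"

definition sobolev2 :: "real set \<Rightarrow> (real \<Rightarrow> real) \<Rightarrow> bool" where
  "sobolev2 \<Omega> f \<longleftrightarrow> sqint \<Omega> f \<and> (\<exists>g. sobolev1 \<Omega> g \<and> weak_deriv \<Omega> f g)"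

definition H1 :: "l2 set" where
  "H1 = {u. sobolev1 half_line (rep_l2 u)}"

definition H2 :: "l2 set" where
  "H2 = {u. sobolev2 half_line (rep_l2 u)}"

definition dx :: "l2 \<Rightarrow> l2" where
  "dx u = (THE g. weak_deriv half_line (rep_l2 u) (rep_l2 g))"

text \<open>Value at 0 of the representative that is continuous up to the boundary;
  meaningful for elements of \<open>H1\<close>.\<close>

definition trace0 :: "l2 \<Rightarrow> real" where
  "trace0 u = (THE r. \<exists>f. continuous_on {0..} f \<and>
     (AE x in lebesgue_on half_line. f x = rep_l2 u x) \<and> f 0 = r)"

definition grad :: "H \<Rightarrow> H" where
  "grad u = (dx (fst u), dx (snd u))"


section \<open>Unbounded operators as graphs, and square roots\<close>

definition adjoint_graph :: "('a::real_inner \<times> 'a) set \<Rightarrow> ('a \<times> 'a) set" where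
  "adjoint_graph T = {(y, z). \<forall>(x, w)\<in>T. inner w y = inner x z}"

definition self_adjoint :: "('a::real_inner \<times> 'a) set \<Rightarrow> bool" where
  "self_adjoint T \<longleftrightarrow> subspace T \<and> single_valued T \<and> closure (Domain T) = UNIV \<and>
     adjoint_graph T = T"

definition positive_op :: "('a::real_inner \<times> 'a) set \<Rightarrow> bool" where
  "positive_op T \<longleftrightarrow> (\<forall>(x, w)\<in>T. 0 \<le> inner w x)"

text \<open>Equality of graphs includes equality of the domains:
  the domain of \<open>B O B\<close> is the set of all \<open>x\<close> in the domain of \<open>B\<close>
  whose image is again in the domain of \<open>B\<close>.\<close>

definition op_sqrt :: "('a::real_inner \<times> 'a) set \<Rightarrow> ('a \<times> 'a) set" where
  "op_sqrt T = (THE B. self_adjoint B \<and> positive_op B \<and> B O B = T)"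

definition app :: "('a \<times> 'a) set \<Rightarrow> 'a \<Rightarrow> 'a" where
  "app T x = (THE w. (x, w) \<in> T)"


section \<open>The operator A and its square root\<close>

definition domA :: "H set" where
  "domA = {(v1, v2). v1 \<in> H2 \<and> v2 \<in> H2 \<and> trace0 v1 = trace0 v2 \<and>
     trace0 (dx v1) + trace0 (dx v2) = 0}"

definition opA :: "real \<Rightarrow> real \<Rightarrow> real \<Rightarrow> H \<Rightarrow> H" where
  "opA c a1 a2 = (\<lambda>(v1, v2). (a1 *\<^sub>R v1 - c\<^sup>2 *\<^sub>R dx (dx v1), a2 *\<^sub>R v2 - c\<^sup>2 *\<^sub>R dx (dx v2)))"

definition graphA :: "real \<Rightarrow> real \<Rightarrow> real \<Rightarrow> (H \<times> H) set" where
  "graphA c a1 a2 = {(v, opA c a1 a2 v) | v. v \<in> domA}"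

definition dom_sqrtA :: "real \<Rightarrow> real \<Rightarrow> real \<Rightarrow> H set" where
  "dom_sqrtA c a1 a2 = Domain (op_sqrt (graphA c a1 a2))"

definition sqrtA :: "real \<Rightarrow> real \<Rightarrow> real \<Rightarrow> H \<Rightarrow> H" where
  "sqrtA c a1 a2 = app (op_sqrt (graphA c a1 a2))"


section \<open>Composition with F\<close>

text \<open>Composites are formed on representatives. They need not be square integrable,
  so membership in \<open>H\<close> is a separate predicate and \<open>to_H\<close> is
  meaningful only under it.\<close>

type_synonym fun_pair = "(real \<Rightarrow> real) \<times> (real \<Rightarrow> real)"

definition in_H :: "fun_pair \<Rightarrow> bool" where
  "in_H p \<longleftrightarrow> sqint half_line (fst p) \<and> sqint half_line (snd p)"

definition to_H :: "fun_pair \<Rightarrow> H" where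
  "to_H p = (abs_l2 (fst p), abs_l2 (snd p))"

definition nemytskii :: "(real \<Rightarrow> real) \<Rightarrow> H \<Rightarrow> fun_pair" where
  "nemytskii F u = (\<lambda>x. F (rep_l2 (fst u) x), \<lambda>x. F (rep_l2 (snd u) x))"

definition nemytskii_diff :: "(real \<Rightarrow> real) \<Rightarrow> H \<Rightarrow> H \<Rightarrow> fun_pair" where
  "nemytskii_diff F u v =
     (\<lambda>x. F (rep_l2 (fst u) x) - F (rep_l2 (fst v) x),
      \<lambda>x. F (rep_l2 (snd u) x) - F (rep_l2 (snd v) x))"


section \<open>The first-order system\<close>

definition spaceX :: "real \<Rightarrow> real \<Rightarrow> real \<Rightarrow> (H \<times> H) set" where
  "spaceX c a1 a2 = dom_sqrtA c a1 a2 \<times> UNIV"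

definition normX :: "real \<Rightarrow> real \<Rightarrow> real \<Rightarrow> H \<times> H \<Rightarrow> real" where
  "normX c a1 a2 \<phi> = sqrt ((norm (sqrtA c a1 a2 (fst \<phi>)))\<^sup>2 + (norm (snd \<phi>))\<^sup>2)"

definition dom_calA :: "real \<Rightarrow> real \<Rightarrow> real \<Rightarrow> (H \<times> H) set" where
  "dom_calA c a1 a2 = domA \<times> dom_sqrtA c a1 a2"

text \<open>All functions being real-valued, only the real operator i times calligraphic A,
  \<open>(u, v) \<mapsto> (- v, A u)\<close>, is used; the factor i does not affect norms.\<close>

definition i_calA :: "real \<Rightarrow> real \<Rightarrow> real \<Rightarrow> H \<times> H \<Rightarrow> H \<times> H" where
  "i_calA c a1 a2 \<phi> = (- snd \<phi>, opA c a1 a2 (fst \<phi>))"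

definition J_in_X :: "(real \<Rightarrow> real) \<Rightarrow> H \<times> H \<Rightarrow> bool" where
  "J_in_X F \<phi> \<longleftrightarrow> in_H (nemytskii F (fst \<phi>))"

definition J :: "(real \<Rightarrow> real) \<Rightarrow> H \<times> H \<Rightarrow> H \<times> H" where
  "J F \<phi> = (0, to_H (nemytskii F (fst \<phi>)))"

definition J_zero :: "(real \<Rightarrow> real) \<Rightarrow> bool" where
  "J_zero F \<longleftrightarrow> J_in_X F 0 \<and> J F 0 = 0"

text \<open>The bounding functions have norms as arguments, so only nonnegative arguments matter.\<close>

definition incr2 :: "(real \<Rightarrow> real \<Rightarrow> real) \<Rightarrow> bool" where
  "incr2 C \<longleftrightarrow> (\<forall>x1 x2 y1 y2. 0 \<le> x1 \<and> x1 \<le> y1 \<and> 0 \<le> x2 \<and> x2 \<le> y2 \<longrightarrow>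
     C x1 x2 \<le> C y1 y2)"

definition incr4 :: "(real \<Rightarrow> real \<Rightarrow> real \<Rightarrow> real \<Rightarrow> real) \<Rightarrow> bool" where
  "incr4 C \<longleftrightarrow> (\<forall>x1 x2 x3 x4 y1 y2 y3 y4.
     0 \<le> x1 \<and> x1 \<le> y1 \<and> 0 \<le> x2 \<and> x2 \<le> y2 \<and> 0 \<le> x3 \<and> x3 \<le> y3 \<and> 0 \<le> x4 \<and> x4 \<le> y4 \<longrightarrow>
     C x1 x2 x3 x4 \<le> C y1 y2 y3 y4)"

definition H0L :: "real \<Rightarrow> real \<Rightarrow> real \<Rightarrow> (real \<Rightarrow> real) \<Rightarrow> bool" where
  "H0L c a1 a2 F \<longleftrightarrow> (\<exists>C. incr2 C \<and>
     (\<forall>\<phi>\<in>dom_calA c a1 a2. \<forall>\<psi>\<in>dom_calA c a1 a2.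
        J_in_X F \<phi> \<and> J_in_X F \<psi> \<and>
        normX c a1 a2 (J F \<phi> - J F \<psi>)
          \<le> C (normX c a1 a2 \<phi>) (normX c a1 a2 \<psi>) * normX c a1 a2 (\<phi> - \<psi>)))"

definition H1L :: "real \<Rightarrow> real \<Rightarrow> real \<Rightarrow> (real \<Rightarrow> real) \<Rightarrow> bool" where
  "H1L c a1 a2 F \<longleftrightarrow> (\<exists>C. incr4 C \<and>
     (\<forall>\<phi>\<in>dom_calA c a1 a2. \<forall>\<psi>\<in>dom_calA c a1 a2.
        J_in_X F \<phi> \<and> J_in_X F \<psi> \<and> J F \<phi> - J F \<psi> \<in> dom_calA c a1 a2 \<and>
        normX c a1 a2 (i_calA c a1 a2 (J F \<phi> - J F \<psi>))
          \<le> C (normX c a1 a2 \<phi>) (normX c a1 a2 (i_calA c a1 a2 \<phi>))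
              (normX c a1 a2 \<psi>) (normX c a1 a2 (i_calA c a1 a2 \<psi>))
            * normX c a1 a2 (i_calA c a1 a2 \<phi> - i_calA c a1 a2 \<psi>)))"


section \<open>Hypotheses on F\<close>

definition lipschitz_energy :: "real \<Rightarrow> real \<Rightarrow> real \<Rightarrow> (real \<Rightarrow> real) \<Rightarrow> bool" where
  "lipschitz_energy c a1 a2 F \<longleftrightarrow> (\<exists>C. incr4 C \<and> (\<forall>u\<in>domA. \<forall>v\<in>domA.
     in_H (nemytskii_diff F u v) \<and>
     norm (to_H (nemytskii_diff F u v))
       \<le> C (norm u) (norm (grad u)) (norm v) (norm (grad v))
         * norm (sqrtA c a1 a2 u - sqrtA c a1 a2 v)))"

definition lipschitz_graph :: "real \<Rightarrow> real \<Rightarrow> real \<Rightarrow> (real \<Rightarrow> real) \<Rightarrow> bool" where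
  "lipschitz_graph c a1 a2 F \<longleftrightarrow> (\<exists>C. incr4 C \<and> (\<forall>u\<in>domA. \<forall>v\<in>domA.
     in_H (nemytskii_diff F u v) \<and> to_H (nemytskii_diff F u v) \<in> dom_sqrtA c a1 a2 \<and>
     norm (sqrtA c a1 a2 (to_H (nemytskii_diff F u v)))
       \<le> C (norm u) (norm (grad u)) (norm v) (norm (grad v))
         * norm (opA c a1 a2 (u - v))))"

definition lipschitz_H :: "(real \<Rightarrow> real) \<Rightarrow> bool" where
  "lipschitz_H F \<longleftrightarrow> (\<exists>C. incr2 C \<and> (\<forall>u v.
     in_H (nemytskii_diff F u v) \<and>
     norm (to_H (nemytskii_diff F u v)) \<le> C (norm u) (norm v) * norm (u - v)))"

definition primitive :: "(real \<Rightarrow> real) \<Rightarrow> real \<Rightarrow> real" where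
  "primitive F w = (LBINT \<xi>=ereal 0..ereal w. F \<xi>)"


section \<open>Solutions\<close>

text \<open>\<open>I\<close> is the time interval, \<open>{0..<T}\<close> or \<open>{0..}\<close>;
  derivatives at its left end point are one-sided.\<close>

definition solves_P ::
    "real \<Rightarrow> real \<Rightarrow> real \<Rightarrow> (real \<Rightarrow> real) \<Rightarrow> H \<Rightarrow> real set \<Rightarrow> (real \<Rightarrow> H) \<Rightarrow> bool" where
  "solves_P c a1 a2 F \<Phi> I u \<longleftrightarrow>
     (\<exists>u' u''.
        (\<forall>t\<in>I. u t \<in> domA \<and> in_H (nemytskii F (u t)) \<and>
           (u has_vector_derivative u' t) (at t within I) \<and>
           (u' has_vector_derivative u'' t) (at t within I) \<and>
           u'' t + opA c a1 a2 (u t) = to_H (nemytskii F (u t))) \<and>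
        continuous_on I u'' \<and> u 0 = \<Phi> \<and> u' 0 = 0)"

text \<open>Differentiability and continuity with respect to \<open>normX\<close>, which is not the
  product norm that the type \<open>H \<times> H\<close> carries.\<close>

definition has_derivX ::
    "real \<Rightarrow> real \<Rightarrow> real \<Rightarrow> (real \<Rightarrow> H \<times> H) \<Rightarrow> H \<times> H \<Rightarrow> real \<Rightarrow> real set \<Rightarrow> bool" where
  "has_derivX c a1 a2 \<phi> d t I \<longleftrightarrow>
     ((\<lambda>s. normX c a1 a2 ((\<phi> s - \<phi> t) /\<^sub>R (s - t) - d)) \<longlongrightarrow> 0) (at t within I)"

definition continuousX ::
    "real \<Rightarrow> real \<Rightarrow> real \<Rightarrow> real set \<Rightarrow> (real \<Rightarrow> H \<times> H) \<Rightarrow> bool" where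
  "continuousX c a1 a2 I \<phi> \<longleftrightarrow>
     (\<forall>t\<in>I. ((\<lambda>s. normX c a1 a2 (\<phi> s - \<phi> t)) \<longlongrightarrow> 0) (at t within I))"

definition solves_Q ::
    "real \<Rightarrow> real \<Rightarrow> real \<Rightarrow> (real \<Rightarrow> real) \<Rightarrow> H \<Rightarrow> real set \<Rightarrow> (real \<Rightarrow> H \<times> H) \<Rightarrow> bool" where
  "solves_Q c a1 a2 F \<Phi> I \<phi> \<longleftrightarrow>
     (\<exists>\<phi>'.
        (\<forall>t\<in>I. \<phi> t \<in> dom_calA c a1 a2 \<and> J_in_X F (\<phi> t) \<and> \<phi>' t \<in> spaceX c a1 a2 \<and>
           has_derivX c a1 a2 \<phi> (\<phi>' t) t I \<and>
           \<phi>' t + i_calA c a1 a2 (\<phi> t) = J F (\<phi> t)) \<and>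
        continuousX c a1 a2 I \<phi>' \<and> \<phi> 0 = (\<Phi>, 0))"

end

theory Submission
  imports Defs
begin

text \<open>The bound on \<open>F \<circ> u - F \<circ> v\<close> in \<open>L\<^sup>2\<close>, applied to multiples of indicator functions of short
  intervals, forces \<open>F\<close> itself to be Lipschitz continuous. Hence the nonlinearity is globally
  Lipschitz on the energy space, and Gronwall's lemma bounds the energy norm on bounded time intervals;
  the sign of the primitive of \<open>F\<close> plays no role.

  Put \<open>B = \<surd>A\<close>. In the coordinates \<open>x = (B u, v)\<close> the system is \<open>x' = K x + j x\<close> with
  \<open>K (p, q) = (B q, - B p)\<close> skew-adjoint and boundedly invertible, \<open>R = K\<^sup>-\<^sup>1\<close>. The graph norm estimate says
  that \<open>N y = K (j (R y))\<close> is locally Lipschitz, so a solution with values in the domain is \<open>x = R y\<close>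
  for a continuous mild solution \<open>y\<close> of \<open>y' = K y + N y\<close>. It is the limit of the solutions for the
  Yosida approximations of \<open>K\<close>, after \<open>N\<close> has been cut off outside a large ball that the
  solution does not leave on a given time interval.

  The inverse of \<open>A\<close> comes from projecting orthogonally onto the form domain in the Hilbert space of
  pairs (function, derivative); its positive square root is the norm limit of the
  iteration \<open>Y \<mapsto> (T + Y\<^sup>2) / 2\<close>, which is dominated by the same iteration for numbers.\<close>

section \<open>Hilbert space preliminaries\<close>

text \<open>The graph norm estimate gives \<open>N\<close> a Lipschitz constant that depends only on
  bounds for \<open>norm (R y)\<close>, that is, on the energy. This order of dependence excludes
  blow-up in the graph norm: the global Lipschitz constant of \<open>F\<close> first confines the
  energy on the time interval, this fixes the linear growth rate of \<open>N\<close> along the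
  solution, and only then is the radius of the cut-off chosen. The cut-off scales towards the origin
  because that decreases \<open>norm y\<close> and \<open>norm (R y)\<close> together. The unknown
  is \<open>y\<close> and not \<open>x\<close> since the solution has to take values in the domain
  of the generator, which \<open>x = R y\<close> does by construction.

  \<open>op_sqrt\<close> is a definite description, so a root must be constructed and also be shown
  unique among all self-adjoint positive candidates. Passing to inverses keeps the operators
  bounded: the root has the graph of all pairs \<open>(S h, h)\<close>, where \<open>S\<close> is a
  bounded root of the inverse of \<open>A\<close>, and uniqueness rests on \<open>S\<close>
  commuting with everything that commutes with this inverse.\<close>

lemma gronwall:
  fixes g g' :: "real \<Rightarrow> real"
  assumes "0 \<le> t" "0 \<le> a" "0 \<le> b"
    and der: "\<And>s. s \<in> {0..t} \<Longrightarrow> (g has_real_derivative g' s) (at s within {0..t})"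
    and le: "\<And>s. s \<in> {0..t} \<Longrightarrow> g' s \<le> a + b * g s"
  shows "g t \<le> (g 0 + a * t) * exp (b * t)"
proof -
  \<comment> \<open>The exponential factor absorbs \<open>b * g\<close>, and \<open>- a * s\<close>
    absorbs the constant term because \<open>exp (- b * s) * a \<le> a\<close>. This avoids the
    quotient \<open>a / b\<close>, so \<open>b = 0\<close> is covered.\<close>
  define h where "h s = exp (- b * s) * g s - a * s" for s
  have dh: "(h has_real_derivative (exp (- b * s) * g' s - b * exp (- b * s) * g s - a))
      (at s within {0..t})" if "s \<in> {0..t}" for s
    unfolding h_def
    by (rule derivative_eq_intros der[OF that] refl)+ (simp add: algebra_simps)
  have "h t \<le> h 0"
  proof (rule DERIV_nonpos_imp_decreasing_open[OF \<open>0 \<le> t\<close>])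
    show "continuous_on {0..t} h"
      using dh by (meson DERIV_continuous continuous_on_eq_continuous_within)
    fix s assume s: "0 < s" "s < t"
    have "at s within {0..t} = at s"
      using s by (intro at_within_interior) auto
    then have "DERIV h s :> (exp (- b * s) * g' s - b * exp (- b * s) * g s - a)"
      using dh[of s] s by auto
    moreover have "exp (- b * s) * g' s - b * exp (- b * s) * g s - a \<le> 0"
    proof -
      have "exp (- b * s) * g' s \<le> exp (- b * s) * (a + b * g s)"
        using le[of s] s by (intro mult_left_mono) auto
      moreover have "exp (- b * s) * a \<le> 1 * a"
        using assms s by (intro mult_right_mono) auto
      ultimately show ?thesis by (simp add: algebra_simps)
    qed
    ultimately show "\<exists>y. DERIV h s :> y \<and> y \<le> 0" by blast
  qed
  then have "exp (- b * t) * g t \<le> g 0 + a * t" by (simp add: h_def)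
  then have "exp (b * t) * (exp (- b * t) * g t) \<le> exp (b * t) * (g 0 + a * t)"
    by (intro mult_left_mono) auto
  also have "exp (b * t) * (exp (- b * t) * g t) = g t"
    by (simp add: exp_minus)
  finally show ?thesis by (simp only: mult.commute)
qed

text \<open>The assumption restrains only the component of \<open>x'\<close> along \<open>x\<close>:
  skew parts of an equation contribute nothing to it, and dissipative parts only help.\<close>

lemma gronwall_norm:
  fixes x x' :: "real \<Rightarrow> 'a::real_inner"
  assumes "0 \<le> t" "0 \<le> a" "0 \<le> b"
    and der: "\<And>s. s \<in> {0..t} \<Longrightarrow> (x has_vector_derivative x' s) (at s within {0..t})"
    and le: "\<And>s. s \<in> {0..t} \<Longrightarrow> inner (x' s) (x s) \<le> a + b * (norm (x s))\<^sup>2"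
  shows "(norm (x t))\<^sup>2 \<le> ((norm (x 0))\<^sup>2 + 2 * a * t) * exp (2 * b * t)"
proof (rule gronwall)
  fix s assume s: "s \<in> {0..t}"
  have "((\<lambda>s. inner (x s) (x s)) has_vector_derivative inner (x s) (x' s) + inner (x' s) (x s))
      (at s within {0..t})"
    by (rule bounded_bilinear.has_vector_derivative[OF bounded_bilinear_inner der[OF s] der[OF s]])
  then show "((\<lambda>s. (norm (x s))\<^sup>2) has_real_derivative 2 * inner (x' s) (x s)) (at s within {0..t})"
    by (simp add: has_real_derivative_iff_has_vector_derivative power2_norm_eq_inner inner_commute)
  show "2 * inner (x' s) (x s) \<le> 2 * a + 2 * b * (norm (x s))\<^sup>2"
    using le[OF s] by simp
qed (use assms in auto)

lemma gronwall_norm_linear: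
  fixes x x' :: "real \<Rightarrow> 'a::real_inner"
  assumes "0 \<le> t" "0 \<le> b"
    and "\<And>s. s \<in> {0..t} \<Longrightarrow> (x has_vector_derivative x' s) (at s within {0..t})"
    and "\<And>s. s \<in> {0..t} \<Longrightarrow> inner (x' s) (x s) \<le> b * (norm (x s))\<^sup>2"
  shows "norm (x t) \<le> exp (b * t) * norm (x 0)"
proof (rule power2_le_imp_le)
  have "(norm (x t))\<^sup>2 \<le> ((norm (x 0))\<^sup>2 + 2 * 0 * t) * exp (2 * b * t)"
    by (rule gronwall_norm[where a = 0 and x' = x']) (use assms in auto)
  also have "\<dots> = (exp (b * t) * norm (x 0))\<^sup>2"
    by (simp add: power_mult_distrib exp_double mult.assoc)
  finally show "(norm (x t))\<^sup>2 \<le> (exp (b * t) * norm (x 0))\<^sup>2" .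
qed simp

section \<open>Orthogonal projection, density of ranges, coercive equations\<close>

text \<open>A minimising sequence for the distance to \<open>V\<close> is Cauchy by the
  parallelogram law, and its limit is the foot of the perpendicular.\<close>

lemma closed_subspace_projection:
  fixes V :: "'a::{real_inner,banach} set"
  assumes "closed V" "subspace V"
  obtains p where "p \<in> V" "\<And>w. w \<in> V \<Longrightarrow> inner (x - p) w = 0"
proof -
  have ne: "V \<noteq> {}" using subspace_0[OF assms(2)] by blast
  define d where "d = infdist x V"
  have d0: "0 \<le> d" by (simp add: d_def infdist_nonneg)
  have dle: "d \<le> norm (x - v)" if "v \<in> V" for v
    using infdist_le[OF that, of x] by (simp add: d_def dist_norm)
  have "\<exists>v\<in>V. norm (x - v) < d + inverse (real (Suc n))" for n
  proof (rule ccontr)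
    assume "\<not> ?thesis"
    then have *: "d + inverse (real (Suc n)) \<le> dist x v" if "v \<in> V" for v
      using that by (force simp: dist_norm)
    have "d + inverse (real (Suc n)) \<le> d"
      unfolding d_def infdist_notempty[OF ne]
      by (rule cINF_greatest[OF ne]) (use * in \<open>simp add: d_def infdist_notempty[OF ne]\<close>)
    then show False by simp
  qed
  then obtain p where p: "\<And>n. p n \<in> V" "\<And>n. norm (x - p n) < d + inverse (real (Suc n))"
    by metis
  have par: "(norm (v - w))\<^sup>2 \<le> 2 * (norm (x - v))\<^sup>2 + 2 * (norm (x - w))\<^sup>2 - 4 * d\<^sup>2"
    if "v \<in> V" "w \<in> V" for v w
  proof -
    \<comment> \<open>The midpoint has distance at least \<open>d\<close> from \<open>x\<close>; the
      parallelogram law for \<open>x - v\<close> and \<open>x - w\<close> turns this into an upper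
      bound for \<open>v - w\<close>.\<close>
    have "(1/2) *\<^sub>R (v + w) \<in> V" using that assms(2) by (simp add: subspace_add subspace_scale)
    from dle[OF this] d0 have "d\<^sup>2 \<le> (norm (x - (1/2) *\<^sub>R (v + w)))\<^sup>2" by (intro power_mono)
    also have "4 * \<dots> = (norm (2 *\<^sub>R (x - (1/2) *\<^sub>R (v + w))))\<^sup>2"
      by (simp add: power_mult_distrib)
    also have "2 *\<^sub>R (x - (1/2) *\<^sub>R (v + w)) = (x - v) + (x - w)"
      by (simp add: algebra_simps scaleR_2)
    finally have "4 * d\<^sup>2 \<le> (norm ((x - v) + (x - w)))\<^sup>2" by simp
    moreover have "(norm ((x - v) + (x - w)))\<^sup>2 + (norm (v - w))\<^sup>2
        = 2 * (norm (x - v))\<^sup>2 + 2 * (norm (x - w))\<^sup>2"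
      by (simp add: power2_norm_eq_inner inner_simps inner_commute)
    ultimately show ?thesis by linarith
  qed
  have pn: "(\<lambda>n. norm (x - p n)) \<longlonglongrightarrow> d"
  proof (rule tendsto_sandwich[where f = "\<lambda>_. d" and h = "\<lambda>n. d + inverse (real (Suc n))"])
    show "(\<lambda>n. d + inverse (real (Suc n))) \<longlonglongrightarrow> d"
      using tendsto_add[OF tendsto_const[of d] LIMSEQ_inverse_real_of_nat] by simp
    show "\<forall>\<^sub>F n in sequentially. d \<le> norm (x - p n)" using dle p by simp
    show "\<forall>\<^sub>F n in sequentially. norm (x - p n) \<le> d + inverse (real (Suc n))"
      using p by (simp add: less_imp_le)
  qed simp
  have "Cauchy p"
  proof (rule metric_CauchyI)
    fix e :: real assume "0 < e"
    have "(\<lambda>n. (norm (x - p n))\<^sup>2) \<longlonglongrightarrow> d\<^sup>2" using pn by (rule tendsto_power)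
    moreover have "d\<^sup>2 < d\<^sup>2 + e\<^sup>2 / 4" using \<open>0 < e\<close> by simp
    ultimately have "\<forall>\<^sub>F n in sequentially. (norm (x - p n))\<^sup>2 < d\<^sup>2 + e\<^sup>2 / 4"
      by (rule order_tendstoD(2))
    then obtain N where N: "\<And>n. n \<ge> N \<Longrightarrow> (norm (x - p n))\<^sup>2 < d\<^sup>2 + e\<^sup>2 / 4"
      unfolding eventually_sequentially by blast
    show "\<exists>M. \<forall>m\<ge>M. \<forall>n\<ge>M. dist (p m) (p n) < e"
    proof (intro exI allI impI)
      fix m n assume "N \<le> m" "N \<le> n"
      then have "(norm (p m - p n))\<^sup>2 < e\<^sup>2"
        using par[OF p(1)[of m] p(1)[of n]] N[of m] N[of n] by simp
      then show "dist (p m) (p n) < e"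
        using \<open>0 < e\<close> by (simp add: dist_norm power2_less_imp_less)
    qed
  qed
  from Cauchy_convergent[OF this] obtain q where q: "p \<longlonglongrightarrow> q" unfolding convergent_def by blast
  have "q \<in> V" using closed_sequentially[OF assms(1)] p(1) q by blast
  have nq: "norm (x - q) = d"
    using LIMSEQ_unique[OF tendsto_norm[OF tendsto_diff[OF tendsto_const q]] pn] by simp
  have "inner (x - q) w = 0" if "w \<in> V" for w
  proof (cases "w = 0")
    case False
    \<comment> \<open>This \<open>t\<close> minimises the distance from \<open>x\<close> to the line
      through \<open>q\<close> in direction \<open>w\<close>; since \<open>q\<close> is already
      optimal, the inner product must vanish.\<close>
    define t where "t = inner (x - q) w / (norm w)\<^sup>2"
    have "q + t *\<^sub>R w \<in> V" using \<open>q \<in> V\<close> that assms(2) by (simp add: subspace_add subspace_scale)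
    from dle[OF this] have "(norm (x - q))\<^sup>2 \<le> (norm (x - (q + t *\<^sub>R w)))\<^sup>2"
      unfolding nq using d0 by (intro power_mono)
    also have "x - (q + t *\<^sub>R w) = (x - q) - t *\<^sub>R w" by simp
    also have "(norm ((x - q) - t *\<^sub>R w))\<^sup>2 = (norm (x - q))\<^sup>2 - 2 * t * inner (x - q) w + t\<^sup>2 * (norm w)\<^sup>2"
      unfolding power2_norm_eq_inner by (simp add: inner_diff_left inner_diff_right inner_commute power2_eq_square)
    also have "\<dots> = (norm (x - q))\<^sup>2 - (inner (x - q) w)\<^sup>2 / (norm w)\<^sup>2"
      using False by (simp add: t_def power2_eq_square field_simps)
    finally have "(inner (x - q) w)\<^sup>2 / (norm w)\<^sup>2 \<le> 0" by simp
    then show ?thesis using False by (simp add: divide_le_0_iff)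
  qed simp
  with \<open>q \<in> V\<close> that show ?thesis by blast
qed

lemma subspace_closure:
  fixes V :: "'a::real_normed_vector set"
  assumes "subspace V"
  shows "subspace (closure V)"
proof (rule subspaceI)
  show "0 \<in> closure V" using subspace_0[OF assms] closure_subset by blast
  fix x y and r :: real assume "x \<in> closure V"
  then obtain f where f: "\<And>n. f n \<in> V" "f \<longlonglongrightarrow> x" unfolding closure_sequential by blast
  have "r *\<^sub>R f n \<in> closure V" for n
    using subspace_scale[OF assms f(1)] closure_subset by blast
  then show "r *\<^sub>R x \<in> closure V"
    by (intro closed_sequentially[OF closed_closure _ tendsto_scaleR[OF tendsto_const f(2)]]) simp
  assume "y \<in> closure V"
  then obtain g where g: "\<And>n. g n \<in> V" "g \<longlonglongrightarrow> y" unfolding closure_sequential by blast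
  have "f n + g n \<in> closure V" for n
    using subspace_add[OF assms f(1) g(1)] closure_subset by blast
  then show "x + y \<in> closure V"
    by (intro closed_sequentially[OF closed_closure _ tendsto_add[OF f(2) g(2)]]) simp
qed

text \<open>If \<open>z\<close> is orthogonal to the range, then
  \<open>inner (Q z) (Q z) = \<sigma> * inner z (Q (Q z)) = 0\<close>, so \<open>z = 0\<close>. The
  factor \<open>\<sigma>\<close> covers symmetric and skew operators at once.\<close>

lemma closure_range_symmetric:
  fixes Q :: "'a::{real_inner,banach} \<Rightarrow> 'a"
  assumes "linear Q" and "\<And>x y. inner (Q x) y = \<sigma> * inner x (Q y)"
    and "\<And>x. Q x = 0 \<Longrightarrow> x = 0"
  shows "closure (range Q) = UNIV"
proof -
  have sub: "subspace (closure (range Q))"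
  proof -
    have "subspace (range Q)" by (rule linear_subspace_image[OF assms(1) subspace_UNIV])
    then show ?thesis by (rule subspace_closure)
  qed
  have "x \<in> closure (range Q)" for x
  proof -
    obtain p where p: "p \<in> closure (range Q)" "\<And>w. w \<in> closure (range Q) \<Longrightarrow> inner (x - p) w = 0"
      using closed_subspace_projection[OF closed_closure sub] by metis
    have "inner (Q (x - p)) (Q (x - p)) = \<sigma> * inner (x - p) (Q (Q (x - p)))" by (rule assms(2))
    also have "\<dots> = 0"
      using p(2)[OF subsetD[OF closure_subset rangeI, of Q "Q (x - p)"]] by simp
    finally have "x - p = 0" using assms(3)[of "x - p"] by simp
    then show ?thesis using p(1) by simp
  qed
  then show ?thesis by blast
qed

text \<open>Lax-Milgram by contraction: the solutions are the fixed points of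
  \<open>x \<mapsto> x - \<tau> *\<^sub>R (M x - y)\<close>, and coercivity makes this map shrink
  distances for a suitable \<open>\<tau>\<close>.\<close>

lemma coercive_solvable:
  fixes M :: "'a::{real_inner,banach} \<Rightarrow> 'a"
  assumes "bounded_linear M" "0 < m" and co: "\<And>x. m * (norm x)\<^sup>2 \<le> inner (M x) x"
  shows "\<exists>!x. M x = y"
proof -
  interpret M: bounded_linear M by fact
  obtain K where K: "0 < K" "\<And>x. norm (M x) \<le> norm x * K" using M.pos_bounded by blast
  \<comment> \<open>This value minimises
    \<open>1 - 2 * \<tau> * m + \<tau>\<^sup>2 * K\<^sup>2\<close>, the bound for the squared
    contraction factor.\<close>
  define \<tau> where "\<tau> = m / K\<^sup>2"
  have tau: "0 < \<tau>" using assms K by (simp add: \<tau>_def)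
  have step: "(norm (x - \<tau> *\<^sub>R M x))\<^sup>2 \<le> (1 - m\<^sup>2 / K\<^sup>2) * (norm x)\<^sup>2" for x
  proof -
    have "(norm (x - \<tau> *\<^sub>R M x))\<^sup>2 = (norm x)\<^sup>2 - 2 * \<tau> * inner (M x) x + \<tau>\<^sup>2 * (norm (M x))\<^sup>2"
      unfolding power2_norm_eq_inner by (simp add: inner_diff_left inner_diff_right inner_commute power2_eq_square)
    also have "\<dots> \<le> (norm x)\<^sup>2 - 2 * \<tau> * (m * (norm x)\<^sup>2) + \<tau>\<^sup>2 * (norm x * K)\<^sup>2"
      using co[of x] K(2)[of x] tau
      by (intro add_mono diff_mono mult_left_mono power_mono) auto
    also have "\<dots> = (1 - m\<^sup>2 / K\<^sup>2) * (norm x)\<^sup>2"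
      using K(1) by (simp add: \<tau>_def power2_eq_square field_simps)
    finally show ?thesis .
  qed
  \<comment> \<open>The maximum matters only in the zero space; otherwise
    \<open>m \<le> K\<close>.\<close>
  define q where "q = max 0 (1 - m\<^sup>2 / K\<^sup>2)"
  have q: "0 \<le> q" "q < 1" using assms K by (auto simp: q_def)
  have step2: "norm (x - \<tau> *\<^sub>R M x) \<le> sqrt q * norm x" for x
  proof (rule power2_le_imp_le)
    have "(1 - m\<^sup>2 / K\<^sup>2) * (norm x)\<^sup>2 \<le> q * (norm x)\<^sup>2" by (intro mult_right_mono) (auto simp: q_def)
    then show "(norm (x - \<tau> *\<^sub>R M x))\<^sup>2 \<le> (sqrt q * norm x)\<^sup>2"
      using step[of x] q by (simp add: power_mult_distrib)
  qed (use q in simp)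
  have "\<exists>!x. (x - \<tau> *\<^sub>R (M x - y)) = x"
  proof (rule banach_fix_type[of "sqrt q"])
    show "\<forall>x z. dist (x - \<tau> *\<^sub>R (M x - y)) (z - \<tau> *\<^sub>R (M z - y)) \<le> sqrt q * dist x z"
    proof (intro allI)
      fix x z
      have "x - \<tau> *\<^sub>R (M x - y) - (z - \<tau> *\<^sub>R (M z - y)) = (x - z) - \<tau> *\<^sub>R M (x - z)"
        by (simp add: M.diff algebra_simps)
      then show "dist (x - \<tau> *\<^sub>R (M x - y)) (z - \<tau> *\<^sub>R (M z - y)) \<le> sqrt q * dist x z"
        using step2[of "x - z"] by (simp only: dist_norm)
    qed
  qed (use q in auto)
  then show ?thesis using tau by simp
qed

section \<open>The square root of a bounded positive operator\<close>

text \<open>With \<open>T = 1 - m Q\<close> and \<open>S = (1 - Z) / sqrt m\<close>, the equation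
  \<open>S (S x) = Q x\<close> becomes \<open>(1 - Z)\<^sup>2 = 1 - T\<close>, that is
  \<open>Z = (T + Z\<^sup>2) / 2\<close>. Each iterate is a polynomial in \<open>T\<close>, which
  yields symmetry and the commutation property; the latter is what proves the root unique in
  \<open>op_sqrt_eq\<close>.\<close>

lemma operator_sqrt:
  fixes Q :: "'a::{real_inner,banach} \<Rightarrow> 'a"
  assumes bl: "bounded_linear Q" and sym: "\<And>x y. inner (Q x) y = inner x (Q y)"
    and m: "0 < m" and co: "\<And>x. m * (norm (Q x))\<^sup>2 \<le> inner (Q x) x"
  obtains S where "bounded_linear S" "\<And>x y. inner (S x) y = inner x (S y)" "\<And>x. 0 \<le> inner (S x) x"
    "\<And>x. S (S x) = Q x" "\<And>P x. bounded_linear P \<Longrightarrow> (\<And>x. P (Q x) = Q (P x)) \<Longrightarrow> P (S x) = S (P x)"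
proof -
  interpret Q: bounded_linear Q by fact
  define T where "T x = x - m *\<^sub>R Q x" for x
  have linT: "linear T"
    by (rule linearI) (simp_all add: T_def Q.add Q.scaleR algebra_simps)
  have symT: "inner (T x) y = inner x (T y)" for x y
    by (simp add: T_def inner_diff_left inner_diff_right sym)
  \<comment> \<open>The lower bound for \<open>inner (Q x) x\<close> in terms of
    \<open>norm (Q x)\<close> is what makes \<open>T\<close> nonexpansive.\<close>
  have nT: "norm (T x) \<le> norm x" for x
  proof (rule power2_le_imp_le)
    have "(norm (T x))\<^sup>2 = (norm x)\<^sup>2 - 2 * m * inner (Q x) x + m * (m * (norm (Q x))\<^sup>2)"
      unfolding power2_norm_eq_inner T_def
      by (simp add: inner_diff_left inner_diff_right inner_commute power2_eq_square)
    also have "\<dots> \<le> (norm x)\<^sup>2 - 2 * m * inner (Q x) x + m * inner (Q x) x"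
      using co[of x] m by (intro add_mono mult_left_mono) auto
    also have "\<dots> = (norm x)\<^sup>2 - m * inner (Q x) x" by simp
    also have "\<dots> \<le> (norm x)\<^sup>2"
    proof -
      have "0 \<le> m * (norm (Q x))\<^sup>2" using m by simp
      then have "0 \<le> inner (Q x) x" using co[of x] by linarith
      then show ?thesis using m by simp
    qed
    finally show "(norm (T x))\<^sup>2 \<le> (norm x)\<^sup>2" .
  qed simp
  define Y where "Y = rec_nat (\<lambda>x. 0) (\<lambda>n f x. (1/2) *\<^sub>R (T x + f (f x)))"
  have Y0: "Y 0 x = 0" and YS: "Y (Suc n) x = (1/2) *\<^sub>R (T x + Y n (Y n x))" for n x
    by (simp_all add: Y_def)
  \<comment> \<open>Replacing \<open>T\<close> by the number 1 gives a scalar iteration that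
    increases and stays below 1; its increments bound those of \<open>Y\<close>.\<close>
  define y :: "nat \<Rightarrow> real" where "y = rec_nat 0 (\<lambda>n r. (1 + r\<^sup>2) / 2)"
  have y0: "y 0 = 0" and yS: "y (Suc n) = (1 + (y n)\<^sup>2) / 2" for n
    by (simp_all add: y_def)
  have yb: "0 \<le> y n \<and> y n \<le> 1" for n
  proof (induction n)
    case (Suc n)
    then have "(y n)\<^sup>2 \<le> 1" by (simp add: power_le_one)
    then show ?case by (simp add: yS)
  qed (simp add: y0)
  have ymono: "y n \<le> y (Suc n)" for n
  proof -
    have "y (Suc n) - y n = (1 - y n)\<^sup>2 / 2" by (simp add: yS power2_eq_square field_simps)
    then show ?thesis by (metis zero_le_divide_iff zero_le_power2 zero_le_numeral diff_ge_0_iff_ge)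
  qed
  have linY: "linear (Y n)" for n
  proof (induction n)
    case 0 then show ?case by (intro linearI) (simp_all add: Y0)
  next
    case (Suc n)
    then show ?case
      by (intro linearI) (simp_all add: YS linear_add linear_scale linT scaleR_add_right)
  qed
  have comm: "P (Y n x) = Y n (P x)" if "linear P" "\<And>x. P (T x) = T (P x)" for P n x
  proof (induction n arbitrary: x)
    case 0 then show ?case by (simp add: Y0 linear_0[OF that(1)])
  next
    case (Suc n) then show ?case
      by (simp add: YS linear_add[OF that(1)] linear_scale[OF that(1)] that(2))
  qed
  have symY: "inner (Y n x) z = inner x (Y n z)" for n x z
    by (induction n arbitrary: x z) (simp_all add: Y0 YS inner_add_left inner_add_right symT)
  have YT: "Y n (T x) = T (Y n x)" for n x using comm[OF linT] by simp
  have YY: "Y k (Y n x) = Y n (Y k x)" for k n x by (rule comm[OF linY YT])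
  have nY: "norm (Y n x) \<le> y n * norm x" for n x
  proof (induction n arbitrary: x)
    case (Suc n)
    have "norm (Y n (Y n x)) \<le> y n * (y n * norm x)"
      using Suc[of "Y n x"] mult_left_mono[OF Suc[of x], of "y n"] yb[of n] by linarith
    then have "norm (T x + Y n (Y n x)) \<le> norm x + y n * (y n * norm x)"
      using nT[of x] by (intro norm_triangle_le) simp
    moreover have "norm (Y (Suc n) x) = norm (T x + Y n (Y n x)) / 2" by (simp add: YS scaleR_add_right[symmetric] del: scaleR_add_right)
    ultimately show ?case by (simp add: yS power2_eq_square algebra_simps)
  qed (simp add: Y0 y0)
  have nY1: "norm (Y n x) \<le> norm x" for n x
    using nY[of n x] yb[of n] mult_right_mono[of "y n" 1 "norm x"] by simp
  \<comment> \<open>Since the iterates commute, a difference of squares factors into sum and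
    difference, and the numbers \<open>y\<close> satisfy the same identity.\<close>
  have nD: "norm (Y (Suc n) x - Y n x) \<le> (y (Suc n) - y n) * norm x" for n x
  proof (induction n arbitrary: x)
    case 0 then show ?case using nT[of x] by (simp add: Y0 YS y0 yS)
  next
    case (Suc n)
    define d where "d = Y (Suc n) x - Y n x"
    have eq: "Y (Suc (Suc n)) x - Y (Suc n) x = (1/2) *\<^sub>R (Y (Suc n) d + Y n d)"
    proof -
      have "Y (Suc n) d + Y n d = Y (Suc n) (Y (Suc n) x) - Y n (Y n x)"
        by (simp add: d_def linear_diff[OF linY] YY[of n "Suc n"])
      then show ?thesis by (simp add: YS[of "Suc n"] YS[of n x] scaleR_diff_right[symmetric])
    qed
    have "norm (Y (Suc n) d + Y n d) \<le> y (Suc n) * norm d + y n * norm d"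
      by (intro norm_triangle_le add_mono nY)
    also have "\<dots> = (y (Suc n) + y n) * norm d" by (simp add: algebra_simps)
    also have "\<dots> \<le> (y (Suc n) + y n) * ((y (Suc n) - y n) * norm x)"
      using Suc[of x] yb[of n] yb[of "Suc n"] by (intro mult_left_mono) (auto simp: d_def)
    also have "\<dots> = 2 * ((y (Suc (Suc n)) - y (Suc n)) * norm x)"
      by (simp add: yS[of "Suc n"] yS[of n] power2_eq_square field_simps)
    finally show ?case unfolding eq by simp
  qed
  have nDk: "norm (Y (n + k) x - Y n x) \<le> (y (n + k) - y n) * norm x" for n k x
  proof (induction k)
    case (Suc k)
    have "norm (Y (n + Suc k) x - Y n x) = norm ((Y (Suc (n + k)) x - Y (n + k) x) + (Y (n + k) x - Y n x))"
      by simp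
    also have "\<dots> \<le> (y (Suc (n + k)) - y (n + k)) * norm x + (y (n + k) - y n) * norm x"
      by (intro norm_triangle_le add_mono nD Suc)
    finally show ?case by (simp add: algebra_simps)
  qed simp
  have "incseq y" using ymono by (rule incseq_SucI)
  then obtain l where l: "y \<longlonglongrightarrow> l" "\<And>n. y n \<le> l"
    using incseq_convergent[of y 1] yb by metis
  have cau: "Cauchy (\<lambda>n. Y n x)" for x
  proof (rule metric_CauchyI)
    fix e :: real assume "0 < e"
    then have "0 < e / (norm x + 1) / 2" by (simp add: add_nonneg_pos)
    then obtain N where N: "l - y N < e / (norm x + 1) / 2"
      using order_tendstoD(1)[OF l(1), of "l - e / (norm x + 1) / 2"]
      unfolding eventually_sequentially by (auto simp: algebra_simps)
    have half: "norm (Y n x - Y N x) < e / 2" if "N \<le> n" for n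
    proof -
      have "norm (Y n x - Y N x) \<le> (y n - y N) * norm x"
        using nDk[of N "n - N" x] that by simp
      also have "\<dots> \<le> (l - y N) * (norm x + 1)"
        using l(2)[of n] l(2)[of N] by (intro mult_mono) auto
      also have "\<dots> < e / (norm x + 1) / 2 * (norm x + 1)"
        using N by (intro mult_strict_right_mono) (auto simp: add_nonneg_pos)
      also have "\<dots> = e / 2" 
      proof -
        have "e / c / 2 * c = e / 2" if "c \<noteq> 0" for c using that by simp
        moreover have "norm x + 1 \<noteq> 0" using norm_ge_zero[of x] by linarith
        ultimately show ?thesis by blast
      qed
      finally show ?thesis .
    qed
    show "\<exists>M. \<forall>m\<ge>M. \<forall>n\<ge>M. dist (Y m x) (Y n x) < e"
    proof (intro exI allI impI)
      fix m n assume "N \<le> m" "N \<le> n"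
      have "dist (Y m x) (Y n x) \<le> dist (Y m x) (Y N x) + dist (Y n x) (Y N x)"
        by (rule dist_triangle2)
      then show "dist (Y m x) (Y n x) < e"
        using half[OF \<open>N \<le> m\<close>] half[OF \<open>N \<le> n\<close>] by (simp add: dist_norm)
    qed
  qed
  define Z where "Z x = lim (\<lambda>n. Y n x)" for x
  have Z: "(\<lambda>n. Y n x) \<longlonglongrightarrow> Z x" for x
    unfolding Z_def using Cauchy_convergent[OF cau] by (simp add: convergent_LIMSEQ_iff)
  have nZ: "norm (Z x) \<le> norm x" for x
    by (rule LIMSEQ_le_const2[OF tendsto_norm[OF Z]]) (use nY1 in blast)
  have linZ: "linear Z"
  proof (rule linearI)
    fix a b and r :: real
    show "Z (a + b) = Z a + Z b"
      by (rule LIMSEQ_unique[OF Z]) (simp add: linear_add[OF linY] tendsto_add[OF Z Z])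
    show "Z (r *\<^sub>R a) = r *\<^sub>R Z a"
      by (rule LIMSEQ_unique[OF Z]) (simp add: linear_scale[OF linY] tendsto_scaleR[OF tendsto_const Z])
  qed
  have symZ: "inner (Z x) z = inner x (Z z)" for x z
  proof (rule LIMSEQ_unique)
    show "(\<lambda>n. inner (Y n x) z) \<longlonglongrightarrow> inner (Z x) z" by (intro tendsto_intros Z)
    show "(\<lambda>n. inner (Y n x) z) \<longlonglongrightarrow> inner x (Z z)" unfolding symY by (intro tendsto_intros Z)
  qed
  \<comment> \<open>The iterates are uniformly nonexpansive, so pointwise convergence suffices to
    pass to the limit in the composition.\<close>
  have ZZ: "(\<lambda>n. Y n (Y n x)) \<longlonglongrightarrow> Z (Z x)" for x
  proof -
    have "(\<lambda>n. norm (Y n x - Z x)) \<longlonglongrightarrow> 0"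
      using tendsto_norm[OF tendsto_diff[OF Z tendsto_const], of x "Z x"] by simp
    then have "(\<lambda>n. Y n (Y n x - Z x)) \<longlonglongrightarrow> 0"
      by (rule Lim_null_comparison[rotated]) (simp add: nY1)
    from tendsto_add[OF this Z[of "Z x"]] show ?thesis by (simp add: linear_diff[OF linY])
  qed
  have Zeq: "Z x = (1/2) *\<^sub>R (T x + Z (Z x))" for x
  proof (rule LIMSEQ_unique)
    show "(\<lambda>n. Y (Suc n) x) \<longlonglongrightarrow> Z x" using Z by (rule LIMSEQ_Suc)
    show "(\<lambda>n. Y (Suc n) x) \<longlonglongrightarrow> (1/2) *\<^sub>R (T x + Z (Z x))"
      unfolding YS by (intro tendsto_intros ZZ)
  qed
  define S where "S x = (1 / sqrt m) *\<^sub>R (x - Z x)" for x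
  show ?thesis
  proof (rule that)
    show "bounded_linear S"
    proof (rule bounded_linear_intro)
      fix a b and r :: real
      show "S (a + b) = S a + S b" by (simp add: S_def linear_add[OF linZ] algebra_simps)
      show "S (r *\<^sub>R a) = r *\<^sub>R S a" by (simp add: S_def linear_scale[OF linZ] algebra_simps)
      have "norm (a - Z a) \<le> norm a + norm a" using norm_triangle_ineq4[of a "Z a"] nZ[of a] by linarith
      then have "(1 / sqrt m) * norm (a - Z a) \<le> (1 / sqrt m) * (norm a + norm a)"
        using m by (intro mult_left_mono) auto
      moreover have "norm (S a) = (1 / sqrt m) * norm (a - Z a)"
        using m by (simp add: S_def scaleR_diff_right[symmetric] del: scaleR_diff_right)
      ultimately show "norm (S a) \<le> norm a * (2 / sqrt m)" by (simp add: mult.commute)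
    qed
    fix x z
    show "inner (S x) z = inner x (S z)"
      by (simp add: S_def inner_diff_left inner_diff_right symZ)
    have "inner (Z x) x \<le> norm (Z x) * norm x" by (rule norm_cauchy_schwarz)
    also have "\<dots> \<le> norm x * norm x" by (intro mult_right_mono nZ) simp
    finally show "0 \<le> inner (S x) x"
      using m by (simp add: S_def inner_diff_left power2_norm_eq_inner[symmetric] power2_eq_square)
    have "S (S x) = (1 / m) *\<^sub>R (x - Z x - Z (x - Z x))"
      using m by (simp add: S_def linear_scale[OF linZ] scaleR_diff_right[symmetric])
    also have "x - Z x - Z (x - Z x) = x - 2 *\<^sub>R Z x + Z (Z x)"
      by (simp add: linear_diff[OF linZ] scaleR_2)
    also have "2 *\<^sub>R Z x = T x + Z (Z x)" by (subst Zeq) simp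
    finally show "S (S x) = Q x" using m by (simp add: T_def)
  next
    fix P x assume P: "bounded_linear P" "\<And>x. P (Q x) = Q (P x)"
    have linP: "linear P" using P(1) by (rule bounded_linear.linear)
    have "P (T x) = T (P x)" for x
      by (simp add: T_def linear_diff[OF linP] linear_scale[OF linP] P(2))
    then have PY: "P (Y n x) = Y n (P x)" for n x by (rule comm[OF linP])
    have "P (Z x) = Z (P x)"
    proof (rule LIMSEQ_unique)
      show "(\<lambda>n. P (Y n x)) \<longlonglongrightarrow> P (Z x)" by (rule bounded_linear.tendsto[OF P(1) Z])
      show "(\<lambda>n. P (Y n x)) \<longlonglongrightarrow> Z (P x)" unfolding PY by (rule Z)
    qed
    then show "P (S x) = S (P x)" by (simp add: S_def linear_scale[OF linP] linear_diff[OF linP])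
  qed
qed

section \<open>Global solutions of Lipschitz differential equations\<close>

lemma at_within_ray: "0 \<le> t \<Longrightarrow> t < T \<Longrightarrow> at t within {0..T} = at t within {0::real..}"
  by (rule at_within_nhd[where S = "{..<T}"]) auto

lemma has_vector_derivative_integral_ray:
  fixes f :: "real \<Rightarrow> 'a::banach"
  assumes "continuous_on {0..} f" "0 \<le> t"
  shows "((\<lambda>u. integral {0..u} f) has_vector_derivative f t) (at t within {0..})"
proof -
  have "continuous_on {0..t + 1} f" using assms by (auto intro: continuous_on_subset)
  then have "((\<lambda>u. integral {0..u} f) has_vector_derivative f t) (at t within {0..t + 1})"
    by (rule integral_has_vector_derivative) (use assms in auto)
  then show ?thesis using at_within_ray[of t "t + 1"] assms by simp
qed

text \<open>Against the weight \<open>exp (\<mu> * s)\<close> integration gains the factor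
  \<open>1 / \<mu>\<close>; a large \<open>\<mu>\<close> makes the Picard map a contraction on the
  whole half line.\<close>

lemma norm_integral_exp_bound:
  fixes f :: "real \<Rightarrow> 'a::banach"
  assumes "continuous_on {0..t} f" "0 \<le> t" "0 < \<mu>" "0 \<le> M"
    and "\<And>s. s \<in> {0..t} \<Longrightarrow> norm (f s) \<le> M * exp (\<mu> * s)"
  shows "norm (integral {0..t} f) \<le> M / \<mu> * exp (\<mu> * t)"
proof -
  have "((\<lambda>s. M * exp (\<mu> * s)) has_integral (M / \<mu> * exp (\<mu> * t) - M / \<mu> * exp (\<mu> * 0))) {0..t}"
  proof (rule fundamental_theorem_of_calculus[OF \<open>0 \<le> t\<close>])
    fix s
    have "((\<lambda>s. M / \<mu> * exp (\<mu> * s)) has_real_derivative M * exp (\<mu> * s)) (at s within {0..t})"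
      using \<open>0 < \<mu>\<close> by (auto intro!: derivative_eq_intros)
    then show "((\<lambda>s. M / \<mu> * exp (\<mu> * s)) has_vector_derivative M * exp (\<mu> * s)) (at s within {0..t})"
      by (simp add: has_real_derivative_iff_has_vector_derivative)
  qed
  note * = this
  have "norm (integral {0..t} f) \<le> integral {0..t} (\<lambda>s. M * exp (\<mu> * s))"
    using assms has_integral_integrable[OF *]
    by (intro integral_norm_bound_integral) (auto intro: integrable_continuous_real)
  also have "\<dots> = M / \<mu> * exp (\<mu> * t) - M / \<mu>" using integral_unique[OF *] by simp
  finally show ?thesis using assms by (smt (verit) divide_nonneg_pos)
qed

text \<open>The fixed point is sought for \<open>z t = exp (- \<mu> * t) *\<^sub>R x t\<close> among
  bounded continuous functions. The weight replaces the gluing of short-time solutions.\<close>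

lemma picard_global:
  fixes G :: "'a::banach \<Rightarrow> 'a"
  assumes lip: "\<And>x y. norm (G x - G y) \<le> L * norm (x - y)"
  obtains x where "x 0 = x0"
    "\<And>t. 0 \<le> t \<Longrightarrow> (x has_vector_derivative G (x t)) (at t within {0..})"
proof -
  define K where "K = max L 1"
  have K: "0 < K" by (simp add: K_def)
  have lipK: "norm (G x - G y) \<le> K * norm (x - y)" for x y
    using lip[of x y] mult_right_mono[of L K "norm (x - y)"] by (simp add: K_def)
  \<comment> \<open>With this rate the Lipschitz factor \<open>K / \<mu>\<close> of the Picard map
    is 1/2.\<close>
  define \<mu> where "\<mu> = 2 * K"
  have lam: "0 < \<mu>" using K by (simp add: \<mu>_def)
  have contG: "continuous_on UNIV G"
    by (rule lipschitz_on_continuous_on[of K]) (use lipK K in \<open>auto simp: lipschitz_on_def dist_norm\<close>)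
  define h where "h z s = G (exp (\<mu> * s) *\<^sub>R apply_bcontfun z s)" for z and s :: real
  have conth: "continuous_on X (h z)" for X z
    unfolding h_def by (intro continuous_on_compose2[OF contG] continuous_intros) auto
  \<comment> \<open>Bounded continuous functions live on the whole line here; \<open>max 0 t\<close>
    extends the map by the constant \<open>x0\<close> to negative times.\<close>
  define \<Phi> where "\<Phi> z (t::real) = exp (- \<mu> * max 0 t) *\<^sub>R (x0 + integral {0..max 0 t} (h z))" for z t
  have mem: "\<Phi> z \<in> bcontfun" for z
  proof (rule bcontfun_normI)
    have "continuous_on {0..} (\<lambda>u. integral {0..u} (h z))"
      unfolding continuous_on_eq_continuous_within
      using has_vector_derivative_continuous[OF has_vector_derivative_integral_ray[OF conth]] by simp
    then have "continuous_on UNIV (\<lambda>t. integral {0..max 0 t} (h z))"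
      by (rule continuous_on_compose2) (auto intro!: continuous_intros)
    then show "continuous_on UNIV (\<Phi> z)"
      unfolding \<Phi>_def by (intro continuous_intros)
    define M where "M = norm (G 0) + K * norm z"
    have M: "0 \<le> M" using K by (simp add: M_def)
    have hb: "norm (h z s) \<le> M * exp (\<mu> * s)" if "0 \<le> s" for s
    proof -
      have "norm (h z s) \<le> norm (G 0) + norm (h z s - G 0)" by (simp add: norm_triangle_sub)
      also have "norm (h z s - G 0) \<le> K * (exp (\<mu> * s) * norm (apply_bcontfun z s))"
        using lipK[of "exp (\<mu> * s) *\<^sub>R apply_bcontfun z s" 0] by (simp add: h_def)
      also have "\<dots> \<le> K * (exp (\<mu> * s) * norm z)"
        using K norm_bounded[of z s] by (intro mult_left_mono) auto
      also have "norm (G 0) + \<dots> \<le> norm (G 0) * exp (\<mu> * s) + K * (exp (\<mu> * s) * norm z)"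
        using lam that by (simp add: mult_le_cancel_left1)
      finally show ?thesis by (simp add: M_def algebra_simps)
    qed
    fix t :: real
    define u where "u = max 0 t"
    have u: "0 \<le> u" by (simp add: u_def)
    have "norm (\<Phi> z t) \<le> exp (- \<mu> * u) * (norm x0 + norm (integral {0..u} (h z)))"
      by (simp add: \<Phi>_def u_def norm_triangle_ineq)
    also have "\<dots> \<le> exp (- \<mu> * u) * (norm x0 + M / \<mu> * exp (\<mu> * u))"
      using norm_integral_exp_bound[OF conth u lam M hb] by (intro mult_left_mono add_left_mono) auto
    also have "\<dots> = exp (- \<mu> * u) * norm x0 + M / \<mu>" by (simp add: algebra_simps exp_minus)
    also have "\<dots> \<le> norm x0 + M / \<mu>" using u lam by (simp add: mult_left_le_one_le)
    finally show "norm (\<Phi> z t) \<le> norm x0 + M / \<mu>" .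
  qed
  have app: "apply_bcontfun (Bcontfun (\<Phi> z)) = \<Phi> z" for z
    by (rule Bcontfun_inverse[OF mem])
  have "\<exists>!z. Bcontfun (\<Phi> z) = z"
  proof (rule banach_fix_type[of "1/2"])
    show "\<forall>z w. dist (Bcontfun (\<Phi> z)) (Bcontfun (\<Phi> w)) \<le> 1 / 2 * dist z w"
    proof (intro allI dist_bound)
      fix z w :: "real \<Rightarrow>\<^sub>C 'a" and t :: real
      define u where "u = max 0 t"
      have u: "0 \<le> u" by (simp add: u_def)
      have "norm (h z s - h w s) \<le> K * dist z w * exp (\<mu> * s)" for s
      proof -
        have "norm (h z s - h w s) \<le> K * (exp (\<mu> * s) * norm (apply_bcontfun z s - apply_bcontfun w s))"
          using lipK[of "exp (\<mu> * s) *\<^sub>R apply_bcontfun z s" "exp (\<mu> * s) *\<^sub>R apply_bcontfun w s"]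
          by (simp add: h_def scaleR_diff_right[symmetric])
        also have "\<dots> \<le> K * (exp (\<mu> * s) * dist z w)"
          using K dist_bounded[of z s w] by (intro mult_left_mono) (auto simp: dist_norm)
        finally show ?thesis by (simp add: mult_ac)
      qed
      then have b: "norm (integral {0..u} (\<lambda>s. h z s - h w s)) \<le> K * dist z w / \<mu> * exp (\<mu> * u)"
        using K by (intro norm_integral_exp_bound continuous_intros conth u lam) auto
      have "\<Phi> z t - \<Phi> w t = exp (- \<mu> * u) *\<^sub>R integral {0..u} (\<lambda>s. h z s - h w s)"
        by (simp add: \<Phi>_def u_def scaleR_diff_right[symmetric] integral_diff integrable_continuous_real conth)
      then have "norm (\<Phi> z t - \<Phi> w t) \<le> exp (- \<mu> * u) * (K * dist z w / \<mu> * exp (\<mu> * u))"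
        using mult_left_mono[OF b, of "exp (- \<mu> * u)"] by simp
      also have "\<dots> = dist z w / 2" using K by (simp add: \<mu>_def exp_minus)
      finally show "dist (apply_bcontfun (Bcontfun (\<Phi> z)) t) (apply_bcontfun (Bcontfun (\<Phi> w)) t) \<le> 1 / 2 * dist z w"
        unfolding app by (simp add: dist_norm)
    qed
  qed auto
  then obtain z where "Bcontfun (\<Phi> z) = z" by blast
  then have zt: "apply_bcontfun z t = \<Phi> z t" for t using app by metis
  define x where "x t = exp (\<mu> * t) *\<^sub>R apply_bcontfun z t" for t
  have xeq: "x t = x0 + integral {0..t} (h z)" if "0 \<le> t" for t
    using that by (simp add: x_def zt \<Phi>_def max_def exp_minus)
  show ?thesis
  proof (rule that)
    show "x 0 = x0" using xeq[of 0] by simp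
    fix t :: real assume t: "0 \<le> t"
    have "((\<lambda>u. x0 + integral {0..u} (h z)) has_vector_derivative h z t) (at t within {0..})"
      using has_vector_derivative_add[OF has_vector_derivative_const has_vector_derivative_integral_ray[OF conth t]]
      by simp
    moreover have "h z t = G (x t)" by (simp add: h_def x_def)
    ultimately show "(x has_vector_derivative G (x t)) (at t within {0..})"
      using has_vector_derivative_transform[of t "{0..}" x "\<lambda>u. x0 + integral {0..u} (h z)"] t xeq
      by simp
  qed
qed

section \<open>Semilinear evolution equations with skew-adjoint generator\<close>

text \<open>This is the shape of \<open>has_derivX\<close>, with \<open>norm\<close> in place of
  \<open>normX\<close>, so that the two notions can be compared.\<close>

lemma has_vector_derivative_iff_quotient:
  fixes f :: "real \<Rightarrow> 'a::real_normed_vector"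
  shows "(f has_vector_derivative d) (at t within S) \<longleftrightarrow>
    ((\<lambda>s. norm ((f s - f t) /\<^sub>R (s - t) - d)) \<longlongrightarrow> 0) (at t within S)"
proof -
  have "norm ((f s - f t - (s - t) *\<^sub>R d) /\<^sub>R norm (s - t)) = norm ((f s - f t) /\<^sub>R (s - t) - d)"
    if "s \<noteq> t" for s
  proof -
    have "(f s - f t) /\<^sub>R (s - t) - d = (f s - f t - (s - t) *\<^sub>R d) /\<^sub>R (s - t)"
      using that by (simp add: scaleR_diff_right)
    then show ?thesis by simp
  qed
  then have "((\<lambda>s. norm ((f s - f t - (s - t) *\<^sub>R d) /\<^sub>R norm (s - t))) \<longlongrightarrow> 0) (at t within S) \<longleftrightarrow>
     ((\<lambda>s. norm ((f s - f t) /\<^sub>R (s - t) - d)) \<longlongrightarrow> 0) (at t within S)"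
    by (intro filterlim_cong) (auto simp: eventually_at_filter)
  then show ?thesis
    unfolding has_vector_derivative_def has_derivative_at_within
    by (simp only: tendsto_norm_zero_iff bounded_linear_scaleR_left simp_thms)
qed

text \<open>A bound on the distance between a trajectory and its time shift passes to the right
  derivatives. It controls \<open>w'\<close> without differentiating the nonlinearity.\<close>

lemma norm_right_derivative_le:
  fixes w :: "real \<Rightarrow> 'a::real_normed_vector"
  assumes w: "(w has_vector_derivative d) (at t within {0..})" and "0 \<le> t"
    and le: "\<And>h. 0 < h \<Longrightarrow> norm (w (t + h) - w t) \<le> C * norm (w h - w 0)"
    and w0: "(w has_vector_derivative d0) (at 0 within {0..})"
  shows "norm d \<le> C * norm d0"
proof -
  define h where "h n = inverse (real (Suc n))" for n
  have h0: "h \<longlonglongrightarrow> 0" "\<And>n. 0 < h n" unfolding h_def by (rule LIMSEQ_inverse_real_of_nat) simp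
  have lim: "(\<lambda>n. norm ((w (t + h n) - w t) /\<^sub>R h n)) \<longlonglongrightarrow> norm d"
    if w: "(w has_vector_derivative d) (at t within {0..})" and "0 \<le> t" for t d
  proof -
    have "filterlim (\<lambda>n. t + h n) (at t within {0..}) sequentially"
      unfolding filterlim_at using tendsto_add[OF tendsto_const[of t] h0(1)] h0(2) \<open>0 \<le> t\<close>
      by (auto simp: less_imp_le less_imp_neq[symmetric] add_nonneg_nonneg)
    from filterlim_compose[OF w[unfolded has_vector_derivative_iff_quotient] this]
    have "(\<lambda>n. norm ((w (t + h n) - w t) /\<^sub>R h n - d)) \<longlonglongrightarrow> 0" by simp
    then have "(\<lambda>n. (w (t + h n) - w t) /\<^sub>R h n) \<longlonglongrightarrow> d"
      by (simp add: tendsto_norm_zero_iff LIM_zero_iff)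
    then show ?thesis by (rule tendsto_norm)
  qed
  show ?thesis
  proof (rule LIMSEQ_le[OF lim[OF w \<open>0 \<le> t\<close>] tendsto_mult[OF tendsto_const lim[OF w0]]])
    have "norm ((w (t + h n) - w t) /\<^sub>R h n) \<le> C * norm ((w (0 + h n) - w 0) /\<^sub>R h n)" for n
      using le[OF h0(2)[of n]] h0(2)[of n] by (simp add: mult_left_mono mult.left_commute)
    then show "\<exists>N. \<forall>n\<ge>N. norm ((w (t + h n) - w t) /\<^sub>R h n) \<le> C * norm ((w (0 + h n) - w 0) /\<^sub>R h n)"
      by blast
  qed simp
qed

section \<open>Yosida approximation of a skew-adjoint operator\<close>

text \<open>The domain of the generator is \<open>range R\<close>, and injectivity allows identities
  to be checked after a further application of \<open>R\<close>.\<close>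

locale skew_inverse =
  fixes R :: "'a::{real_inner,banach} \<Rightarrow> 'a"
  assumes bounded_linear_R: "bounded_linear R"
    and skew: "inner (R x) y = - inner x (R y)"
    and inj0: "R x = 0 \<Longrightarrow> x = 0"
begin

sublocale R: bounded_linear R by (rule bounded_linear_R)

lemma inner_R_self [simp]: "inner (R x) x = 0" "inner x (R x) = 0"
  using skew[of x x] by (simp_all add: inner_commute)

text \<open>The Yosida approximation of the unbounded operator inverse to \<open>R\<close>.\<close>

definition yosida :: "real \<Rightarrow> 'a \<Rightarrow> 'a" where
  "yosida \<epsilon> y = (THE t. R t - \<epsilon> *\<^sub>R t = y)"

text \<open>Skewness makes \<open>\<epsilon> - R\<close> coercive with constant
  \<open>\<epsilon>\<close>. With \<open>K\<close> inverse to \<open>R\<close>, the solution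
  operator is \<open>K\<close> followed by the inverse of \<open>1 - \<epsilon> K\<close>.\<close>

lemma yosida_ex1:
  assumes "0 < \<epsilon>" shows "\<exists>!t. R t - \<epsilon> *\<^sub>R t = y"
proof -
  have "\<exists>!t. \<epsilon> *\<^sub>R t - R t = - y"
  proof (rule coercive_solvable[OF _ assms])
    show "bounded_linear (\<lambda>t. \<epsilon> *\<^sub>R t - R t)"
      by (intro bounded_linear_sub bounded_linear_R bounded_linear_scaleR_right)
  qed (simp add: inner_diff_left power2_norm_eq_inner)
  moreover have "\<epsilon> *\<^sub>R t - R t = - y \<longleftrightarrow> R t - \<epsilon> *\<^sub>R t = y" for t
    by (metis minus_diff_eq minus_minus)
  ultimately show ?thesis by simp
qed

context
  fixes \<epsilon> :: real
  assumes eps: "0 < \<epsilon>"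
begin

lemma yosida_eq: "R (yosida \<epsilon> y) - \<epsilon> *\<^sub>R yosida \<epsilon> y = y"
  unfolding yosida_def by (rule theI'[OF yosida_ex1[OF eps]])

lemma yosida_unique: "R t - \<epsilon> *\<^sub>R t = y \<Longrightarrow> yosida \<epsilon> y = t"
  using yosida_ex1[OF eps] yosida_eq by blast

lemma R_yosida: "R (yosida \<epsilon> y) = y + \<epsilon> *\<^sub>R yosida \<epsilon> y"
  using yosida_eq[of y] by (simp add: algebra_simps)

lemma yosida_diff: "yosida \<epsilon> (x - y) = yosida \<epsilon> x - yosida \<epsilon> y"
  by (rule yosida_unique) (simp add: R.diff R_yosida algebra_simps)

lemma yosida_R: "yosida \<epsilon> (R y) = R (yosida \<epsilon> y)"
proof (rule yosida_unique)
  have "R (R (yosida \<epsilon> y)) - \<epsilon> *\<^sub>R R (yosida \<epsilon> y) = R (R (yosida \<epsilon> y) - \<epsilon> *\<^sub>R yosida \<epsilon> y)"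
    by (simp add: R.diff R.scaleR)
  then show "R (R (yosida \<epsilon> y)) - \<epsilon> *\<^sub>R R (yosida \<epsilon> y) = R y" by (simp add: yosida_eq)
qed

text \<open>\<open>R t\<close> is orthogonal to \<open>t\<close>, so this is Pythagoras for
  \<open>y = R t - \<epsilon> *\<^sub>R t\<close>. It bounds \<open>yosida \<epsilon>\<close> by
  \<open>1 / \<epsilon>\<close>, and its composition with \<open>R\<close> by 1 uniformly in
  \<open>\<epsilon>\<close>.\<close>

lemma norm_yosida_sum: "(norm (R (yosida \<epsilon> y)))\<^sup>2 + (\<epsilon> * norm (yosida \<epsilon> y))\<^sup>2 = (norm y)\<^sup>2"
proof -
  have "(norm y)\<^sup>2 = (norm (R (yosida \<epsilon> y) - \<epsilon> *\<^sub>R yosida \<epsilon> y))\<^sup>2" by (simp only: yosida_eq)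
  also have "\<dots> = (norm (R (yosida \<epsilon> y)))\<^sup>2 + (\<epsilon> * norm (yosida \<epsilon> y))\<^sup>2"
    unfolding power_mult_distrib power2_norm_eq_inner
    by (simp add: inner_diff_left inner_diff_right power2_eq_square)
  finally show ?thesis by simp
qed

lemma norm_R_yosida: "norm (R (yosida \<epsilon> y)) \<le> norm y"
proof (rule power2_le_imp_le)
  show "(norm (R (yosida \<epsilon> y)))\<^sup>2 \<le> (norm y)\<^sup>2"
    using norm_yosida_sum[of y] zero_le_power2[of "\<epsilon> * norm (yosida \<epsilon> y)"] by linarith
qed simp

lemma norm_yosida: "norm (yosida \<epsilon> y) \<le> norm y / \<epsilon>"
proof -
  have "\<epsilon> * norm (yosida \<epsilon> y) \<le> norm y"
  proof (rule power2_le_imp_le)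
    show "(\<epsilon> * norm (yosida \<epsilon> y))\<^sup>2 \<le> (norm y)\<^sup>2"
      using norm_yosida_sum[of y] zero_le_power2[of "norm (R (yosida \<epsilon> y))"] by linarith
  qed simp
  then show ?thesis using eps by (simp add: field_simps)
qed

lemma yosida_dissipative: "inner (yosida \<epsilon> y) y \<le> 0"
proof -
  have "inner (yosida \<epsilon> y) y = inner (yosida \<epsilon> y) (R (yosida \<epsilon> y) - \<epsilon> *\<^sub>R yosida \<epsilon> y)"
    by (simp only: yosida_eq)
  also have "\<dots> = - \<epsilon> * (norm (yosida \<epsilon> y))\<^sup>2"
    by (simp add: inner_diff_right power2_norm_eq_inner)
  finally show ?thesis using eps by simp
qed

end

text \<open>Up to terms with the factors \<open>\<epsilon>\<close> and \<open>\<delta>\<close> the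
  difference \<open>y - z\<close> is \<open>R (a - b)\<close>, which is orthogonal to
  \<open>a - b\<close>. Approximations with different parameters therefore separate slowly as long
  as their Yosida terms stay bounded.\<close>

lemma yosida_cross:
  assumes "0 < \<epsilon>" "0 < \<delta>" and k: "norm (yosida \<epsilon> y) \<le> \<kappa>" "norm (yosida \<delta> z) \<le> \<kappa>"
  shows "inner (yosida \<epsilon> y - yosida \<delta> z) (y - z) \<le> 2 * \<kappa>\<^sup>2 * (\<epsilon> + \<delta>)"
proof -
  define a where "a = yosida \<epsilon> y"
  define b where "b = yosida \<delta> z"
  have yz: "y - z = R (a - b) + (\<delta> *\<^sub>R b - \<epsilon> *\<^sub>R a)"
    using yosida_eq[OF assms(1), of y] yosida_eq[OF assms(2), of z]
    by (simp add: a_def b_def R.diff algebra_simps)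
  have k0: "0 \<le> \<kappa>" using k(1) norm_ge_zero order_trans by blast
  have "inner (a - b) (y - z) = inner (a - b) (\<delta> *\<^sub>R b - \<epsilon> *\<^sub>R a)"
    unfolding yz inner_add_right by simp
  also have "\<dots> \<le> norm (a - b) * norm (\<delta> *\<^sub>R b - \<epsilon> *\<^sub>R a)" by (rule norm_cauchy_schwarz)
  also have "\<dots> \<le> (2 * \<kappa>) * (\<kappa> * (\<epsilon> + \<delta>))"
  proof (rule mult_mono)
    show "norm (a - b) \<le> 2 * \<kappa>"
      using norm_triangle_ineq4[of a b] k by (simp add: a_def b_def)
    have "norm (\<delta> *\<^sub>R b - \<epsilon> *\<^sub>R a) \<le> \<delta> * norm b + \<epsilon> * norm a"
      using norm_triangle_ineq4[of "\<delta> *\<^sub>R b" "\<epsilon> *\<^sub>R a"] assms by simp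
    also have "\<dots> \<le> \<delta> * \<kappa> + \<epsilon> * \<kappa>"
      using assms by (intro add_mono mult_left_mono) (auto simp: a_def b_def)
    finally show "norm (\<delta> *\<^sub>R b - \<epsilon> *\<^sub>R a) \<le> \<kappa> * (\<epsilon> + \<delta>)" by (simp add: algebra_simps)
  qed (use k0 in auto)
  finally show ?thesis by (simp add: a_def b_def power2_eq_square mult_ac)
qed

lemma closure_range_R: "closure (range R) = UNIV"
  by (rule closure_range_symmetric[where \<sigma> = "-1"])
     (auto simp: skew inj0 bounded_linear.linear[OF bounded_linear_R])

text \<open>The Yosida equations \<open>w' = yosida \<epsilon> w + N w\<close> have Lipschitz
  right-hand sides. Their solutions converge uniformly for initial values in \<open>range R\<close>,
  where the Yosida terms stay bounded as \<open>\<epsilon>\<close> tends to 0, and then for all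
  initial values by density. The limit \<open>y\<close> is merely known to be continuous, so the
  equation \<open>y' = K y + N y\<close> is stated after applying \<open>R\<close>. The final bound
  contains \<open>L1\<close> and not \<open>L\<close>, which the cut-off argument depends
  on.\<close>

lemma lipschitz_evolution:
  assumes N: "\<And>y z. norm (N y - N z) \<le> L * norm (y - z)" and "0 \<le> T"
    and L0: "0 \<le> L0" "\<And>y. norm (R (N y)) \<le> L0 * norm (R y)"
    and L1: "0 \<le> L1" "\<And>y. norm (R y) \<le> exp (L0 * T) * norm (R y0) \<Longrightarrow> norm (N y) \<le> L1 * norm y"
  obtains y where "continuous_on {0..T} y" "y 0 = y0"
    "\<And>t. t \<in> {0..T} \<Longrightarrow> ((\<lambda>t. R (y t)) has_vector_derivative y t + R (N (y t))) (at t within {0..T})"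
    "\<And>t. t \<in> {0..T} \<Longrightarrow> norm (y t) \<le> exp (L1 * T) * norm y0"
proof -
  define K where "K = max L 0"
  have K0: "0 \<le> K" by (simp add: K_def)
  have NK: "norm (N y - N z) \<le> K * norm (y - z)" for y z
    using N[of y z] mult_right_mono[of L K "norm (y - z)"] by (simp add: K_def)
  have N0: "N 0 = 0" using L0(2)[of 0] by (simp add: R.zero inj0)
  have Nn: "norm (N y) \<le> K * norm y" for y using NK[of y 0] by (simp add: N0)
  have "\<exists>w. w 0 = b \<and> (\<forall>t\<ge>0. (w has_vector_derivative yosida \<epsilon> (w t) + N (w t)) (at t within {0..}))"
    if "0 < \<epsilon>" for \<epsilon> b
  proof -
    have "norm (yosida \<epsilon> y + N y - (yosida \<epsilon> z + N z)) \<le> (1 / \<epsilon> + K) * norm (y - z)" for y z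
    proof -
      have "norm (yosida \<epsilon> y + N y - (yosida \<epsilon> z + N z)) = norm (yosida \<epsilon> (y - z) + (N y - N z))"
        by (simp add: yosida_diff[OF that] algebra_simps)
      also have "\<dots> \<le> norm (y - z) / \<epsilon> + K * norm (y - z)"
        by (intro norm_triangle_le add_mono norm_yosida[OF that] NK)
      finally show ?thesis by (simp add: algebra_simps)
    qed
    from picard_global[OF this, of b] show ?thesis by metis
  qed
  then obtain W where W0: "\<And>\<epsilon> b. 0 < \<epsilon> \<Longrightarrow> W \<epsilon> b 0 = b"
    and Wd: "\<And>\<epsilon> b t. 0 < \<epsilon> \<Longrightarrow> 0 \<le> t \<Longrightarrow>
      (W \<epsilon> b has_vector_derivative yosida \<epsilon> (W \<epsilon> b t) + N (W \<epsilon> b t)) (at t within {0..})"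
    by metis
  \<comment> \<open>For two solutions with the same \<open>\<epsilon>\<close> the Yosida part is
    dissipative, so the rate is \<open>K\<close> uniformly in \<open>\<epsilon>\<close>.\<close>
  have dep: "norm (v t - w t) \<le> exp (K * t) * norm (v 0 - w 0)"
    if "0 < \<epsilon>" "0 \<le> t"
      "\<And>t. 0 \<le> t \<Longrightarrow> (v has_vector_derivative yosida \<epsilon> (v t) + N (v t)) (at t within {0..})"
      "\<And>t. 0 \<le> t \<Longrightarrow> (w has_vector_derivative yosida \<epsilon> (w t) + N (w t)) (at t within {0..})"
    for \<epsilon> v w t
  proof (rule gronwall_norm_linear[OF that(2) K0])
    fix s assume s: "s \<in> {0..t}"
    show "((\<lambda>s. v s - w s) has_vector_derivative (yosida \<epsilon> (v s) + N (v s) - (yosida \<epsilon> (w s) + N (w s))))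
        (at s within {0..t})"
      using s by (intro has_vector_derivative_diff has_vector_derivative_within_subset[OF that(3)]
          has_vector_derivative_within_subset[OF that(4)]) auto
    have "inner (yosida \<epsilon> (v s) + N (v s) - (yosida \<epsilon> (w s) + N (w s))) (v s - w s)
      = inner (yosida \<epsilon> (v s - w s)) (v s - w s) + inner (N (v s) - N (w s)) (v s - w s)"
      by (simp add: yosida_diff[OF that(1)] inner_diff_left inner_add_left)
    also have "\<dots> \<le> 0 + norm (N (v s) - N (w s)) * norm (v s - w s)"
      by (intro add_mono yosida_dissipative[OF that(1)] norm_cauchy_schwarz)
    also have "\<dots> \<le> K * norm (v s - w s) * norm (v s - w s)"
      using mult_right_mono[OF NK] by simp
    finally show "inner (yosida \<epsilon> (v s) + N (v s) - (yosida \<epsilon> (w s) + N (w s))) (v s - w s)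
        \<le> K * (norm (v s - w s))\<^sup>2" by (simp add: power2_eq_square)
  qed
  have expmono: "exp (k * t) * r \<le> exp (k * T) * r" if "0 \<le> k" "t \<le> T" "0 \<le> r" for k t r
    using that by (intro mult_right_mono) (auto intro: mult_left_mono)
  have depT: "norm (W \<epsilon> b t - W \<epsilon> b' t) \<le> exp (K * T) * norm (b - b')"
    if "0 < \<epsilon>" "t \<in> {0..T}" for \<epsilon> t b b'
    using dep[OF that(1), of t "W \<epsilon> b" "W \<epsilon> b'"] Wd[OF that(1)] W0[OF that(1)] that
      expmono[OF K0, of t "norm (b - b')"] by (auto intro: order_trans)
  \<comment> \<open>For the initial value \<open>R z\<close> the Yosida term at time 0 is
    \<open>R (yosida \<epsilon> z)\<close>, bounded by \<open>norm z\<close>. Comparing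
    \<open>w\<close> with its time shift, again a solution, carries the bound on \<open>w'\<close>
    to later times.\<close>
  have yosb: "norm (yosida \<epsilon> (W \<epsilon> (R z) t)) \<le> exp (K * T) * (norm z + 2 * K * norm (R z))"
    if "0 < \<epsilon>" and t: "t \<in> {0..T}" for \<epsilon> z t
  proof -
    define w where "w = W \<epsilon> (R z)"
    note wd = Wd[OF that(1), of _ "R z", folded w_def]
    have w0: "w 0 = R z" using W0[OF that(1)] by (simp add: w_def)
    have "norm (yosida \<epsilon> (w t) + N (w t)) \<le> exp (K * t) * norm (yosida \<epsilon> (w 0) + N (w 0))"
    proof (rule norm_right_derivative_le[OF wd _ _ wd])
      fix h :: real assume h: "0 < h"
      have "((\<lambda>s. w (s + h)) has_vector_derivative yosida \<epsilon> (w (s + h)) + N (w (s + h))) (at s within {0..})"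
        if "0 \<le> s" for s
      proof -
        have "((\<lambda>s. s + h) has_vector_derivative 1) (at s within {0..})"
          by (auto intro!: derivative_eq_intros)
        moreover have "(w has_vector_derivative yosida \<epsilon> (w (s + h)) + N (w (s + h)))
            (at (s + h) within (\<lambda>s. s + h) ` {0..})"
          by (rule has_vector_derivative_within_subset[OF wd]) (use that h in auto)
        ultimately show ?thesis using vector_diff_chain_within by (fastforce simp: o_def)
      qed
      from dep[OF that(1) _ this wd, of t]
      show "norm (w (t + h) - w t) \<le> exp (K * t) * norm (w h - w 0)" using t by simp
    qed (use t in auto)
    also have "\<dots> \<le> exp (K * T) * (norm z + K * norm (R z))"
    proof (rule mult_mono)
      have "norm (yosida \<epsilon> (R z)) \<le> norm z"
        unfolding yosida_R[OF that(1)] by (rule norm_R_yosida[OF that(1)])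
      then show "norm (yosida \<epsilon> (w 0) + N (w 0)) \<le> norm z + K * norm (R z)"
        unfolding w0 by (intro norm_triangle_le add_mono Nn)
    qed (use t K0 in \<open>auto intro: mult_left_mono\<close>)
    finally have 1: "norm (yosida \<epsilon> (w t) + N (w t)) \<le> exp (K * T) * (norm z + K * norm (R z))" .
    have "W \<epsilon> 0 t = 0"
    proof -
      have "((\<lambda>_. 0) has_vector_derivative yosida \<epsilon> 0 + N 0) (at s within {0..})" for s
        using yosida_diff[OF that(1), of 0 0] by (simp add: N0 has_vector_derivative_const)
      from dep[OF that(1) _ Wd[OF that(1), of _ 0] this, of t] show ?thesis
        using t W0[OF that(1)] by simp
    qed
    then have "norm (w t) \<le> exp (K * T) * norm (R z)"
      using depT[OF that, of "R z" 0] by (simp add: w_def)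
    then have "norm (N (w t)) \<le> K * (exp (K * T) * norm (R z))"
      using Nn[of "w t"] mult_left_mono[OF _ K0] order_trans by blast
    then show ?thesis
      using 1 norm_triangle_ineq4[of "yosida \<epsilon> (w t) + N (w t)" "N (w t)"]
      by (simp add: w_def algebra_simps)
  qed
  \<comment> \<open>The interaction of the two Yosida terms is of order
    \<open>\<epsilon> + \<delta>\<close> in the squared norm, hence the square root.\<close>
  have cross: "norm (W \<epsilon> (R z) t - W \<delta> (R z) t)
      \<le> 2 * exp (K * T) * (exp (K * T) * (norm z + 2 * K * norm (R z))) * sqrt (T * (\<epsilon> + \<delta>))"
    if e: "0 < \<epsilon>" "0 < \<delta>" and t: "t \<in> {0..T}" for \<epsilon> \<delta> z t
  proof -
    define \<kappa> where "\<kappa> = exp (K * T) * (norm z + 2 * K * norm (R z))"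
    have k0: "0 \<le> \<kappa>" using K0 by (simp add: \<kappa>_def)
    define v where "v = W \<epsilon> (R z)"
    define w where "w = W \<delta> (R z)"
    have "(norm (v t - w t))\<^sup>2 \<le> ((norm (v 0 - w 0))\<^sup>2 + 2 * (2 * \<kappa>\<^sup>2 * (\<epsilon> + \<delta>)) * t) * exp (2 * K * t)"
    proof (rule gronwall_norm)
      fix s assume s: "s \<in> {0..t}"
      then have sT: "s \<in> {0..T}" using t by auto
      show "((\<lambda>s. v s - w s) has_vector_derivative (yosida \<epsilon> (v s) + N (v s) - (yosida \<delta> (w s) + N (w s))))
          (at s within {0..t})"
        using s unfolding v_def w_def
        by (intro has_vector_derivative_diff has_vector_derivative_within_subset[OF Wd[OF e(1)]]
            has_vector_derivative_within_subset[OF Wd[OF e(2)]]) auto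
      have "inner (yosida \<epsilon> (v s) + N (v s) - (yosida \<delta> (w s) + N (w s))) (v s - w s)
        = inner (yosida \<epsilon> (v s) - yosida \<delta> (w s)) (v s - w s) + inner (N (v s) - N (w s)) (v s - w s)"
        by (simp add: inner_diff_left inner_add_left)
      also have "\<dots> \<le> 2 * \<kappa>\<^sup>2 * (\<epsilon> + \<delta>) + norm (N (v s) - N (w s)) * norm (v s - w s)"
        using yosb[OF e(1) sT, of z] yosb[OF e(2) sT, of z]
        by (intro add_mono yosida_cross[OF e] norm_cauchy_schwarz) (simp_all add: v_def w_def \<kappa>_def)
      also have "\<dots> \<le> 2 * \<kappa>\<^sup>2 * (\<epsilon> + \<delta>) + K * norm (v s - w s) * norm (v s - w s)"
        using mult_right_mono[OF NK] by simp
      finally show "inner (yosida \<epsilon> (v s) + N (v s) - (yosida \<delta> (w s) + N (w s))) (v s - w s)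
        \<le> 2 * \<kappa>\<^sup>2 * (\<epsilon> + \<delta>) + K * (norm (v s - w s))\<^sup>2" by (simp add: power2_eq_square mult.assoc)
    qed (use t e K0 in auto)
    also have "v 0 - w 0 = 0" using W0 e by (simp add: v_def w_def)
    also have "((norm (0::'a))\<^sup>2 + 2 * (2 * \<kappa>\<^sup>2 * (\<epsilon> + \<delta>)) * t) * exp (2 * K * t)
        \<le> (2 * (2 * \<kappa>\<^sup>2 * (\<epsilon> + \<delta>)) * T) * exp (2 * K * T)"
      using t e K0 by (intro mult_mono) (auto intro!: mult_left_mono)
    also have "\<dots> = (2 * exp (K * T) * \<kappa> * sqrt (T * (\<epsilon> + \<delta>)))\<^sup>2"
      using e \<open>0 \<le> T\<close> by (simp add: power_mult_distrib exp_double mult.assoc)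
    finally have "norm (v t - w t) \<le> 2 * exp (K * T) * \<kappa> * sqrt (T * (\<epsilon> + \<delta>))"
      by (rule power2_le_imp_le) (use e k0 \<open>0 \<le> T\<close> in auto)
    then show ?thesis by (simp add: v_def w_def \<kappa>_def)
  qed
  define e where "e n = inverse (real (Suc n))" for n
  have e0: "0 < e n" for n by (simp add: e_def)
  have elim: "e \<longlonglongrightarrow> 0" unfolding e_def by (rule LIMSEQ_inverse_real_of_nat)
  define w where "w n = W (e n) y0" for n
  note wd = Wd[OF e0, of _ _ y0, folded w_def]
  have w0: "w n 0 = y0" for n using W0[OF e0] by (simp add: w_def)
  have "uniformly_Cauchy_on {0..T} w"
  proof (rule uniformly_Cauchy_onI)
    fix \<eta> :: real assume "0 < \<eta>"
    then have "0 < \<eta> / (3 * exp (K * T))" by simp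
    then obtain z where z: "norm (R z - y0) < \<eta> / (3 * exp (K * T))"
      using closure_range_R closure_approachable[of y0 "range R"] by (auto simp: dist_norm)
    \<comment> \<open>Three contributions below \<open>\<eta> / 3\<close> are arranged: replacing
      \<open>y0\<close> by \<open>R z\<close> for each of the two parameters, and changing the
      parameter for the initial value \<open>R z\<close>.\<close>
    define A where "A = 2 * exp (K * T) * (exp (K * T) * (norm z + 2 * K * norm (R z)))"
    have A0: "0 \<le> A" using K0 by (simp add: A_def)
    have "(\<lambda>n. A * sqrt (T * (e n + e n))) \<longlonglongrightarrow> A * sqrt (T * (0 + 0))"
      by (intro tendsto_intros elim)
    then have "\<forall>\<^sub>F n in sequentially. A * sqrt (T * (e n + e n)) < \<eta> / 3"
      using \<open>0 < \<eta>\<close> by (intro order_tendstoD(2)) auto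
    then obtain M where M: "A * sqrt (T * (e M + e M)) < \<eta> / 3"
      unfolding eventually_sequentially by blast
    show "\<exists>M. \<forall>t\<in>{0..T}. \<forall>m\<ge>M. \<forall>n\<ge>M. dist (w m t) (w n t) < \<eta>"
    proof (intro exI ballI allI impI)
      fix t m n assume t: "t \<in> {0..T}" and mn: "M \<le> m" "M \<le> n"
      have em: "e m \<le> e M" "e n \<le> e M" using mn by (simp_all add: e_def)
      have near: "norm (W (e k) y0 t - W (e k) (R z) t) < \<eta> / 3" for k
      proof -
        have "norm (W (e k) y0 t - W (e k) (R z) t) \<le> exp (K * T) * norm (R z - y0)"
          using depT[OF e0 t] by (simp add: norm_minus_commute)
        also have "\<dots> < exp (K * T) * (\<eta> / (3 * exp (K * T)))"
          using z by (intro mult_strict_left_mono) auto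
        finally show ?thesis by simp
      qed
      have "norm (W (e m) (R z) t - W (e n) (R z) t) \<le> A * sqrt (T * (e m + e n))"
        using cross[OF e0 e0 t] by (simp add: A_def)
      also have "\<dots> \<le> A * sqrt (T * (e M + e M))"
        using em \<open>0 \<le> T\<close> A0 by (intro mult_left_mono real_sqrt_le_mono add_mono) auto
      also have "\<dots> < \<eta> / 3" by (rule M)
      finally have mid: "norm (W (e m) (R z) t - W (e n) (R z) t) < \<eta> / 3" .
      have "w m t - w n t = (W (e m) y0 t - W (e m) (R z) t) + (W (e m) (R z) t - W (e n) (R z) t)
          - (W (e n) y0 t - W (e n) (R z) t)" by (simp add: w_def)
      then have "norm (w m t - w n t) < \<eta> / 3 + \<eta> / 3 + \<eta> / 3"
        using near[of m] near[of n] mid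
          norm_triangle_ineq4[of "(W (e m) y0 t - W (e m) (R z) t) + (W (e m) (R z) t - W (e n) (R z) t)"
            "W (e n) y0 t - W (e n) (R z) t"]
          norm_triangle_ineq[of "W (e m) y0 t - W (e m) (R z) t" "W (e m) (R z) t - W (e n) (R z) t"]
        by simp
      then show "dist (w m t) (w n t) < \<eta>" by (simp add: dist_norm)
    qed
  qed
  then obtain y where y: "uniform_limit {0..T} w y sequentially"
    using Cauchy_uniformly_convergent unfolding uniformly_convergent_on_def by blast
  have ylim: "(\<lambda>n. w n t) \<longlonglongrightarrow> y t" if "t \<in> {0..T}" for t
    using tendsto_uniform_limitI[OF y that] .
  have contw: "continuous_on {0..T} (w n)" for n
    unfolding continuous_on_eq_continuous_within
    by (auto intro!: has_vector_derivative_continuous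
        intro: has_vector_derivative_within_subset[OF wd])
  have conty: "continuous_on {0..T} y"
    by (rule uniform_limit_theorem[OF _ y]) (auto simp: contw)
  \<comment> \<open>\<open>R\<close> commutes with \<open>yosida \<epsilon>\<close>, so
    \<open>R w\<close> satisfies an equation with a dissipative part as well, now with growth rate
    \<open>L0\<close>. This keeps \<open>w\<close> in the region where the bound with
    \<open>L1\<close> is available.\<close>
  have Rw: "norm (R (w n t)) \<le> exp (L0 * T) * norm (R y0)" if t: "t \<in> {0..T}" for n t
  proof -
    have "norm (R (w n t)) \<le> exp (L0 * t) * norm (R (w n 0))"
    proof (rule gronwall_norm_linear)
      fix s assume s: "s \<in> {0..t}"
      show "((\<lambda>s. R (w n s)) has_vector_derivative R (yosida (e n) (w n s) + N (w n s))) (at s within {0..t})"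
        using s by (intro R.has_vector_derivative has_vector_derivative_within_subset[OF wd]) auto
      have "inner (R (yosida (e n) (w n s) + N (w n s))) (R (w n s))
          = inner (yosida (e n) (R (w n s))) (R (w n s)) + inner (R (N (w n s))) (R (w n s))"
        by (simp add: R.add inner_add_left yosida_R[OF e0])
      also have "\<dots> \<le> 0 + norm (R (N (w n s))) * norm (R (w n s))"
        by (intro add_mono yosida_dissipative[OF e0] norm_cauchy_schwarz)
      also have "\<dots> \<le> L0 * norm (R (w n s)) * norm (R (w n s))"
        using mult_right_mono[OF L0(2)] by simp
      finally show "inner (R (yosida (e n) (w n s) + N (w n s))) (R (w n s)) \<le> L0 * (norm (R (w n s)))\<^sup>2"
        by (simp add: power2_eq_square)
    qed (use t L0 in auto)
    then show ?thesis using expmono[OF L0(1), of t "norm (R y0)"] t w0 by simp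
  qed
  have wb: "norm (w n t) \<le> exp (L1 * T) * norm y0" if t: "t \<in> {0..T}" for n t
  proof -
    have "norm (w n t) \<le> exp (L1 * t) * norm (w n 0)"
    proof (rule gronwall_norm_linear)
      fix s assume s: "s \<in> {0..t}"
      show "(w n has_vector_derivative yosida (e n) (w n s) + N (w n s)) (at s within {0..t})"
        using s by (intro has_vector_derivative_within_subset[OF wd]) auto
      have "norm (N (w n s)) \<le> L1 * norm (w n s)" by (rule L1(2)[OF Rw]) (use s t in auto)
      then have "norm (N (w n s)) * norm (w n s) \<le> L1 * norm (w n s) * norm (w n s)"
        by (rule mult_right_mono) simp
      moreover have "inner (N (w n s)) (w n s) \<le> norm (N (w n s)) * norm (w n s)"
        by (rule norm_cauchy_schwarz)
      ultimately show "inner (yosida (e n) (w n s) + N (w n s)) (w n s) \<le> L1 * (norm (w n s))\<^sup>2"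
        using yosida_dissipative[OF e0, of n "w n s"] by (simp add: inner_add_left power2_eq_square)
    qed (use t L1 in auto)
    then show ?thesis using expmono[OF L1(1), of t "norm y0"] t w0 by simp
  qed
  have yb: "norm (y t) \<le> exp (L1 * T) * norm y0" if "t \<in> {0..T}" for t
    by (rule LIMSEQ_le_const2[OF tendsto_norm[OF ylim[OF that]]]) (use wb that in blast)
  obtain B where B: "0 < B" "\<And>x. norm (R x) \<le> norm x * B" using R.pos_bounded by blast
  text \<open>Applying \<open>R\<close> once more makes the derivatives of the approximations converge uniformly;
    injectivity of \<open>R\<close> then removes it again.\<close>
  have RRd: "((\<lambda>t. R (R (y t))) has_vector_derivative R (y t + R (N (y t)))) (at t within {0..T})"
    if t: "t \<in> {0..T}" for t
  proof -
    have "\<exists>g. \<forall>t\<in>{0..T}. (\<lambda>n. R (R (w n t))) \<longlonglongrightarrow> g t \<and>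
        (g has_derivative (\<lambda>h. h *\<^sub>R R (y t + R (N (y t))))) (at t within {0..T})"
    proof (rule has_derivative_sequence[where f' = "\<lambda>n t h. h *\<^sub>R R (R (yosida (e n) (w n t) + N (w n t)))"
          and ?x0.0 = 0 and l = "R (R y0)"])
      fix n s assume s: "s \<in> {0..T}"
      have "((\<lambda>t. R (R (w n t))) has_vector_derivative R (R (yosida (e n) (w n s) + N (w n s)))) (at s within {0..T})"
        using s by (intro R.has_vector_derivative has_vector_derivative_within_subset[OF wd]) auto
      then show "((\<lambda>t. R (R (w n t))) has_derivative (\<lambda>h. h *\<^sub>R R (R (yosida (e n) (w n s) + N (w n s))))) (at s within {0..T})"
        by (simp add: has_vector_derivative_def)
    next
      fix \<eta> :: real assume \<eta>: "0 < \<eta>"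
      define D where "D = exp (L1 * T) * norm y0"
      \<comment> \<open>Chosen so that \<open>(r + K * r * B) * B = \<eta> / 2\<close>.\<close>
      define r where "r = \<eta> / 2 / (B * (1 + B * K))"
      have bk: "0 < B * (1 + B * K)" using B(1) K0 by (simp add: add_pos_nonneg)
      have r: "0 < r" using \<eta> bk by (simp add: r_def)
      have ev1: "\<forall>\<^sub>F n in sequentially. \<forall>t\<in>{0..T}. dist (w n t) (y t) < r"
        using y r by (auto simp: uniform_limit_iff)
      have "(\<lambda>n. e n * D) \<longlonglongrightarrow> 0 * D" by (intro tendsto_intros elim)
      then have ev2: "\<forall>\<^sub>F n in sequentially. e n * D < \<eta> / 2"
        by (rule order_tendstoD(2)) (use \<eta> in auto)
      show "\<forall>\<^sub>F n in sequentially. \<forall>t\<in>{0..T}. \<forall>h. norm (h *\<^sub>R R (R (yosida (e n) (w n t) + N (w n t)))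
          - h *\<^sub>R R (y t + R (N (y t)))) \<le> \<eta> * norm h"
        using ev1 ev2
      proof eventually_elim
        case (elim n)
        show ?case
        proof (intro ballI allI)
          fix t h assume t: "t \<in> {0..T}"
          have d: "norm (w n t - y t) < r" using elim(1) t by (simp add: dist_norm)
          have "R (R (yosida (e n) (w n t) + N (w n t))) - R (y t + R (N (y t)))
            = R ((w n t - y t) + R (N (w n t) - N (y t))) + e n *\<^sub>R R (yosida (e n) (w n t))"
            by (simp add: R.add R.diff R_yosida[OF e0] R.scaleR)
          also have "norm \<dots> \<le> norm ((w n t - y t) + R (N (w n t) - N (y t))) * B + e n * norm (w n t)"
            using norm_R_yosida[OF e0, of n "w n t"] e0[of n]
            by (intro norm_triangle_le add_mono B(2)) (auto intro: mult_left_mono)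
          also have "\<dots> \<le> (r + (K * r) * B) * B + e n * D"
          proof -
            have "norm (R (N (w n t) - N (y t))) \<le> norm (N (w n t) - N (y t)) * B" by (rule B(2))
            also have "\<dots> \<le> (K * r) * B"
              using NK[of "w n t" "y t"] d K0 B(1)
              by (intro mult_right_mono) (auto intro: order_trans mult_left_mono less_imp_le)
            finally have "norm ((w n t - y t) + R (N (w n t) - N (y t))) \<le> r + (K * r) * B"
              using d by (intro norm_triangle_le) simp
            then show ?thesis
              using B(1) e0[of n] wb[OF t, of n] by (intro add_mono mult_right_mono mult_left_mono) (auto simp: D_def)
          qed
          also have "(r + (K * r) * B) * B = r * (B * (1 + B * K))" by (simp add: algebra_simps)
          also have "\<dots> = \<eta> / 2"
          proof -
            have "\<eta> / 2 / c * c = \<eta> / 2" if "0 < c" for c using that by simp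
            from this[OF bk] show ?thesis by (simp only: r_def)
          qed
          finally have "norm (R (R (yosida (e n) (w n t) + N (w n t))) - R (y t + R (N (y t)))) \<le> \<eta>"
            using elim(2) by simp
          then have "\<bar>h\<bar> * norm (R (R (yosida (e n) (w n t) + N (w n t))) - R (y t + R (N (y t)))) \<le> \<bar>h\<bar> * \<eta>"
            by (intro mult_left_mono) auto
          then show "norm (h *\<^sub>R R (R (yosida (e n) (w n t) + N (w n t))) - h *\<^sub>R R (y t + R (N (y t)))) \<le> \<eta> * norm h"
            by (simp only: scaleR_diff_right[symmetric] norm_scaleR) (simp add: mult.commute)
        qed
      qed
    qed (use \<open>0 \<le> T\<close> w0 in auto)
    then obtain g where g: "\<And>t. t \<in> {0..T} \<Longrightarrow> (\<lambda>n. R (R (w n t))) \<longlonglongrightarrow> g t"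
      "\<And>t. t \<in> {0..T} \<Longrightarrow> (g has_derivative (\<lambda>h. h *\<^sub>R R (y t + R (N (y t))))) (at t within {0..T})"
      by blast
    have eq: "R (R (y t)) = g t" if "t \<in> {0..T}" for t
      by (rule LIMSEQ_unique[OF _ g(1)[OF that]]) (intro R.tendsto ylim that)
    show ?thesis
      unfolding has_vector_derivative_def by (rule has_derivative_transform[OF t eq g(2)[OF t]])
  qed
  have contN: "continuous_on UNIV N"
    by (rule lipschitz_on_continuous_on[of K]) (use NK K0 in \<open>auto simp: lipschitz_on_def dist_norm\<close>)
  define X where "X t = R y0 + integral {0..t} (\<lambda>s. y s + R (N (y s)))" for t
  have contint: "continuous_on {0..T} (\<lambda>s. y s + R (N (y s)))"
    by (intro continuous_intros conty R.continuous_on continuous_on_compose2[OF contN]) auto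
  have Xd: "(X has_vector_derivative y t + R (N (y t))) (at t within {0..T})" if "t \<in> {0..T}" for t
    unfolding X_def using has_vector_derivative_add[OF has_vector_derivative_const
        integral_has_vector_derivative[OF contint that]] by simp
  have y0': "y 0 = y0"
    using LIMSEQ_unique[OF ylim[of 0]] w0 \<open>0 \<le> T\<close> by simp
  have "R (X t) - R (R (y t)) = 0" if t: "t \<in> {0..T}" for t
  proof -
    have *: "((\<lambda>t. R (X t) - R (R (y t))) has_vector_derivative 0) (at s within {0..T})" if "s \<in> {0..T}" for s
      using has_vector_derivative_diff[OF R.has_vector_derivative[OF Xd[OF that]] RRd[OF that]] by simp
    obtain c where c: "\<And>s. s \<in> {0..T} \<Longrightarrow> R (X s) - R (R (y s)) = c"
      by (rule has_vector_derivative_zero_constant[OF convex_real_interval(5) *]) (assumption, rule that)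
    have "X 0 = R (y 0)" by (simp add: X_def y0')
    then have "c = 0" using c[of 0] \<open>0 \<le> T\<close> by simp
    then show ?thesis using c[OF t] by simp
  qed
  then have XR: "R (y t) = X t" if "t \<in> {0..T}" for t
    using inj0[of "X t - R (y t)"] that by (simp add: R.diff)
  have "((\<lambda>t. R (y t)) has_vector_derivative y t + R (N (y t))) (at t within {0..T})" if "t \<in> {0..T}" for t
    by (rule has_vector_derivative_transform[OF that XR Xd[OF that]])
  with conty y0' yb show ?thesis using that by blast
qed

section \<open>Locally Lipschitz nonlinearities by cut-off\<close>

text \<open>\<open>N\<close> is replaced by its composition with the radial retraction
  \<open>P\<close> onto the ball of radius \<open>M\<close>. As \<open>R (P y)\<close> is a multiple
  of \<open>R y\<close> with a factor between 0 and 1, the bounds with \<open>L0\<close> and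
  \<open>L1\<close> survive, and they keep the solution where \<open>P\<close> is the
  identity.\<close>

lemma local_evolution:
  assumes N: "\<And>\<rho>. \<exists>L. \<forall>y z. norm (R y) \<le> \<rho> \<longrightarrow> norm (R z) \<le> \<rho> \<longrightarrow> norm (N y - N z) \<le> L * norm (y - z)"
    and "0 \<le> T" and L0: "0 \<le> L0" "\<And>y. norm (R (N y)) \<le> L0 * norm (R y)"
  obtains y where "continuous_on {0..T} y" "y 0 = y0"
    "\<And>t. t \<in> {0..T} \<Longrightarrow> ((\<lambda>t. R (y t)) has_vector_derivative y t + R (N (y t))) (at t within {0..T})"
proof -
  have N0: "N 0 = 0" using L0(2)[of 0] by (simp add: R.zero inj0)
  \<comment> \<open>The a priori bound for \<open>R y\<close> on the time interval; it does not
    refer to the radius \<open>M\<close> chosen below.\<close>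
  define \<rho> where "\<rho> = exp (L0 * T) * norm (R y0)"
  have \<rho>0: "0 \<le> \<rho>" by (simp add: \<rho>_def)
  obtain L1' where "\<And>y z. norm (R y) \<le> \<rho> \<Longrightarrow> norm (R z) \<le> \<rho> \<Longrightarrow> norm (N y - N z) \<le> L1' * norm (y - z)"
    using N by metis
  from this[of _ 0] have L1': "norm (N y) \<le> L1' * norm y" if "norm (R y) \<le> \<rho>" for y
    using that \<rho>0 by (simp add: N0 R.zero)
  define L1 where "L1 = max 0 L1'"
  have L1: "0 \<le> L1" "norm (R y) \<le> \<rho> \<Longrightarrow> norm (N y) \<le> L1 * norm y" for y
    using L1'[of y] mult_right_mono[of L1' L1 "norm y"] by (auto simp: L1_def)
  \<comment> \<open>The a priori bound for \<open>y\<close>; adding 1 makes the radius positive even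
    for \<open>y0 = 0\<close>.\<close>
  define M where "M = exp (L1 * T) * norm y0 + 1"
  have M: "0 < M" by (simp add: M_def add_nonneg_pos)
  define \<theta> where "\<theta> y = M / max M (norm y)" for y :: 'a
  define P where "P y = \<theta> y *\<^sub>R y" for y
  have th: "0 \<le> \<theta> y" "\<theta> y \<le> 1" for y using M by (auto simp: \<theta>_def)
  have Pn: "norm (P y) \<le> M" for y
  proof -
    have "norm (P y) = M * (norm y / max M (norm y))" using M by (simp add: P_def \<theta>_def abs_of_pos)
    also have "\<dots> \<le> M * 1" using M by (intro mult_left_mono) (auto simp: field_simps)
    finally show ?thesis by simp
  qed
  have Pn2: "norm (P y) \<le> norm y" for y
    using th[of y] by (simp add: P_def mult_left_le_one_le)
  have RP: "norm (R (P y)) \<le> norm (R y)" for y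
    using th[of y] by (simp add: P_def R.scaleR mult_left_le_one_le)
  have P2: "norm (P y - P z) \<le> 2 * norm (y - z)" for y z
  proof -
    define a b where "a = max M (norm y)" and "b = max M (norm z)"
    have ab: "0 < a" "0 < b" "M \<le> a" "M \<le> b" "norm z \<le> b" using M by (auto simp: a_def b_def)
    \<comment> \<open>One share of the constant 2 comes from moving the point, the other from the
      change of the scaling factor.\<close>
    have "P y - P z = (M / a) *\<^sub>R (y - z) + (M / a - M / b) *\<^sub>R z"
      by (simp add: P_def \<theta>_def a_def b_def algebra_simps)
    also have "norm \<dots> \<le> norm (y - z) + norm (y - z)"
    proof (rule norm_triangle_le, rule add_mono)
      show "norm ((M / a) *\<^sub>R (y - z)) \<le> norm (y - z)"
      proof -
        have "(M / a) * norm (y - z) \<le> norm (y - z)"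
          using ab M by (intro mult_left_le_one_le) auto
        then show ?thesis using ab M by simp
      qed
      have "norm ((M / a - M / b) *\<^sub>R z) = \<bar>b - a\<bar> * (M / a * (norm z / b))"
      proof -
        have "M / a - M / b = (b - a) * (M / a / b)" using ab by (simp add: field_simps)
        then show ?thesis using ab M by (simp add: abs_mult)
      qed
      also have "\<dots> \<le> \<bar>b - a\<bar> * (1 * 1)"
        using ab M by (intro mult_left_mono mult_mono) auto
      also have "\<dots> \<le> norm (y - z)"
        using norm_triangle_ineq3[of y z] by (auto simp: a_def b_def)
      finally show "norm ((M / a - M / b) *\<^sub>R z) \<le> norm (y - z)" .
    qed
    finally show ?thesis by simp
  qed
  obtain B where B: "0 < B" "\<And>x. norm (R x) \<le> norm x * B" using R.pos_bounded by blast
  obtain L' where L': "\<And>y z. norm (R y) \<le> M * B \<Longrightarrow> norm (R z) \<le> M * B \<Longrightarrow> norm (N y - N z) \<le> L' * norm (y - z)"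
    using N by metis
  have RPM: "norm (R (P y)) \<le> M * B" for y
    using B(2)[of "P y"] mult_right_mono[OF Pn[of y], of B] B(1) by linarith
  have 1: "norm (N (P y) - N (P z)) \<le> (max 0 L' * 2) * norm (y - z)" for y z
  proof -
    have "norm (N (P y) - N (P z)) \<le> L' * norm (P y - P z)" by (rule L'[OF RPM RPM])
    also have "\<dots> \<le> max 0 L' * (2 * norm (y - z))" by (intro mult_mono P2) auto
    finally show ?thesis by simp
  qed
  have 2: "norm (R (N (P y))) \<le> L0 * norm (R y)" for y
    using L0(2)[of "P y"] mult_left_mono[OF RP L0(1), of y] by linarith
  have 3: "norm (N (P y)) \<le> L1 * norm y" if "norm (R y) \<le> exp (L0 * T) * norm (R y0)" for y
    using L1(2)[of "P y"] RP[of y] that mult_left_mono[OF Pn2 L1(1), of y] by (simp add: \<rho>_def)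
  obtain y where y: "continuous_on {0..T} y" "y 0 = y0"
    "\<And>t. t \<in> {0..T} \<Longrightarrow> ((\<lambda>t. R (y t)) has_vector_derivative y t + R (N (P (y t)))) (at t within {0..T})"
    "\<And>t. t \<in> {0..T} \<Longrightarrow> norm (y t) \<le> exp (L1 * T) * norm y0"
    by (rule lipschitz_evolution[where ?y0.0 = y0, OF 1 \<open>0 \<le> T\<close> L0(1) 2 L1(1) 3]) (assumption, rule that)
  have "P (y t) = y t" if "t \<in> {0..T}" for t
    using y(4)[OF that] M by (simp add: P_def \<theta>_def M_def max_def)
  with y that show ?thesis by simp
qed

end

section \<open>Square roots of unbounded operators\<close>

text \<open>The inverse of the root is \<open>S\<close>. For a rival \<open>B\<close>, its converse
  is the graph of a bounded everywhere defined \<open>P\<close> with \<open>P (P x) = Q x\<close>.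
  This \<open>P\<close> commutes with \<open>Q\<close>, hence with \<open>S\<close>, so
  \<open>(S + P) (S - P) = 0\<close>, and positivity of both operators gives
  \<open>S = P\<close>.\<close>

lemma op_sqrt_eq:
  fixes Q S :: "'a::{real_inner,banach} \<Rightarrow> 'a"
  assumes S: "bounded_linear S" "\<And>x y. inner (S x) y = inner x (S y)" "\<And>x. 0 \<le> inner (S x) x"
    "\<And>x. S (S x) = Q x" "\<And>P x. bounded_linear P \<Longrightarrow> (\<And>x. P (Q x) = Q (P x)) \<Longrightarrow> P (S x) = S (P x)"
    and inj: "\<And>x. Q x = 0 \<Longrightarrow> x = 0"
  shows "op_sqrt (range (\<lambda>h. (Q h, h))) = range (\<lambda>h. (S h, h))"
  unfolding op_sqrt_def
proof (rule the_equality)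
  interpret S: bounded_linear S by fact
  have Q_eq: "Q = (\<lambda>x. S (S x))" using S(4) by auto
  have S0: "x = 0" if "S x = 0" for x using inj[of x] S(4)[of x] that by (simp add: S.zero)
  have Sinj: "x = y" if "S x = S y" for x y using S0[of "x - y"] that by (simp add: S.diff)
  let ?B = "range (\<lambda>h. (S h, h))"
  have "subspace ?B"
    by (intro linear_subspace_image bounded_linear.linear bounded_linear_Pair S(1) bounded_linear_ident subspace_UNIV)
  moreover have "single_valued ?B" by (auto simp: single_valued_def dest: Sinj)
  moreover have "Domain ?B = range S" by auto
  then have "closure (Domain ?B) = UNIV"
    using closure_range_symmetric[of S 1] S.linear S(2) S0 by simp
  moreover have "adjoint_graph ?B = ?B"
  proof -
    have "(y, z) \<in> adjoint_graph ?B \<longleftrightarrow> y = S z" for y z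
    proof
      assume "(y, z) \<in> adjoint_graph ?B"
      then have *: "inner k y = inner (S k) z" for k by (auto simp: adjoint_graph_def)
      have "inner (y - S z) (y - S z) = 0"
        using *[of "y - S z"] S(2)[of "y - S z" z] by (simp add: inner_diff_right)
      then show "y = S z" by simp
    qed (auto simp: adjoint_graph_def S(2))
    then show ?thesis by auto
  qed
  moreover have "positive_op ?B" using S(3) by (auto simp: positive_op_def inner_commute)
  moreover have "?B O ?B = range (\<lambda>h. (Q h, h))"
  proof -
    have "(x, y) \<in> ?B \<longleftrightarrow> x = S y" for x y by auto
    then have "(x, z) \<in> ?B O ?B \<longleftrightarrow> x = Q z" for x z by (simp add: S(4) relcomp_unfold)
    moreover have "(x, z) \<in> range (\<lambda>h. (Q h, h)) \<longleftrightarrow> x = Q z" for x z by auto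
    ultimately show ?thesis by (intro set_eqI) (simp only: split_paired_all)
  qed
  ultimately show "self_adjoint ?B \<and> positive_op ?B \<and> ?B O ?B = range (\<lambda>h. (Q h, h))"
    by (simp add: self_adjoint_def)
  fix B assume "self_adjoint B \<and> positive_op B \<and> B O B = range (\<lambda>h. (Q h, h))"
  then have sub: "subspace B" and adj: "adjoint_graph B = B" and pos: "positive_op B"
    and BB: "B O B = range (\<lambda>h. (Q h, h))" by (auto simp: self_adjoint_def)
  have B0: "(0, 0) \<in> B" using subspace_0[OF sub] by (simp add: zero_prod_def)
  have BBiff: "(\<exists>y. (x, y) \<in> B \<and> (y, z) \<in> B) \<longleftrightarrow> x = Q z" for x z
    using BB by (auto simp: relcomp_unfold set_eq_iff)
  \<comment> \<open>Surjectivity of \<open>B\<close> is read off from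
    \<open>(Q z, z) \<in> B O B\<close>.\<close>
  have ex: "\<exists>y. (y, z) \<in> B" for z using BBiff by blast
  have null: "y = 0" if "(y, 0) \<in> B" for y
  proof -
    have "\<exists>w. (w, y) \<in> B" using ex .
    then obtain w where w: "(w, y) \<in> B" by blast
    have "w = Q 0" using BBiff w that by blast
    then have "w = 0" by (simp add: Q_eq S.zero)
    text \<open>Now \<open>(0, y) \<in> B\<close> and \<open>(y, 0) \<in> B\<close>, and symmetry of \<open>B\<close> gives \<open>inner y y = inner 0 0\<close>.\<close>
    have "(0, y) \<in> adjoint_graph B" using w \<open>w = 0\<close> adj by simp
    then have "inner 0 0 = inner y y" using that by (force simp: adjoint_graph_def)
    then show ?thesis by simp
  qed
  have uniq: "y = y'" if "(y, z) \<in> B" "(y', z) \<in> B" for y y' z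
    using null[of "y - y'"] subspace_diff[OF sub that] by simp
  define P where "P z = (THE y. (y, z) \<in> B)" for z
  have PB: "(y, z) \<in> B \<longleftrightarrow> y = P z" for y z
    unfolding P_def using ex uniq by (metis the_equality)
  have PP: "P (P z) = Q z" for z using BBiff[of "Q z" z] by (auto simp: PB)
  have symP: "inner (P x) y = inner x (P y)" for x y
  proof -
    have "(P y, y) \<in> adjoint_graph B" using adj by (simp add: PB)
    then have "inner x (P y) = inner (P x) y" using PB[of "P x" x] by (auto simp: adjoint_graph_def)
    then show ?thesis by simp
  qed
  have posP: "0 \<le> inner (P x) x" for x
    using pos PB[of "P x" x] by (auto simp: positive_op_def inner_commute)
  have addP: "P (x + y) = P x + P y" for x y
    using subspace_add[OF sub, of "(P x, x)" "(P y, y)"] by (simp add: PB)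
  have scaleP: "P (r *\<^sub>R x) = r *\<^sub>R P x" for x r
    using subspace_scale[OF sub, of "(P x, x)" r] by (simp add: PB)
  obtain k where k: "0 < k" "\<And>x. norm (S x) \<le> norm x * k" using S.pos_bounded by blast
  have "bounded_linear P"
  proof (rule bounded_linear_intro[OF addP scaleP])
    fix x
    \<comment> \<open>Both sides equal \<open>inner (Q x) x\<close>, so \<open>P\<close> inherits
      the bound of \<open>S\<close>.\<close>
    have "(norm (P x))\<^sup>2 = (norm (S x))\<^sup>2"
      by (simp add: power2_norm_eq_inner symP[of x] S(2)[of x] PP S(4))
    then show "norm (P x) \<le> norm x * k" using k(2)[of x] by (simp add: power2_eq_iff_nonneg)
  qed
  have PS: "P (S x) = S (P x)" for x
    by (rule S(5)[OF \<open>bounded_linear P\<close>]) (simp add: PP[symmetric])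
  have "S x = P x" for x
  proof -
    define y where "y = S x - P x"
    have Py: "P y = P (S x) - P (P x)"
      using addP[of y "P x"] by (simp add: y_def)
    have "inner (S y) y + inner (P y) y = inner (S y + P y) y" by (simp add: inner_add_left)
    also have "S y + P y = S (S x) - P (P x)" unfolding Py by (simp add: y_def S.diff PS)
    also have "\<dots> = 0" by (simp add: S(4) PP)
    finally have "inner (S y) y = 0" using S(3)[of y] posP[of y] by simp
    text \<open>A positive form vanishing at \<open>y\<close> has \<open>S y = 0\<close>: otherwise it would be negative at
      \<open>y - t S y\<close> for small \<open>t > 0\<close>.\<close>
    define a where "a = inner (S y) (S y)"
    define b where "b = inner (S (S y)) (S y)"
    have quad: "0 \<le> t * t * b - 2 * t * a" for t
    proof -
      have "0 \<le> inner (S (y - t *\<^sub>R S y)) (y - t *\<^sub>R S y)" by (rule S(3))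
      also have "\<dots> = t * t * b - 2 * t * a"
        using \<open>inner (S y) y = 0\<close> S(2)[of "S y" y]
        by (simp add: S.diff S.scaleR inner_diff_left inner_diff_right a_def b_def inner_commute)
      finally show ?thesis .
    qed
    have "0 \<le> b" by (simp add: b_def S(3))
    have "a \<le> 0"
    proof (rule ccontr)
      assume "\<not> a \<le> 0"
      \<comment> \<open>Any positive \<open>t\<close> with \<open>t * b < 2 * a\<close> makes the
        quadratic negative; the \<open>+ 1\<close> guards against \<open>b = 0\<close>.\<close>
      define t where "t = a / (b + 1)"
      have "0 < t" using \<open>\<not> a \<le> 0\<close> \<open>0 \<le> b\<close> by (simp add: t_def)
      have "0 \<le> t * (t * b - 2 * a)" using quad[of t] by (simp add: algebra_simps)
      then have "2 * a \<le> t * b" using \<open>0 < t\<close> by (simp add: zero_le_mult_iff)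
      also have "t * b = a * (b / (b + 1))" by (simp add: t_def)
      also have "\<dots> \<le> a * 1" using \<open>\<not> a \<le> 0\<close> \<open>0 \<le> b\<close> by (intro mult_left_mono) auto
      finally show False using \<open>\<not> a \<le> 0\<close> by simp
    qed
    then have "S y = 0" unfolding a_def using inner_ge_zero[of "S y"] inner_eq_zero_iff order_antisym by blast
    then show ?thesis using S0[of y] by (simp add: y_def)
  qed
  then show "B = ?B" using PB by auto
qed

section \<open>Completeness of the space of square integrable functions\<close>

abbreviation half_lebesgue :: "real measure" where
  "half_lebesgue \<equiv> lebesgue_on half_line"

lemma abs_l2_rep_l2: "abs_l2 (rep_l2 u) = u"
  using Quotient_l2 by (rule Quotient_abs_rep)

lemma abs_l2_eqI: "l2_rel f g \<Longrightarrow> abs_l2 f = abs_l2 g"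
  using Quotient_rel_abs[OF Quotient_l2] .

lemma AE_rep_abs_l2: "sqint half_line f \<Longrightarrow> AE x in half_lebesgue. rep_l2 (abs_l2 f) x = f x"
  using l2_rel_rep_abs by (simp add: l2_rel_def)

lemma l2_eqI: "AE x in half_lebesgue. rep_l2 u x = rep_l2 v x \<Longrightarrow> u = v"
  using abs_l2_eqI[of "rep_l2 u" "rep_l2 v"] by (simp add: l2_rel_def abs_l2_rep_l2)

lemma abs_l2_diff: "sqint half_line f \<Longrightarrow> sqint half_line g \<Longrightarrow>
    abs_l2 (\<lambda>x. f x - g x) = abs_l2 f - abs_l2 g"
  by (simp add: minus_l2.abs_eq l2_rel_def)

lemma abs_l2_scaleR: "sqint half_line f \<Longrightarrow> abs_l2 (\<lambda>x. r * f x) = r *\<^sub>R abs_l2 f"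
  by (simp add: scaleR_l2.abs_eq l2_rel_def)

lemma abs_l2_zero: "abs_l2 (\<lambda>x. 0) = 0"
  by (simp add: zero_l2_def)

lemma AE_rep_l2_diff: "AE x in half_lebesgue. rep_l2 (u - v) x = rep_l2 u x - rep_l2 v x"
  using AE_rep_abs_l2[of "\<lambda>x. rep_l2 u x - rep_l2 v x"]
  by (simp add: abs_l2_diff abs_l2_rep_l2 sqint_diff)

lemma AE_rep_l2_scaleR: "AE x in half_lebesgue. rep_l2 (r *\<^sub>R u) x = r * rep_l2 u x"
  using AE_rep_abs_l2[of "\<lambda>x. r * rep_l2 u x"]
  by (simp add: abs_l2_scaleR abs_l2_rep_l2 sqint_scale)

lemma AE_rep_l2_zero: "AE x in half_lebesgue. rep_l2 0 x = 0"
  using AE_rep_abs_l2[of "\<lambda>x. 0"] by (simp add: abs_l2_zero)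

lemma rep_l2_measurable [measurable]: "rep_l2 u \<in> borel_measurable half_lebesgue"
  using sqint_rep_l2[of u] by (simp add: sqint_def del: sqint_rep_l2)

lemma inner_abs_l2_right:
  assumes "sqint half_line g"
  shows "inner u (abs_l2 g) = (\<integral>x. rep_l2 u x * g x \<partial>half_lebesgue)"
  using inner_l2.abs_eq[of "rep_l2 u" g] assms by (simp add: l2_rel_def abs_l2_rep_l2)

lemma nn_integral_rep_l2_sq: "(\<integral>\<^sup>+x. ennreal ((rep_l2 u x)\<^sup>2) \<partial>half_lebesgue) = ennreal ((norm u)\<^sup>2)"
proof -
  have "(norm u)\<^sup>2 = (\<integral>x. (rep_l2 u x)\<^sup>2 \<partial>half_lebesgue)"
    unfolding power2_norm_eq_inner inner_l2.rep_eq by (simp add: power2_eq_square)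
  moreover have "integrable half_lebesgue (\<lambda>x. (rep_l2 u x)\<^sup>2)"
    using sqint_rep_l2[of u] by (simp add: sqint_def del: sqint_rep_l2)
  ultimately show ?thesis by (simp add: nn_integral_eq_integral)
qed

lemma norm_abs_l2_sq:
  assumes "sqint half_line f"
  shows "(norm (abs_l2 f))\<^sup>2 = (\<integral>x. (f x)\<^sup>2 \<partial>half_lebesgue)"
  unfolding power2_norm_eq_inner inner_abs_l2_right[OF assms]
  by (rule integral_cong_AE)
    (use assms AE_rep_abs_l2[OF assms] in \<open>auto simp: sqint_def power2_eq_square\<close>)

lemma sqintI_nn_integral:
  assumes "f \<in> borel_measurable (lebesgue_on \<Omega>)"
    "(\<integral>\<^sup>+x. ennreal ((f x)\<^sup>2) \<partial>lebesgue_on \<Omega>) < \<infinity>"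
  shows "sqint \<Omega> f"
  using assms by (auto simp: sqint_def integrable_iff_bounded)

lemma sqintI_bound:
  assumes "f \<in> borel_measurable (lebesgue_on \<Omega>)" "sqint \<Omega> g"
    "AE x in lebesgue_on \<Omega>. \<bar>f x\<bar> \<le> \<bar>g x\<bar>"
  shows "sqint \<Omega> f"
  unfolding sqint_def
proof
  show "integrable (lebesgue_on \<Omega>) (\<lambda>x. (f x)\<^sup>2)"
  proof (rule Bochner_Integration.integrable_bound)
    show "integrable (lebesgue_on \<Omega>) (\<lambda>x. (g x)\<^sup>2)" using assms by (simp add: sqint_def)
    show "AE x in lebesgue_on \<Omega>. norm ((f x)\<^sup>2) \<le> norm ((g x)\<^sup>2)"
      using assms(3) by eventually_elim (simp add: abs_le_square_iff)
  qed (use assms in measurable)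
qed fact

lemma integral_exp_half_line:
  assumes "0 < k"
  shows "has_bochner_integral half_lebesgue (\<lambda>x. exp (- k * x)) (1 / k)"
proof -
  have "((\<lambda>x. exp (- k * x)) has_integral exp (- k * 0) / k) {0..}"
    by (rule has_integral_exp_minus_to_infinity[OF assms])
  then have "(\<lambda>x. exp (- k * x)) absolutely_integrable_on {0..}" "((\<lambda>x. exp (- k * x)) has_integral 1 / k) {0..}"
    by (auto intro: nonnegative_absolutely_integrable_1 simp: has_integral_integrable)
  note * = this
  have "negligible {x \<in> {0..} - half_line. exp (- k * x) \<noteq> 0}"
    by (rule negligible_subset[of "{0}"]) auto
  with * have "((\<lambda>x. exp (- k * x)) has_integral 1 / k) half_line"
    by (subst has_integral_spike_set_eq[where T = "{0..}"]) (auto intro: negligible_subset[of "{0}"])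
  moreover have "(\<lambda>x. exp (- k * x)) absolutely_integrable_on half_line"
    by (rule set_integrable_subset[OF *(1)]) auto
  then have "integrable half_lebesgue (\<lambda>x. exp (- k * x))"
    by (simp add: set_integrable_def integrable_restrict_space)
  moreover from lebesgue_integral_eq_integral[OF this]
  have "(\<integral>x. exp (- k * x) \<partial>half_lebesgue) = integral half_line (\<lambda>x. exp (- k * x))" by simp
  ultimately show ?thesis by (simp add: has_bochner_integral_iff integral_unique)
qed

lemma sqint_exp: "0 < k \<Longrightarrow> sqint half_line (\<lambda>x. exp (- k * x))"
proof -
  assume "0 < k"
  then have "integrable half_lebesgue (\<lambda>x. exp (- (2 * k) * x))"
    using integral_exp_half_line[of "2 * k"] by (simp add: has_bochner_integral_iff)
  moreover have "(\<lambda>x. exp (- k * x)) \<in> borel_measurable half_lebesgue" for k :: real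
    by (intro continuous_imp_measurable_on_sets_lebesgue continuous_intros) auto
  ultimately show ?thesis by (simp add: sqint_def exp_double[symmetric] mult.assoc)
qed

section \<open>The Riesz-Fischer theorem on the half line\<close>

text \<open>On a set of infinite measure an L2 bound gives an L1 bound only after multiplication
  with an L2 function; \<open>exp (- x)\<close> is used, and being positive it does not affect
  pointwise summability of the increments. Fatou's lemma then turns convergence almost everywhere
  into convergence in norm.\<close>

lemma fast_Cauchy_l2_convergent:
  fixes X :: "nat \<Rightarrow> l2"
  assumes X: "\<And>m n. m \<le> n \<Longrightarrow> norm (X n - X m) \<le> (1/2) ^ m"
  shows "convergent X"
proof -
  define f where "f n = rep_l2 (X n)" for n
  have [measurable]: "f n \<in> borel_measurable half_lebesgue" for n by (simp add: f_def)
  define e where "e = abs_l2 (\<lambda>x. exp (- 1 * x))"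
  have se: "sqint half_line (\<lambda>x. exp (- 1 * x))" by (rule sqint_exp) simp
  have [measurable]: "(\<lambda>x. exp (- 1 * x :: real)) \<in> borel_measurable half_lebesgue"
    using se by (simp add: sqint_def)
  define h where "h k x = \<bar>f (Suc k) x - f k x\<bar> * exp (- 1 * x)" for k x
  have [measurable]: "h k \<in> borel_measurable half_lebesgue" for k unfolding h_def by measurable
  have hint: "(\<integral>\<^sup>+x. ennreal (h k x) \<partial>half_lebesgue) \<le> ennreal ((1/2) ^ k * norm e)" for k
  proof -
    define d where "d x = \<bar>f (Suc k) x - f k x\<bar>" for x
    have sd0: "sqint half_line (\<lambda>x. f (Suc k) x - f k x)" by (simp add: f_def sqint_diff)
    have [measurable]: "d \<in> borel_measurable half_lebesgue" unfolding d_def by measurable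
    have sd: "sqint half_line d" using sd0 by (simp add: sqint_def d_def)
    have "norm (abs_l2 d) = norm (X (Suc k) - X k)"
    proof -
      have "(norm (abs_l2 d))\<^sup>2 = (norm (abs_l2 (\<lambda>x. f (Suc k) x - f k x)))\<^sup>2"
        unfolding norm_abs_l2_sq[OF sd] norm_abs_l2_sq[OF sd0] by (simp add: d_def)
      also have "abs_l2 (\<lambda>x. f (Suc k) x - f k x) = X (Suc k) - X k"
        by (simp add: f_def abs_l2_diff abs_l2_rep_l2)
      finally show ?thesis by simp
    qed
    have hd: "h k = (\<lambda>x. d x * exp (- 1 * x))" by (simp add: h_def d_def fun_eq_iff)
    have "integrable half_lebesgue (h k)" unfolding hd by (rule sqint_mult_integrable[OF sd se])
    then have "(\<integral>\<^sup>+x. ennreal (h k x) \<partial>half_lebesgue) = ennreal (\<integral>x. h k x \<partial>half_lebesgue)"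
      by (rule nn_integral_eq_integral) (simp add: h_def)
    also have "(\<integral>x. h k x \<partial>half_lebesgue) = inner (abs_l2 d) e"
      unfolding hd e_def using inner_l2.abs_eq sd se by (simp add: l2_rel_def)
    also have "\<dots> \<le> norm (abs_l2 d) * norm e" by (rule norm_cauchy_schwarz)
    also have "\<dots> \<le> (1/2) ^ k * norm e"
      unfolding \<open>norm (abs_l2 d) = _\<close> by (intro mult_right_mono X) auto
    finally show ?thesis by (simp add: ennreal_leI)
  qed
  have "(\<integral>\<^sup>+x. (\<Sum>k. ennreal (h k x)) \<partial>half_lebesgue) = (\<Sum>k. \<integral>\<^sup>+x. ennreal (h k x) \<partial>half_lebesgue)"
    by (intro nn_integral_suminf) measurable
  also have "\<dots> \<le> (\<Sum>k. ennreal ((1/2) ^ k * norm e))" by (intro suminf_le hint) auto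
  also have "\<dots> = ennreal (\<Sum>k. (1/2) ^ k * norm e)"
    by (intro suminf_ennreal2) (auto intro!: summable_mult2 summable_geometric)
  finally have "(\<integral>\<^sup>+x. (\<Sum>k. ennreal (h k x)) \<partial>half_lebesgue) \<noteq> \<infinity>"
    by (metis ennreal_neq_top infinity_ennreal_def neq_top_trans)
  then have "AE x in half_lebesgue. (\<Sum>k. ennreal (h k x)) \<noteq> \<infinity>"
    by (intro nn_integral_PInf_AE) measurable
  then have conv: "AE x in half_lebesgue. convergent (\<lambda>n. f n x)"
  proof eventually_elim
    case (elim x)
    then have "summable (\<lambda>k. h k x)"
      by (intro summable_suminf_not_top) (auto simp: h_def)
    then have "summable (\<lambda>k. h k x * exp x)" by (rule summable_mult2)
    then have "summable (\<lambda>k. \<bar>f (Suc k) x - f k x\<bar>)"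
      by (simp add: h_def mult.assoc exp_add[symmetric])
    then have "summable (\<lambda>k. f (Suc k) x - f k x)" by (rule summable_rabs_cancel)
    then have "convergent (\<lambda>n. \<Sum>k<n. f (Suc k) x - f k x)" by (simp add: summable_iff_convergent)
    then have "convergent (\<lambda>n. f n x - f 0 x)" 
      using sum_lessThan_telescope[of "\<lambda>k. f k x"] by simp
    from convergent_add[OF this convergent_const[of "f 0 x"]] show ?case by simp
  qed
  define g where "g x = lim (\<lambda>n. f n x)" for x
  have [measurable]: "g \<in> borel_measurable half_lebesgue" unfolding g_def by measurable
  have lim: "AE x in half_lebesgue. (\<lambda>n. f n x) \<longlonglongrightarrow> g x"
    using conv by eventually_elim (simp add: g_def convergent_LIMSEQ_iff)
  \<comment> \<open>For fixed \<open>m\<close> the limit inherits the distance bound that holds for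
    all later terms of the sequence.\<close>
  have fatou: "(\<integral>\<^sup>+x. ennreal ((g x - f m x)\<^sup>2) \<partial>half_lebesgue) \<le> ennreal (((1/2) ^ m)\<^sup>2)" for m
  proof -
    have "(\<integral>\<^sup>+x. ennreal ((g x - f m x)\<^sup>2) \<partial>half_lebesgue)
        = (\<integral>\<^sup>+x. liminf (\<lambda>n. ennreal ((f n x - f m x)\<^sup>2)) \<partial>half_lebesgue)"
    proof (rule nn_integral_cong_AE)
      show "AE x in half_lebesgue. ennreal ((g x - f m x)\<^sup>2) = liminf (\<lambda>n. ennreal ((f n x - f m x)\<^sup>2))"
        using lim
      proof eventually_elim
        case (elim x)
        then have "(\<lambda>n. ennreal ((f n x - f m x)\<^sup>2)) \<longlonglongrightarrow> ennreal ((g x - f m x)\<^sup>2)"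
          by (intro tendsto_intros)
        from lim_imp_Liminf[OF sequentially_bot this] show ?case by (rule sym)
      qed
    qed
    also have "\<dots> \<le> liminf (\<lambda>n. \<integral>\<^sup>+x. ennreal ((f n x - f m x)\<^sup>2) \<partial>half_lebesgue)"
      by (intro nn_integral_liminf) measurable
    also have "\<dots> \<le> ennreal (((1/2) ^ m)\<^sup>2)"
    proof (rule Liminf_le)
      have "(\<integral>\<^sup>+x. ennreal ((f n x - f m x)\<^sup>2) \<partial>half_lebesgue) \<le> ennreal (((1/2) ^ m)\<^sup>2)" if "m \<le> n" for n
      proof -
        have "(\<integral>\<^sup>+x. ennreal ((f n x - f m x)\<^sup>2) \<partial>half_lebesgue)
            = (\<integral>\<^sup>+x. ennreal ((rep_l2 (X n - X m) x)\<^sup>2) \<partial>half_lebesgue)"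
          by (rule nn_integral_cong_AE) (use AE_rep_l2_diff[of "X n" "X m"] in \<open>eventually_elim, simp add: f_def\<close>)
        also have "\<dots> = ennreal ((norm (X n - X m))\<^sup>2)" by (rule nn_integral_rep_l2_sq)
        also have "\<dots> \<le> ennreal (((1/2) ^ m)\<^sup>2)" by (intro ennreal_leI power_mono X that) simp
        finally show ?thesis .
      qed
      then show "\<forall>\<^sub>F n in sequentially. (\<integral>\<^sup>+x. ennreal ((f n x - f m x)\<^sup>2) \<partial>half_lebesgue) \<le> ennreal (((1/2) ^ m)\<^sup>2)"
        by (auto simp: eventually_sequentially)
    qed simp
    finally show ?thesis .
  qed
  have sgf: "sqint half_line (\<lambda>x. g x - f m x)" for m
    by (rule sqintI_nn_integral) (use fatou[of m] in \<open>auto intro: le_less_trans\<close>)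
  have sg: "sqint half_line g"
    using sqint_add[OF sgf[of 0], of "f 0"] by (simp add: f_def)
  have bound: "norm (abs_l2 g - X m) \<le> (1/2) ^ m" for m
  proof -
    have eq: "abs_l2 g - X m = abs_l2 (\<lambda>x. g x - f m x)"
      using sg by (simp add: f_def abs_l2_diff abs_l2_rep_l2)
    have "ennreal ((norm (abs_l2 g - X m))\<^sup>2) = (\<integral>\<^sup>+x. ennreal ((g x - f m x)\<^sup>2) \<partial>half_lebesgue)"
      unfolding eq norm_abs_l2_sq[OF sgf]
      by (rule nn_integral_eq_integral[symmetric]) (use sgf in \<open>auto simp: sqint_def\<close>)
    then have "ennreal ((norm (abs_l2 g - X m))\<^sup>2) \<le> ennreal (((1/2) ^ m)\<^sup>2)"
      using fatou[of m] by (simp only:)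
    then have "(norm (abs_l2 g - X m))\<^sup>2 \<le> ((1/2) ^ m)\<^sup>2"
      by (subst (asm) ennreal_le_iff) simp_all
    then show ?thesis by (rule power2_le_imp_le) simp
  qed
  have "X \<longlonglongrightarrow> abs_l2 g"
  proof (rule metric_LIMSEQ_I)
    fix r :: real assume "0 < r"
    then obtain N where N: "(1/2) ^ N < r" using real_arch_pow_inv[of r "1/2"] by auto
    have "dist (X n) (abs_l2 g) < r" if "N \<le> n" for n
    proof -
      have "dist (X n) (abs_l2 g) \<le> (1/2) ^ n" using bound[of n] by (simp add: dist_norm norm_minus_commute)
      also have "\<dots> \<le> (1/2) ^ N" using that by (simp add: power_decreasing)
      finally show ?thesis using N by simp
    qed
    then show "\<exists>N. \<forall>n\<ge>N. dist (X n) (abs_l2 g) < r" by blast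
  qed
  then show ?thesis by (auto simp: convergent_def)
qed

instance l2 :: banach
proof
  fix X :: "nat \<Rightarrow> l2" assume C: "Cauchy X"
  have "\<exists>N. \<forall>m\<ge>N. \<forall>n\<ge>N. norm (X m - X n) < (1/2) ^ k" for k
    using C[unfolded Cauchy_def, rule_format, of "(1/2) ^ k"] by (simp add: dist_norm)
  then obtain N where N: "\<And>k m n. N k \<le> m \<Longrightarrow> N k \<le> n \<Longrightarrow> norm (X m - X n) < (1/2) ^ k" by metis
  \<comment> \<open>Adding \<open>k\<close> to the running maximum makes the selection strictly
    increasing.\<close>
  define r where "r k = k + Max (N ` {..k})" for k
  have rN: "N k \<le> r k" for k by (auto simp: r_def intro: trans_le_add2 Max_ge)
  have r_mono: "r k < r (Suc k)" for k
  proof -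
    have "Max (N ` {..k}) \<le> Max (N ` {..Suc k})" by (intro Max_mono) auto
    then show ?thesis unfolding r_def by linarith
  qed
  have sm: "strict_mono r" by (rule strict_monoI_Suc) (rule r_mono)
  have "convergent (X \<circ> r)"
  proof (rule fast_Cauchy_l2_convergent)
    fix m n :: nat assume "m \<le> n"
    then have "r m \<le> r n" using sm by (simp add: strict_mono_less_eq)
    then show "norm ((X \<circ> r) n - (X \<circ> r) m) \<le> (1/2) ^ m"
      using N[of m "r n" "r m"] rN[of m] by simp
  qed
  then obtain l where "(X \<circ> r) \<longlonglongrightarrow> l" by (auto simp: convergent_def)
  with C sm have "X \<longlonglongrightarrow> l" by (rule Cauchy_converges_subseq)
  then show "convergent X" by (auto simp: convergent_def)
qed

section \<open>Test functions and weak derivatives on the half line\<close>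

definition smooth :: "(real \<Rightarrow> real) \<Rightarrow> bool" where
  "smooth f \<longleftrightarrow> (\<forall>n x. ((deriv ^^ n) f) differentiable (at x))"

text \<open>All iterated derivatives stay inside a family closed under \<open>deriv\<close>, which
  replaces an explicit formula for them. The art lies in choosing the family.\<close>

lemma smoothI_closed:
  assumes "f \<in> F" "\<And>g x. g \<in> F \<Longrightarrow> g differentiable (at x)" "\<And>g. g \<in> F \<Longrightarrow> deriv g \<in> F"
  shows "smooth f"
proof -
  have "(deriv ^^ n) f \<in> F" for n by (induction n) (use assms in auto)
  then show ?thesis using assms(2) by (simp add: smooth_def)
qed

lemma smooth_deriv: "smooth f \<Longrightarrow> smooth (deriv f)"
  unfolding smooth_def by (metis funpow_Suc_right o_apply)

lemma smooth_DERIV: "smooth f \<Longrightarrow> (f has_real_derivative deriv f x) (at x)"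
  unfolding smooth_def using DERIV_deriv_iff_real_differentiable by (metis funpow_0)

lemma smooth_iff_deriv:
  assumes "\<And>x. (f has_real_derivative f' x) (at x)" "smooth f'"
  shows "smooth f"
proof -
  have "deriv f = f'" using assms(1) by (auto intro: DERIV_imp_deriv)
  have "(deriv ^^ n) f differentiable (at x)" for n x
  proof (cases n)
    case 0 then show ?thesis using assms(1) by (auto simp: real_differentiable_def)
  next
    case (Suc m)
    then have "(deriv ^^ n) f = (deriv ^^ m) f'"
      using \<open>deriv f = f'\<close> by (metis funpow_Suc_right o_apply)
    then show ?thesis using assms(2) by (simp add: smooth_def)
  qed
  then show ?thesis by (simp add: smooth_def)
qed

lemma smooth_continuous_on: "smooth f \<Longrightarrow> continuous_on X f"
  by (meson DERIV_isCont continuous_at_imp_continuous_on smooth_DERIV)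

lemma smooth_affine:
  assumes "smooth f" shows "smooth (\<lambda>x. f (r * x + s))"
proof (rule smoothI_closed)
  define F where "F = {(\<lambda>x. c * g (r * x + s)) | c g. smooth g}"
  have "(\<lambda>x. 1 * f (r * x + s)) \<in> F" using assms unfolding F_def by blast
  then show "(\<lambda>x. f (r * x + s)) \<in> F" by simp
  fix h assume "h \<in> F"
  then obtain c g where g: "smooth g" and h: "h = (\<lambda>x. c * g (r * x + s))" by (auto simp: F_def)
  have d: "(h has_real_derivative (c * r) * deriv g (r * x + s)) (at x)" for x
    unfolding h by (rule derivative_eq_intros DERIV_chain2[OF smooth_DERIV[OF g]] refl)+ simp
  show "h differentiable (at x)" for x using d by (auto simp: real_differentiable_def)
  have "deriv h = (\<lambda>x. (c * r) * deriv g (r * x + s))" using d by (auto intro: DERIV_imp_deriv)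
  then show "deriv h \<in> F" using smooth_deriv[OF g] unfolding F_def by blast
qed

lemma smooth_lincomb:
  assumes "smooth f" "smooth g" shows "smooth (\<lambda>x. f x - c * g x)"
proof (rule smoothI_closed)
  define F where "F = {(\<lambda>x. f x - c * g x) | f g. smooth f \<and> smooth g}"
  show "(\<lambda>x. f x - c * g x) \<in> F" using assms unfolding F_def by blast
  fix h assume "h \<in> F"
  then obtain f g where g: "smooth f" "smooth g" and h: "h = (\<lambda>x. f x - c * g x)" by (auto simp: F_def)
  have d: "(h has_real_derivative deriv f x - c * deriv g x) (at x)" for x
    unfolding h by (intro DERIV_diff DERIV_cmult smooth_DERIV g)
  show "h differentiable (at x)" for x using d by (auto simp: real_differentiable_def)
  have "deriv h = (\<lambda>x. deriv f x - c * deriv g x)" using d by (auto intro: DERIV_imp_deriv)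
  then show "deriv h \<in> F" using smooth_deriv g unfolding F_def by blast
qed

text \<open>Products alone are not closed under differentiation; together with sums they
  are.\<close>

inductive_set smooth_products :: "(real \<Rightarrow> real) set" where
  mult: "smooth f \<Longrightarrow> smooth g \<Longrightarrow> (\<lambda>x. f x * g x) \<in> smooth_products"
| add: "f \<in> smooth_products \<Longrightarrow> g \<in> smooth_products \<Longrightarrow> (\<lambda>x. f x + g x) \<in> smooth_products"

lemma smooth_mult:
  assumes "smooth f" "smooth g" shows "smooth (\<lambda>x. f x * g x)"
proof (rule smoothI_closed)
  show "(\<lambda>x. f x * g x) \<in> smooth_products" using assms by (rule smooth_products.mult)
  have *: "\<exists>h'\<in>smooth_products. \<forall>x. (h has_real_derivative h' x) (at x)" if "h \<in> smooth_products" for h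
    using that
  proof induction
    case (mult f g)
    show ?case
      by (rule bexI[of _ "\<lambda>x. deriv f x * g x + deriv g x * f x"])
        (intro allI DERIV_mult smooth_DERIV smooth_products.intros smooth_deriv mult)+
  next
    case (add f g)
    then obtain f' g' where fg: "f' \<in> smooth_products" "\<forall>x. (f has_real_derivative f' x) (at x)"
      "g' \<in> smooth_products" "\<forall>x. (g has_real_derivative g' x) (at x)" by blast
    then show ?case
      by (intro bexI[of _ "\<lambda>x. f' x + g' x"] allI DERIV_add smooth_products.add) auto
  qed
  fix h assume "h \<in> smooth_products"
  with * obtain h' where h': "h' \<in> smooth_products" "\<And>x. (h has_real_derivative h' x) (at x)" by blast
  show "h differentiable (at x)" for x using h'(2) by (auto simp: real_differentiable_def)
  have "deriv h = h'" using h'(2) by (auto intro: DERIV_imp_deriv)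
  then show "deriv h \<in> smooth_products" using h'(1) by simp
qed

text \<open>The classical smooth but not analytic function \<open>exp (- 1 / x)\<close>, extended by
  0, with polynomials in \<open>1 / x\<close> as factors so that the family is closed under
  differentiation.\<close>

definition flat :: "real poly \<Rightarrow> real \<Rightarrow> real" where
  "flat p x = (if 0 < x then poly p (1 / x) * exp (- (1 / x)) else 0)"

lemma poly_exp_minus_tendsto_0: "((\<lambda>t. poly p t * exp (- t)) \<longlongrightarrow> (0::real)) at_top"
proof -
  have "((\<lambda>t. \<Sum>i\<le>degree p. coeff p i * (t ^ i / exp t)) \<longlongrightarrow> (\<Sum>i\<le>degree p. coeff p i * 0)) at_top"
    by (intro tendsto_intros tendsto_power_div_exp_0)
  then show ?thesis
    by (simp add: poly_altdef sum_distrib_right exp_minus divide_inverse mult.assoc)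
qed

text \<open>The chain rule for \<open>1 / x\<close> produces the factor
  \<open>1 / x\<^sup>2\<close>, which is \<open>[:0, 0, 1:]\<close> evaluated at
  \<open>1 / x\<close>. At 0 the difference quotient is again a polynomial in \<open>1 / h\<close>
  times \<open>exp (- 1 / h)\<close> and tends to 0.\<close>

lemma DERIV_flat:
  "(flat p has_real_derivative flat ([:0, 0, 1:] * (p - pderiv p)) x) (at x)"
proof -
  consider "0 < x" | "x < 0" | "x = 0" by linarith
  then show ?thesis
  proof cases
    case 1
    have "((\<lambda>x. poly p (1 / x) * exp (- (1 / x))) has_real_derivative
        flat ([:0, 0, 1:] * (p - pderiv p)) x) (at x)"
      using 1 by (auto intro!: derivative_eq_intros DERIV_chain2[OF poly_DERIV]
          simp: flat_def power2_eq_square field_simps)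
    then show ?thesis
      by (rule has_field_derivative_transform_within_open[where S = "{0<..}"]) (use 1 in \<open>auto simp: flat_def\<close>)
  next
    case 2
    have "((\<lambda>x. 0) has_real_derivative flat ([:0, 0, 1:] * (p - pderiv p)) x) (at x)"
      using 2 by (simp add: flat_def)
    then show ?thesis
      by (rule has_field_derivative_transform_within_open[where S = "{..<0}"]) (use 2 in \<open>auto simp: flat_def\<close>)
  next
    case 3
    have "((\<lambda>h. flat p h / h) \<longlongrightarrow> 0) (at_right 0)"
    proof -
      have "((\<lambda>h. poly ([:0, 1:] * p) (inverse h) * exp (- inverse h)) \<longlongrightarrow> (0::real)) (at_right 0)"
        by (rule filterlim_compose[OF poly_exp_minus_tendsto_0 filterlim_inverse_at_top_right])
      then show ?thesis
        by (rule Lim_transform_eventually)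
           (auto simp: eventually_at_filter flat_def field_simps)
    qed
    moreover have "((\<lambda>h. flat p h / h) \<longlongrightarrow> 0) (at_left 0)"
      by (rule Lim_transform_eventually[OF tendsto_const]) (auto simp: eventually_at_filter flat_def)
    ultimately have "((\<lambda>h. flat p h / h) \<longlongrightarrow> 0) (at 0)" by (rule filterlim_split_at[rotated])
    then show ?thesis using 3 by (simp add: DERIV_def flat_def)
  qed
qed

lemma smooth_flat: "smooth (flat p)"
proof (rule smoothI_closed)
  show "flat p \<in> range flat" by simp
  fix g assume "g \<in> range flat"
  then obtain q where g: "g = flat q" by blast
  show "g differentiable (at x)" for x
    unfolding g using DERIV_flat[of q] by (auto simp: real_differentiable_def)
  have "deriv g = flat ([:0, 0, 1:] * (q - pderiv q))"
    unfolding g using DERIV_flat[of q] by (auto intro: DERIV_imp_deriv)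
  then show "deriv g \<in> range flat" by simp
qed

lemma flat_1_bounds: "0 \<le> flat 1 x" "flat 1 x \<le> 1" "x \<le> 0 \<Longrightarrow> flat 1 x = 0" "0 < x \<Longrightarrow> 0 < flat 1 x"
  by (auto simp: flat_def)

text \<open>Since \<open>exp (- 1 / (n t)) \<longrightarrow> 1\<close> for \<open>t > 0\<close>, these test functions increase to the
  indicator function of the interval from \<open>a\<close> to \<open>b\<close>.\<close>

definition bump :: "real \<Rightarrow> real \<Rightarrow> nat \<Rightarrow> real \<Rightarrow> real" where
  "bump a b n x = flat 1 (real (Suc n) * (x - a)) * flat 1 (real (Suc n) * (b - x))"

section \<open>Test functions on the half line\<close>

lemma test_fun_iff: "test_fun \<Omega> \<phi> \<longleftrightarrow> smooth \<phi> \<and> (\<exists>K. compact K \<and> K \<subseteq> \<Omega> \<and> (\<forall>x. x \<notin> K \<longrightarrow> \<phi> x = 0))"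
  by (simp add: test_fun_def smooth_def)

lemma bump_zero: "x \<notin> {a<..<b} \<Longrightarrow> bump a b n x = 0"
proof -
  assume "x \<notin> {a<..<b}"
  then have "real (Suc n) * (x - a) \<le> 0 \<or> real (Suc n) * (b - x) \<le> 0"
    by (auto simp: mult_le_0_iff)
  then show ?thesis by (auto simp: bump_def flat_1_bounds)
qed

lemma bump_pos: "a < x \<Longrightarrow> x < b \<Longrightarrow> 0 < bump a b n x"
  by (simp add: bump_def flat_1_bounds)

lemma bump_bounds: "0 \<le> bump a b n x" "bump a b n x \<le> 1"
  by (auto simp: bump_def flat_1_bounds mult_le_one)

lemma smooth_bump: "smooth (bump a b n)"
proof -
  have "smooth (\<lambda>x. flat 1 (real (Suc n) * x + (- real (Suc n) * a)) * flat 1 ((- real (Suc n)) * x + real (Suc n) * b))"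
    by (intro smooth_mult smooth_affine smooth_flat)
  then show ?thesis by (simp add: bump_def[abs_def] algebra_simps)
qed

lemma test_fun_bump: "0 < a \<Longrightarrow> test_fun half_line (bump a b n)"
  unfolding test_fun_iff
  by (intro conjI smooth_bump exI[of _ "{a..b}"]) (auto intro!: bump_zero)

lemma bump_tendsto: "(\<lambda>n. bump a b n x) \<longlonglongrightarrow> indicator {a<..<b} x"
proof (cases "x \<in> {a<..<b}")
  case True
  have *: "(\<lambda>n. flat 1 (real (Suc n) * t)) \<longlonglongrightarrow> 1" if "0 < t" for t
  proof -
    have "(\<lambda>n. exp (- (1 / t * inverse (real (Suc n))))) \<longlonglongrightarrow> exp (- (1 / t * 0))"
      by (intro tendsto_intros LIMSEQ_inverse_real_of_nat)
    moreover have "flat 1 (real (Suc n) * t) = exp (- (1 / t * inverse (real (Suc n))))" for n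
    proof -
      have "0 < real (Suc n) * t" using that by (intro mult_pos_pos) auto
      then show ?thesis by (simp add: flat_def divide_inverse mult.commute del: of_nat_Suc)
    qed
    ultimately show ?thesis by simp
  qed
  show ?thesis
    using tendsto_mult[OF *[of "x - a"] *[of "b - x"]] True by (simp add: bump_def)
next
  case False
  then show ?thesis by (simp add: bump_zero)
qed

lemma test_fun_bounded_support:
  assumes "test_fun half_line \<phi>"
  obtains a b where "0 < a" "a < b" "\<And>x. x \<notin> {a..b} \<Longrightarrow> \<phi> x = 0"
proof -
  obtain K where K: "compact K" "K \<subseteq> half_line" "\<And>x. x \<notin> K \<Longrightarrow> \<phi> x = 0"
    using assms by (auto simp: test_fun_iff)
  show ?thesis
  proof (cases "K = {}")
    case True then show ?thesis using K that[of 1 2] by auto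
  next
    case False
    obtain a where a: "a \<in> K" "\<And>x. x \<in> K \<Longrightarrow> a \<le> x" using compact_attains_inf[OF K(1) False] by blast
    obtain b where b: "b \<in> K" "\<And>x. x \<in> K \<Longrightarrow> x \<le> b" using compact_attains_sup[OF K(1) False] by blast
    show ?thesis
    proof (rule that[of a "b + 1"])
      show "0 < a" using a K by auto
      show "a < b + 1" using a b by fastforce
      show "\<phi> x = 0" if "x \<notin> {a..b + 1}" for x using that a b K(3)[of x] by force
    qed
  qed
qed

lemma deriv_zero_outside:
  assumes "\<And>x. x \<notin> {a..b} \<Longrightarrow> \<phi> x = (0::real)" "x \<notin> {a..b}"
  shows "deriv \<phi> x = 0"
proof -
  have "((\<lambda>_. 0) has_real_derivative 0) (at x)" by simp
  then have "(\<phi> has_real_derivative 0) (at x)"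
    by (rule has_field_derivative_transform_within_open[where S = "- {a..b}"]) (use assms in auto)
  then show ?thesis by (rule DERIV_imp_deriv)
qed

lemma test_fun_deriv: "test_fun half_line \<phi> \<Longrightarrow> test_fun half_line (deriv \<phi>)"
proof -
  assume t: "test_fun half_line \<phi>"
  obtain a b where ab: "0 < a" "a < b" "\<And>x. x \<notin> {a..b} \<Longrightarrow> \<phi> x = 0"
    using test_fun_bounded_support[OF t] by blast
  have "deriv \<phi> x = 0" if "x \<notin> {a..b}" for x by (rule deriv_zero_outside[OF ab(3) that])
  then show ?thesis using t ab(1) unfolding test_fun_iff
    by (intro conjI smooth_deriv exI[of _ "{a..b}"]) auto
qed

lemma test_fun_lincomb:
  assumes "test_fun half_line \<phi>" "test_fun half_line \<psi>"
  shows "test_fun half_line (\<lambda>x. \<phi> x - c * \<psi> x)"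
proof -
  obtain K where K: "compact K" "K \<subseteq> half_line" "\<forall>x. x \<notin> K \<longrightarrow> \<phi> x = 0" using assms(1) by (auto simp: test_fun_iff)
  obtain L where L: "compact L" "L \<subseteq> half_line" "\<forall>x. x \<notin> L \<longrightarrow> \<psi> x = 0" using assms(2) by (auto simp: test_fun_iff)
  show ?thesis
    unfolding test_fun_iff
    by (intro conjI smooth_lincomb exI[of _ "K \<union> L"]) (use assms K L in \<open>auto simp: test_fun_iff\<close>)
qed

text \<open>Bounded support allows any rate of decay; the exponential form is the one that
  \<open>antider_fubini\<close> asks for.\<close>

lemma test_fun_exp_bound:
  assumes "test_fun half_line \<phi>"
  obtains C where "0 \<le> C" "\<And>x. \<bar>\<phi> x\<bar> \<le> C * exp (- x)"
proof -
  obtain a b where ab: "0 < a" "a < b" "\<And>x. x \<notin> {a..b} \<Longrightarrow> \<phi> x = 0"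
    using test_fun_bounded_support[OF assms] by blast
  have "continuous_on {a..b} (\<lambda>x. \<phi> x * exp x)"
    using assms by (intro continuous_intros smooth_continuous_on) (simp add: test_fun_iff)
  then have "bounded ((\<lambda>x. \<phi> x * exp x) ` {a..b})"
    by (intro compact_imp_bounded compact_continuous_image) auto
  then obtain C where C: "0 < C" "\<And>x. x \<in> {a..b} \<Longrightarrow> \<bar>\<phi> x * exp x\<bar> \<le> C"
    by (auto simp: bounded_pos)
  have "\<bar>\<phi> x\<bar> \<le> C * exp (- x)" for x
  proof (cases "x \<in> {a..b}")
    case True then show ?thesis using C(2)[of x] by (simp add: abs_mult exp_minus field_simps)
  qed (use ab(3) C(1) in auto)
  then show ?thesis using that C(1) by (meson less_imp_le)
qed

lemma continuous_imp_measurable_half: "continuous_on half_line f \<Longrightarrow> f \<in> borel_measurable half_lebesgue"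
  by (rule continuous_imp_measurable_on_sets_lebesgue) auto

lemma borel_measurable_half: "f \<in> borel_measurable borel \<Longrightarrow> f \<in> borel_measurable half_lebesgue"
  by (intro measurable_restrict_space1 measurable_completion) simp

lemma test_fun_measurable: "test_fun half_line \<phi> \<Longrightarrow> \<phi> \<in> borel_measurable half_lebesgue"
  by (intro continuous_imp_measurable_half smooth_continuous_on) (simp add: test_fun_iff)

lemma sqint_test_fun: "test_fun half_line \<phi> \<Longrightarrow> sqint half_line \<phi>"
proof -
  assume t: "test_fun half_line \<phi>"
  obtain C where C: "0 \<le> C" "\<And>x. \<bar>\<phi> x\<bar> \<le> C * exp (- x)" using test_fun_exp_bound[OF t] by blast
  have "sqint half_line (\<lambda>x. C * exp (- 1 * x))" by (intro sqint_scale sqint_exp) simp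
  then show ?thesis
    by (rule sqintI_bound[OF test_fun_measurable[OF t]]) (use C in auto)
qed

section \<open>Locally integrable functions and the fundamental lemma\<close>

text \<open>Integrability reaches down to the end point 0 and is local only at infinity. Both L2
  functions and functions continuous on the whole line qualify.\<close>

definition locint :: "(real \<Rightarrow> real) \<Rightarrow> bool" where
  "locint m \<longleftrightarrow> m \<in> borel_measurable half_lebesgue \<and>
    (\<forall>b. integrable half_lebesgue (\<lambda>x. indicator {..b} x * m x))"

lemma sqint_indicator: "sqint half_line (indicator {..b})"
proof (rule sqintI_bound)
  have "sqint half_line (\<lambda>x. exp b * exp (- 1 * x))" by (intro sqint_scale sqint_exp) simp
  then show "sqint half_line (\<lambda>x. exp b * exp (- 1 * x))" .
  show "AE x in half_lebesgue. \<bar>indicat_real {..b} x\<bar> \<le> \<bar>exp b * exp (- 1 * x)\<bar>"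
    by (auto simp: indicator_def exp_add[symmetric] abs_mult)
  show "indicat_real {..b} \<in> borel_measurable half_lebesgue"
    by (rule borel_measurable_half) auto
qed

lemma locint_sqint: "sqint half_line f \<Longrightarrow> locint f"
  using sqint_mult_integrable[OF sqint_indicator] by (auto simp: locint_def sqint_def)

lemma locint_diff: "locint f \<Longrightarrow> locint g \<Longrightarrow> locint (\<lambda>x. f x - g x)"
  by (auto simp: locint_def right_diff_distrib)

lemma locint_mult_integrable:
  assumes "locint m" "\<phi> \<in> borel_measurable half_lebesgue" "\<And>x. \<bar>\<phi> x\<bar> \<le> C" "\<And>x. b < x \<Longrightarrow> \<phi> x = 0"
  shows "integrable half_lebesgue (\<lambda>x. m x * \<phi> x)"
proof (rule Bochner_Integration.integrable_bound)
  show "integrable half_lebesgue (\<lambda>x. C * (indicator {..b} x * m x))"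
    using assms(1) by (simp add: locint_def)
  show "(\<lambda>x. m x * \<phi> x) \<in> borel_measurable half_lebesgue" using assms(1,2) by (auto simp: locint_def)
  have "\<bar>m x * \<phi> x\<bar> \<le> \<bar>C * (indicator {..b} x * m x)\<bar>" for x
    using mult_left_mono[OF assms(3)[of x], of "\<bar>m x\<bar>"] assms(3)[of x] assms(4)[of x]
    by (cases "x \<le> b") (auto simp: abs_mult mult.commute)
  then show "AE x in half_lebesgue. norm (m x * \<phi> x) \<le> norm (C * (indicator {..b} x * m x))" by simp
qed

text \<open>The positive and the negative part of \<open>f\<close> define finite measures that agree
  on all rays and therefore coincide; equality of their densities means that \<open>f\<close>
  vanishes.\<close>

lemma AE_zero_if_Ioi_integrals_zero:
  fixes f :: "real \<Rightarrow> real"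
  assumes f: "integrable lborel f" and z: "\<And>x. (\<integral>y. indicator {x<..} y * f y \<partial>lborel) = 0"
  shows "AE x in lborel. f x = 0"
proof -
  have [measurable]: "f \<in> borel_measurable borel" using f by auto
  have eq: "emeasure (density lborel (\<lambda>y. ennreal (f y))) {x<..} = emeasure (density lborel (\<lambda>y. ennreal (- f y))) {x<..}"
    and fin: "emeasure (density lborel (\<lambda>y. ennreal (f y))) {x<..} < \<infinity>" for x
  proof -
    have e: "emeasure (density lborel (\<lambda>y. ennreal (g y))) {x<..} = ennreal (\<integral>y. max 0 (indicator {x<..} y * g y) \<partial>lborel)"
      if "integrable lborel g" for g
    proof -
      have [measurable]: "g \<in> borel_measurable borel" using that by auto
      have i: "integrable lborel (\<lambda>y. max 0 (indicator {x<..} y * g y))"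
        using integrable_mult_indicator[of "{x<..}" lborel g] that by (intro integrable_max) auto
      have "emeasure (density lborel (\<lambda>y. ennreal (g y))) {x<..} = (\<integral>\<^sup>+y. ennreal (g y) * indicator {x<..} y \<partial>lborel)"
        by (simp add: emeasure_density)
      also have "\<dots> = (\<integral>\<^sup>+y. ennreal (max 0 (indicator {x<..} y * g y)) \<partial>lborel)"
        by (intro nn_integral_cong) (auto simp: indicator_def ennreal_max_0)
      also have "\<dots> = ennreal (\<integral>y. max 0 (indicator {x<..} y * g y) \<partial>lborel)"
        by (rule nn_integral_eq_integral[OF i]) simp
      finally show ?thesis .
    qed
    show "emeasure (density lborel (\<lambda>y. ennreal (f y))) {x<..} < \<infinity>" unfolding e[OF f] by simp
    have i: "integrable lborel (\<lambda>y. indicator {x<..} y * f y)"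
      using integrable_mult_indicator[of "{x<..}" lborel f] f by simp
    have "(\<integral>y. max 0 (indicator {x<..} y * f y) \<partial>lborel) - (\<integral>y. max 0 (indicator {x<..} y * - f y) \<partial>lborel)
      = (\<integral>y. max 0 (indicator {x<..} y * f y) - max 0 (indicator {x<..} y * - f y) \<partial>lborel)"
      using i by (intro Bochner_Integration.integral_diff[symmetric] integrable_max) auto
    also have "\<dots> = (\<integral>y. indicator {x<..} y * f y \<partial>lborel)"
      by (intro Bochner_Integration.integral_cong) (auto simp: max_def)
    also have "\<dots> = 0" by (rule z)
    finally show "emeasure (density lborel (\<lambda>y. ennreal (f y))) {x<..} = emeasure (density lborel (\<lambda>y. ennreal (- f y))) {x<..}"
      using e[OF f] e[of "\<lambda>y. - f y"] f by simp
  qed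
  have "density lborel (\<lambda>y. ennreal (f y)) = density lborel (\<lambda>y. ennreal (- f y))"
    by (rule measure_eqI_lessThan[OF _ _ fin eq]) auto
  then have "AE x in lborel. ennreal (f x) = ennreal (- f x)"
    by (intro sigma_finite_measure.density_unique[OF lborel.sigma_finite_measure_axioms]) auto
  then show ?thesis
  proof eventually_elim
    case (elim x)
    then show ?case by (cases "0 \<le> f x") (auto simp: ennreal_neg ennreal_eq_0_iff)
  qed
qed

text \<open>Fubini's theorem and the uniqueness of measures are applied below to Borel functions,
  whereas a function measurable for \<open>half_lebesgue\<close> is Borel only up to a null
  set.\<close>

lemma half_lebesgue_borel_version:
  assumes "f \<in> borel_measurable half_lebesgue"
  obtains g :: "real \<Rightarrow> real" where "g \<in> borel_measurable borel" "\<And>x. x \<le> 0 \<Longrightarrow> g x = 0"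
    "AE x in half_lebesgue. f x = g x"
proof -
  have "(\<lambda>x. indicator half_line x *\<^sub>R f x) \<in> borel_measurable lebesgue"
    using assms by (subst (asm) borel_measurable_restrict_space_iff) auto
  then obtain g where g: "g \<in> borel_measurable lborel" "AE x in lborel. indicator half_line x *\<^sub>R f x = g x"
    using completion_ex_borel_measurable_real by blast
  have "AE x in lebesgue. indicator half_line x *\<^sub>R f x = g x" using g(2) by (rule AE_completion)
  then have "AE x in half_lebesgue. f x = indicator half_line x * g x"
    by (auto simp: AE_restrict_space_iff elim!: AE_mp)
  then show ?thesis using g(1) by (intro that[of "\<lambda>x. indicator half_line x * g x"]) auto
qed

lemma half_lebesgue_integral_borel:
  fixes f :: "real \<Rightarrow> real"
  assumes "f \<in> borel_measurable borel"
  shows "(\<integral>x. f x \<partial>half_lebesgue) = (\<integral>x. indicator half_line x * f x \<partial>lborel)"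
    and "integrable half_lebesgue f \<longleftrightarrow> integrable lborel (\<lambda>x. indicator half_line x * f x)"
proof -
  have [measurable]: "(\<lambda>x. indicator half_line x * f x) \<in> borel_measurable lborel" using assms by measurable
  show "(\<integral>x. f x \<partial>half_lebesgue) = (\<integral>x. indicator half_line x * f x \<partial>lborel)"
    by (subst integral_restrict_space) (auto simp: integral_completion)
  show "integrable half_lebesgue f \<longleftrightarrow> integrable lborel (\<lambda>x. indicator half_line x * f x)"
    by (subst integrable_restrict_space) (auto simp: integrable_completion)
qed

text \<open>Bump functions converge boundedly to indicators of intervals, so the integrals of
  \<open>m\<close> over all bounded intervals away from 0 vanish; these determine \<open>m\<close>
  almost everywhere.\<close>

lemma fundamental_lemma:
  assumes m: "locint m" and z: "\<And>\<phi>. test_fun half_line \<phi> \<Longrightarrow> (\<integral>x. m x * \<phi> x \<partial>half_lebesgue) = 0"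
  shows "AE x in half_lebesgue. m x = 0"
proof -
  have mm [measurable]: "m \<in> borel_measurable half_lebesgue" using m by (simp add: locint_def)
  have int0: "(\<integral>x. m x * indicator {a<..<b} x \<partial>half_lebesgue) = 0" if "0 < a" for a b
  proof -
    have "(\<lambda>n. \<integral>x. m x * bump a b n x \<partial>half_lebesgue) \<longlonglongrightarrow> (\<integral>x. m x * indicator {a<..<b} x \<partial>half_lebesgue)"
    proof (rule integral_dominated_convergence)
      show "integrable half_lebesgue (\<lambda>x. \<bar>indicator {..b} x * m x\<bar>)" using m by (simp add: locint_def)
      show "(\<lambda>x. m x * bump a b n x) \<in> borel_measurable half_lebesgue" for n
        using test_fun_measurable[OF test_fun_bump[OF that]] by measurable
      show "(\<lambda>x. m x * indicator {a<..<b} x) \<in> borel_measurable half_lebesgue"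
        by (intro borel_measurable_times mm borel_measurable_half) auto
      show "AE x in half_lebesgue. (\<lambda>n. m x * bump a b n x) \<longlonglongrightarrow> m x * indicator {a<..<b} x"
        by (auto intro!: tendsto_mult bump_tendsto)
      have "\<bar>m x * bump a b n x\<bar> \<le> \<bar>indicator {..b} x * m x\<bar>" for n x
        using bump_bounds[of a b n x] bump_zero[of x a b n]
        by (cases "x \<le> b") (auto simp: abs_mult mult_left_le)
      then show "AE x in half_lebesgue. norm (m x * bump a b n x) \<le> \<bar>indicator {..b} x * m x\<bar>" for n
        by simp
    qed
    then show ?thesis using z[OF test_fun_bump[OF that]] by (simp add: LIMSEQ_const_iff)
  qed
  obtain g where g [measurable]: "g \<in> borel_measurable borel" and g0: "\<And>x. x \<le> 0 \<Longrightarrow> g x = 0"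
    and gm: "AE x in half_lebesgue. m x = g x"
    using half_lebesgue_borel_version[OF mm] by blast
  have gmh: "g \<in> borel_measurable half_lebesgue" by (rule borel_measurable_half[OF g])
  have ind: "indicat_real A \<in> borel_measurable half_lebesgue" if "A \<in> sets borel" for A
    using that by (intro borel_measurable_half) auto
  have part: "AE x in lborel. indicator {a<..<b} x * g x = 0" if "0 < a" for a b
  proof (rule AE_zero_if_Ioi_integrals_zero)
    have i: "indicator half_line x * (indicator {..b} x * g x) = indicator {..b} x * g x" for x
      using g0[of x] by (auto simp: indicator_def)
    have "integrable half_lebesgue (\<lambda>x. indicator {..b} x * m x)" using m by (simp add: locint_def)
    also have "integrable half_lebesgue (\<lambda>x. indicator {..b} x * m x) \<longleftrightarrow>
        integrable half_lebesgue (\<lambda>x. indicator {..b} x * g x)"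
      by (intro integrable_cong_AE borel_measurable_times mm gmh ind) (use gm in auto)
    also have "\<dots> \<longleftrightarrow> integrable lborel (\<lambda>x. indicator {..b} x * g x)"
      by (subst half_lebesgue_integral_borel(2)) (simp_all add: i)
    finally have "integrable lborel (\<lambda>x. indicator {a<..<b} x *\<^sub>R (indicator {..b} x * g x))"
      by (intro integrable_mult_indicator) auto
    moreover have "(\<lambda>x. indicator {a<..<b} x *\<^sub>R (indicator {..b} x * g x)) = (\<lambda>x. indicator {a<..<b} x * g x)"
      by (auto simp: indicator_def fun_eq_iff)
    ultimately show "integrable lborel (\<lambda>x. indicator {a<..<b} x * g x)" by (simp only:)
    fix y
    have "(\<integral>x. indicator {y<..} x * (indicator {a<..<b} x * g x) \<partial>lborel)
      = (\<integral>x. indicator half_line x * (g x * indicator {max a y<..<b} x) \<partial>lborel)"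
      using that by (intro Bochner_Integration.integral_cong) (auto simp: indicator_def)
    also have "\<dots> = (\<integral>x. g x * indicator {max a y<..<b} x \<partial>half_lebesgue)"
      by (rule half_lebesgue_integral_borel(1)[symmetric]) measurable
    also have "\<dots> = (\<integral>x. m x * indicator {max a y<..<b} x \<partial>half_lebesgue)"
      by (intro integral_cong_AE borel_measurable_times mm gmh ind) (use gm in auto)
    also have "\<dots> = 0" using that by (intro int0) auto
    finally show "(\<integral>x. indicator {y<..} x * (indicator {a<..<b} x * g x) \<partial>lborel) = 0" .
  qed
  \<comment> \<open>These intervals exhaust the open half line, so countably many null sets
    suffice.\<close>
  have "AE x in lborel. \<forall>n::nat. indicator {inverse (real (Suc n))<..<real n} x * g x = 0"
    by (intro AE_all_countable[THEN iffD2] allI part) simp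
  then have "AE x in lborel. g x = 0"
  proof eventually_elim
    case (elim x)
    show ?case
    proof (cases "0 < x")
      case True
      obtain n1 where n1: "inverse (real (Suc n1)) < x" using reals_Archimedean[OF True] by blast
      obtain n2 where n2: "x < real n2" using reals_Archimedean2 by blast
      define n where "n = max n1 n2"
      have "inverse (real (Suc n)) \<le> inverse (real (Suc n1))" by (simp add: n_def)
      then have "inverse (real (Suc n)) < x" using n1 by linarith
      moreover have "x < real n" using n2 by (simp add: n_def)
      ultimately have "x \<in> {inverse (real (Suc n))<..<real n}" by simp
      then show ?thesis using elim[rule_format, of n] by simp
    qed (use g0 in auto)
  qed
  then have "AE x in lebesgue. g x = 0" by (rule AE_completion)
  then have "AE x in half_lebesgue. g x = 0" by (auto simp: AE_restrict_space_iff elim!: AE_mp)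
  with gm show ?thesis by eventually_elim simp
qed

section \<open>Tail integrals and primitives of test functions\<close>

lemma not_AE_half_interval:
  assumes "0 \<le> a" "a < b" "AE x in half_lebesgue. x \<notin> {a<..<b}"
  shows False
proof -
  have "AE x in lebesgue. x \<in> half_line \<longrightarrow> x \<notin> {a<..<b}"
    using assms(3) by (subst (asm) AE_restrict_space_iff) auto
  then have "AE x in lebesgue. x \<notin> {a<..<b}"
    by eventually_elim (use assms(1) in auto)
  then have "{a<..<b} \<in> null_sets lebesgue" by (subst (asm) AE_iff_null_sets[symmetric]) auto
  then have "emeasure lebesgue {a<..<b} = 0" by blast
  then show False using assms(2) by simp
qed

lemma half_integral_tail:
  fixes f :: "real \<Rightarrow> real"
  assumes f: "integrable half_lebesgue f" and y: "0 < y"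
  shows "integrable half_lebesgue (\<lambda>x. indicator {y..} x * f x)"
    and "(\<integral>x. indicator {y..} x * f x \<partial>half_lebesgue) = integral {y..} f"
proof -
  have sub: "{y..} \<subseteq> half_line" using y by auto
  have "set_integrable lebesgue half_line f"
    using f by (simp add: set_integrable_def integrable_restrict_space)
  then have s: "set_integrable lebesgue {y..} f" by (rule set_integrable_subset) (use sub in auto)
  have eq: "indicator half_line x *\<^sub>R (indicator {y..} x * f x) = indicator {y..} x *\<^sub>R f x" for x
    using y by (auto simp: indicator_def)
  show "integrable half_lebesgue (\<lambda>x. indicator {y..} x * f x)"
    using s unfolding set_integrable_def by (subst integrable_restrict_space) (simp_all only: eq, auto)
  have "(\<integral>x. indicator {y..} x * f x \<partial>half_lebesgue) = (\<integral>x. indicator {y..} x *\<^sub>R f x \<partial>lebesgue)"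
    by (subst integral_restrict_space) (simp_all only: eq, auto)
  also have "\<dots> = integral {y..} f"
    using set_lebesgue_integral_eq_integral(2)[OF s] by (simp add: set_lebesgue_integral_def)
  finally show "(\<integral>x. indicator {y..} x * f x \<partial>half_lebesgue) = integral {y..} f" .
qed

lemma integrable_half_exp_bound:
  assumes "f \<in> borel_measurable half_lebesgue" "0 < k" "\<And>x. 0 < x \<Longrightarrow> \<bar>f x\<bar> \<le> C * exp (- k * x)"
  shows "integrable half_lebesgue f"
proof (rule Bochner_Integration.integrable_bound)
  show "integrable half_lebesgue (\<lambda>x. C * exp (- k * x))"
    using integral_exp_half_line[OF assms(2)] by (simp add: has_bochner_integral_iff)
  have "\<bar>f x\<bar> \<le> \<bar>C * exp (- k * x)\<bar>" if "0 < x" for x using assms(3)[OF that] by linarith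
  then show "AE x in half_lebesgue. norm (f x) \<le> norm (C * exp (- k * x))"
    by (intro AE_I2) (auto simp: space_restrict_space)
qed fact

lemma integrable_test_fun: "test_fun half_line \<phi> \<Longrightarrow> integrable half_lebesgue \<phi>"
  by (metis integrable_half_exp_bound[of \<phi> 1] test_fun_exp_bound test_fun_measurable mult_minus1 zero_less_one)

lemma tail_integral_exp:
  assumes "0 < k" "0 < y"
  shows "(\<integral>x. indicator {y..} x * (k * exp (- k * x)) \<partial>half_lebesgue) = exp (- k * y)"
proof -
  have "integrable half_lebesgue (\<lambda>x. k * exp (- k * x))"
    using integral_exp_half_line[OF assms(1)] by (simp add: has_bochner_integral_iff)
  from half_integral_tail(2)[OF this assms(2)]
  have "(\<integral>x. indicator {y..} x * (k * exp (- k * x)) \<partial>half_lebesgue) = integral {y..} (\<lambda>x. k * exp (- k * x))" .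
  also have "((\<lambda>x. k * exp (- k * x)) has_integral k * (exp (- k * y) / k)) {y..}"
    by (intro has_integral_mult_right has_integral_exp_minus_to_infinity assms)
  from integral_unique[OF this] have "integral {y..} (\<lambda>x. k * exp (- k * x)) = exp (- k * y)"
    using assms by simp
  finally show ?thesis .
qed

lemma tail_integral_deriv_test_fun:
  assumes "test_fun half_line \<phi>" "0 < y"
  shows "(\<integral>x. indicator {y..} x * deriv \<phi> x \<partial>half_lebesgue) = - \<phi> y"
proof -
  obtain a b where ab: "0 < a" "a < b" "\<And>x. x \<notin> {a..b} \<Longrightarrow> \<phi> x = 0"
    using test_fun_bounded_support[OF assms(1)] by blast
  define B where "B = max b y + 1"
  have d0: "deriv \<phi> x = 0" if "B \<le> x" for x
    by (rule deriv_zero_outside[OF ab(3)]) (use that in \<open>auto simp: B_def\<close>)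
  have "(deriv \<phi> has_integral (\<phi> B - \<phi> y)) {y..B}"
  proof (rule fundamental_theorem_of_calculus)
    show "y \<le> B" by (simp add: B_def)
    show "(\<phi> has_vector_derivative deriv \<phi> x) (at x within {y..B})" for x
      using smooth_DERIV[of \<phi> x] assms(1) unfolding test_fun_iff
      by (simp add: has_real_derivative_iff_has_vector_derivative has_vector_derivative_at_within)
  qed
  moreover have "{x \<in> {y..B} - {y..}. deriv \<phi> x \<noteq> 0} = {}" "{x \<in> {y..} - {y..B}. deriv \<phi> x \<noteq> 0} = {}"
    using d0 less_imp_le[of B] by (auto simp: not_le)
  ultimately have "(deriv \<phi> has_integral (\<phi> B - \<phi> y)) {y..}"
    by (subst (asm) has_integral_spike_set_eq[where T = "{y..}"]) (simp_all only: negligible_empty)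
  moreover have "\<phi> B = 0" by (rule ab(3)) (auto simp: B_def)
  ultimately show ?thesis
    using half_integral_tail(2)[OF integrable_test_fun[OF test_fun_deriv[OF assms(1)]] assms(2)]
    by (simp add: integral_unique)
qed

text \<open>A vanishing integral makes the primitive return to 0 beyond the support of
  \<open>\<psi>\<close>, so that it is again compactly supported.\<close>

lemma test_fun_primitive:
  assumes t: "test_fun half_line \<psi>" and z: "(\<integral>x. \<psi> x \<partial>half_lebesgue) = 0"
  shows "\<exists>\<phi>. test_fun half_line \<phi> \<and> deriv \<phi> = \<psi>"
proof -
  obtain a b where ab: "0 < a" "a < b" "\<And>x. x \<notin> {a..b} \<Longrightarrow> \<psi> x = 0"
    using test_fun_bounded_support[OF t] by blast
  have sm: "smooth \<psi>" using t by (simp add: test_fun_iff)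
  define \<phi> where "\<phi> x = integral {0..x} \<psi>" for x
  have left: "\<phi> x = 0" if "x < a" for x
  proof -
    have "integral {0..x} \<psi> = integral {0..x} (\<lambda>_. 0)"
      by (rule Henstock_Kurzweil_Integration.integral_cong) (use that ab(3) in auto)
    then show ?thesis by (simp add: \<phi>_def)
  qed
  have der: "(\<phi> has_real_derivative \<psi> x) (at x)" for x
  proof (cases "x < a")
    case True
    have "((\<lambda>_. 0) has_real_derivative \<psi> x) (at x)" using True ab(3)[of x] by simp
    then show ?thesis
      by (rule has_field_derivative_transform_within_open[where S = "{..<a}"]) (use True left in auto)
  next
    case False
    then have x: "0 < x" using ab(1) by linarith
    have "(\<phi> has_vector_derivative \<psi> x) (at x within {0..x + 1})"
      unfolding \<phi>_def by (rule integral_has_vector_derivative[OF smooth_continuous_on[OF sm]]) (use x in auto)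
    moreover have "at x within {0..x + 1} = at x" using x by (intro at_within_interior) auto
    ultimately show ?thesis by (simp add: has_real_derivative_iff_has_vector_derivative)
  qed
  have right: "\<phi> x = 0" if "b < x" for x
  proof -
    have "integral half_line \<psi> = 0"
      using lebesgue_integral_eq_integral[OF integrable_test_fun[OF t]] z by simp
    moreover have "integral half_line \<psi> = integral {0..x} \<psi>"
    proof (rule integral_spike_set)
      show "negligible {z \<in> half_line - {0..x}. \<psi> z \<noteq> 0}"
      proof -
        have "\<psi> y = 0" if "x < y" for y using ab(3)[of y] that \<open>b < x\<close> by simp
        then have "{z \<in> half_line - {0..x}. \<psi> z \<noteq> 0} = {}" by (auto simp: not_le)
        then show ?thesis by (simp only: negligible_empty)
      qed
      show "negligible {z \<in> {0..x} - half_line. \<psi> z \<noteq> 0}"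
        by (rule negligible_subset[of "{0}"]) auto
    qed
    ultimately show ?thesis by (simp add: \<phi>_def)
  qed
  have "smooth \<phi>" by (rule smooth_iff_deriv[OF der sm])
  moreover have "\<phi> x = 0" if "x \<notin> {a..b}" for x using that left[of x] right[of x] by auto
  moreover have "{a..b} \<subseteq> half_line" using ab by auto
  ultimately have "test_fun half_line \<phi>"
    unfolding test_fun_iff by (intro conjI exI[of _ "{a..b}"]) auto
  moreover have "deriv \<phi> = \<psi>" using der by (auto intro: DERIV_imp_deriv)
  ultimately show ?thesis by blast
qed

section \<open>Antiderivatives of square integrable functions\<close>

text \<open>As an inner product it is independent of the representative and linear in
  \<open>u\<close>, and Cauchy-Schwarz makes it Hoelder continuous with exponent 1/2.\<close>

definition antider :: "l2 \<Rightarrow> real \<Rightarrow> real" where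
  "antider u x = inner u (abs_l2 (indicator {..x}))"

lemma antider_eq: "antider u x = (\<integral>y. rep_l2 u y * indicator {..x} y \<partial>half_lebesgue)"
  unfolding antider_def by (rule inner_abs_l2_right[OF sqint_indicator])

lemma antider_nonpos: "x \<le> 0 \<Longrightarrow> antider u x = 0"
proof -
  assume "x \<le> 0"
  have "(\<integral>y. rep_l2 u y * indicator {..x} y \<partial>half_lebesgue) = (\<integral>y. 0 \<partial>half_lebesgue)"
    by (intro Bochner_Integration.integral_cong) (use \<open>x \<le> 0\<close> in \<open>auto simp: indicator_def space_restrict_space\<close>)
  then show ?thesis by (simp add: antider_eq)
qed

lemma antider_holder:
  assumes "0 \<le> x" "x \<le> z"
  shows "\<bar>antider u z - antider u x\<bar> \<le> norm u * sqrt (z - x)"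
proof -
  let ?d = "abs_l2 (indicator {..z}) - abs_l2 (indicator {..x})"
  have d: "?d = abs_l2 (\<lambda>y. indicator {..z} y - indicator {..x} y)"
    by (simp add: abs_l2_diff sqint_indicator)
  have "(norm ?d)\<^sup>2 = (\<integral>y. (indicator {..z} y - indicator {..x} y)\<^sup>2 \<partial>half_lebesgue)"
    unfolding d by (rule norm_abs_l2_sq) (intro sqint_diff sqint_indicator)
  also have "\<dots> = (\<integral>y. indicator {x<..z} y \<partial>half_lebesgue)"
    using assms by (intro Bochner_Integration.integral_cong) (auto simp: indicator_def)
  also have "\<dots> = (\<integral>y. indicator half_line y * indicator {x<..z} y \<partial>lborel)"
    by (rule half_lebesgue_integral_borel) simp
  also have "\<dots> = (\<integral>y. indicator {x<..z} y \<partial>lborel)"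
    using assms by (intro Bochner_Integration.integral_cong) (auto simp: indicator_def)
  also have "\<dots> = z - x" using assms by simp
  finally have "norm ?d = sqrt (z - x)" by (metis norm_ge_zero real_sqrt_unique)
  then show ?thesis
    using Cauchy_Schwarz_ineq2[of u ?d] by (simp add: antider_def inner_diff_right)
qed

lemma continuous_antider: "continuous_on UNIV (antider u)"
proof -
  have "continuous_on {0..} (antider u)"
  proof (rule continuous_onI)
    fix x e :: real assume x: "x \<in> {0..}" "0 < e"
    define d where "d = (e / (norm u + 1))\<^sup>2"
    have n: "0 < norm u + 1" using norm_ge_zero[of u] by linarith
    have d: "0 < d" using x n by (simp add: d_def)
    have "dist (antider u z) (antider u x) \<le> e" if z: "z \<in> {0..}" "dist z x < d" for z
    proof -
      have "\<bar>antider u z - antider u x\<bar> \<le> norm u * sqrt \<bar>z - x\<bar>"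
        using antider_holder[of x z u] antider_holder[of z x u] x z by (cases "x \<le> z") auto
      also have "\<dots> \<le> (norm u + 1) * sqrt d"
        using z n by (intro mult_mono real_sqrt_le_mono) (auto simp: dist_real_def)
      also have "\<dots> = e" using x n by (simp add: d_def real_sqrt_abs)
      finally show ?thesis by (simp add: dist_real_def)
    qed
    then show "\<exists>d>0. \<forall>x'\<in>{0..}. dist x' x < d \<longrightarrow> dist (antider u x') (antider u x) \<le> e"
      using d by blast
  qed
  then have "continuous_on UNIV (\<lambda>x. antider u (max 0 x))"
    by (rule continuous_on_compose2) (auto intro!: continuous_intros)
  moreover have "antider u (max 0 x) = antider u x" for x
    by (cases "0 \<le> x") (auto simp: max_def antider_nonpos)
  ultimately show ?thesis by simp
qed

lemma borel_measurable_antider [measurable]: "antider u \<in> borel_measurable borel"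
  using continuous_antider by (rule borel_measurable_continuous_onI)

lemma locint_continuous:
  assumes "continuous_on UNIV f" shows "locint f"
  unfolding locint_def
proof (intro conjI allI)
  show fm: "f \<in> borel_measurable half_lebesgue"
    by (intro borel_measurable_half borel_measurable_continuous_onI assms)
  fix b
  have "bounded (f ` {0..b})"
    by (intro compact_imp_bounded compact_continuous_image continuous_on_subset[OF assms]) auto
  then obtain C where C: "0 < C" "\<And>x. x \<in> {0..b} \<Longrightarrow> \<bar>f x\<bar> \<le> C" by (auto simp: bounded_pos)
  show "integrable half_lebesgue (\<lambda>x. indicator {..b} x * f x)"
  proof (rule integrable_half_exp_bound[where k = 1 and C = "C * exp b"])
    show "(\<lambda>x. indicator {..b} x * f x) \<in> borel_measurable half_lebesgue"
      by (intro borel_measurable_times fm borel_measurable_half) auto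
    fix x :: real assume "0 < x"
    show "\<bar>indicator {..b} x * f x\<bar> \<le> C * exp b * exp (- 1 * x)"
    proof (cases "x \<le> b")
      case True
      then have "C * 1 \<le> C * (exp b * exp (- x))"
        using C(1) by (intro mult_left_mono) (auto simp: exp_add[symmetric])
      then show ?thesis using C(2)[of x] True \<open>0 < x\<close> by (simp add: mult.assoc)
    qed (use C(1) in simp)
  qed simp
qed

text \<open>Exchanging the order of integration over \<open>0 < y \<le> x\<close> moves the
  integration from \<open>u\<close> to \<open>\<psi>\<close>. It is used for derivatives of test
  functions, where \<open>\<Psi>\<close> is minus the test function, and for exponentials, where it
  leads to the trace formula.\<close>

lemma antider_fubini:
  assumes psi [measurable]: "\<psi> \<in> borel_measurable borel" and k: "0 < k"
    and bound: "\<And>x. 0 < x \<Longrightarrow> \<bar>\<psi> x\<bar> \<le> C * exp (- k * x)"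
    and tail: "\<And>y. 0 < y \<Longrightarrow> (\<integral>x. indicator {y..} x * \<psi> x \<partial>half_lebesgue) = \<Psi> y"
    and Psi [measurable]: "\<Psi> \<in> borel_measurable borel"
  shows "(\<integral>x. antider u x * \<psi> x \<partial>half_lebesgue) = (\<integral>y. rep_l2 u y * \<Psi> y \<partial>half_lebesgue)"
proof -
  obtain g where g [measurable]: "g \<in> borel_measurable borel" and g0: "\<And>x. x \<le> 0 \<Longrightarrow> g x = 0"
    and ug: "AE x in half_lebesgue. rep_l2 u x = g x"
    using half_lebesgue_borel_version[OF rep_l2_measurable] by blast
  have gmh: "g \<in> borel_measurable half_lebesgue" by (rule borel_measurable_half[OF g])
  define K where "K y x = g y * (if y \<le> x \<and> 0 < x then \<psi> x else 0)" for y x :: real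
  have C0: "0 \<le> C" using bound[of 1] by (smt (verit) zero_less_mult_iff exp_gt_zero mult_neg_pos)
  have expint: "integrable lborel (\<lambda>x. indicator half_line x * exp (- k' * x))"
    "(\<integral>x. indicator half_line x * exp (- k' * x) \<partial>lborel) = 1 / k'" if "0 < k'" for k' :: real
  proof -
    have m: "(\<lambda>x. exp (- k' * x)) \<in> borel_measurable borel" by measurable
    show "integrable lborel (\<lambda>x. indicator half_line x * exp (- k' * x))"
      "(\<integral>x. indicator half_line x * exp (- k' * x) \<partial>lborel) = 1 / k'"
      using integral_exp_half_line[OF that] half_lebesgue_integral_borel[OF m]
      by (simp_all add: has_bochner_integral_iff)
  qed
  have Kint: "integrable lborel (\<lambda>x. K y x)" for y
  proof (rule Bochner_Integration.integrable_bound)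
    show "integrable lborel (\<lambda>x. \<bar>g y\<bar> * (C * (indicator half_line x * exp (- k * x))))"
      using expint(1)[OF k] by auto
    show "(\<lambda>x. K y x) \<in> borel_measurable lborel" unfolding K_def by measurable
    show "AE x in lborel. norm (K y x) \<le> norm (\<bar>g y\<bar> * (C * (indicator half_line x * exp (- k * x))))"
      using bound C0 by (intro AE_I2) (auto simp: K_def abs_mult intro!: mult_left_mono)
  qed
  have Kbound: "(\<integral>x. norm (K y x) \<partial>lborel) \<le> 2 * C / k * (\<bar>g y\<bar> * exp (- (k / 2) * y))" for y
  proof (cases "0 < y")
    case True
    have "(\<integral>x. norm (K y x) \<partial>lborel)
        \<le> (\<integral>x. \<bar>g y\<bar> * (C * exp (- (k / 2) * y)) * (indicator half_line x * exp (- (k / 2) * x)) \<partial>lborel)"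
    proof (rule integral_mono)
      show "integrable lborel (\<lambda>x. norm (K y x))" using Kint by simp
      show "integrable lborel (\<lambda>x. \<bar>g y\<bar> * (C * exp (- (k / 2) * y)) * (indicator half_line x * exp (- (k / 2) * x)))"
        using expint(1)[of "k / 2"] k by auto
      fix x
      show "norm (K y x) \<le> \<bar>g y\<bar> * (C * exp (- (k / 2) * y)) * (indicator half_line x * exp (- (k / 2) * x))"
      proof (cases "y \<le> x \<and> 0 < x")
        case True
        \<comment> \<open>Half of the decay in \<open>x\<close> is traded for decay in
          \<open>y\<close>. This leaves \<open>\<bar>g y\<bar> * exp (- (k / 2) * y)\<close>,
          integrable as a product of two L2 functions.\<close>
        have "exp (- k * x) \<le> exp (- (k / 2) * y) * exp (- (k / 2) * x)"
          using True k by (simp add: exp_add[symmetric] field_simps)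
        then have "\<bar>\<psi> x\<bar> \<le> C * (exp (- (k / 2) * y) * exp (- (k / 2) * x))"
          using bound[of x] True C0 by (auto intro: order_trans mult_left_mono)
        then show ?thesis
          using True by (auto simp: K_def abs_mult mult.assoc intro!: mult_left_mono)
      qed (use C0 in \<open>auto simp: K_def\<close>)
    qed
    also have "\<dots> = \<bar>g y\<bar> * (C * exp (- (k / 2) * y)) * (1 / (k / 2))"
      using expint(2)[of "k / 2"] k by simp
    finally show ?thesis by (simp add: mult_ac)
  qed (simp add: K_def g0)
  have gint: "integrable lborel (\<lambda>y. \<bar>g y\<bar> * exp (- (k / 2) * y))"
  proof -
    have "sqint half_line g"
      by (rule sqintI_bound[OF gmh sqint_rep_l2[of u]]) (use ug in auto)
    then have "sqint half_line (\<lambda>x. \<bar>g x\<bar>)" by (auto simp: sqint_def)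
    from sqint_mult_integrable[OF this sqint_exp[of "k / 2"]]
    have "integrable half_lebesgue (\<lambda>y. \<bar>g y\<bar> * exp (- (k / 2) * y))" using k by simp
    then have "integrable lborel (\<lambda>y. indicator half_line y * (\<bar>g y\<bar> * exp (- (k / 2) * y)))"
      by (subst (asm) half_lebesgue_integral_borel(2)) measurable
    moreover have "(\<lambda>y. indicator half_line y * (\<bar>g y\<bar> * exp (- (k / 2) * y))) = (\<lambda>y. \<bar>g y\<bar> * exp (- (k / 2) * y))"
      using g0 by (auto simp: indicator_def fun_eq_iff)
    ultimately show ?thesis by (simp only:)
  qed
  have Kpair: "integrable (lborel \<Otimes>\<^sub>M lborel) (case_prod K)"
  proof (rule lborel_pair.Fubini_integrable)
    show "case_prod K \<in> borel_measurable (lborel \<Otimes>\<^sub>M lborel)" unfolding K_def by measurable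
    show "AE y in lborel. integrable lborel (\<lambda>x. case (y, x) of (y, x) \<Rightarrow> K y x)" using Kint by simp
    show "integrable lborel (\<lambda>y. \<integral>x. norm (case (y, x) of (y, x) \<Rightarrow> K y x) \<partial>lborel)"
    proof (rule Bochner_Integration.integrable_bound)
      show "integrable lborel (\<lambda>y. 2 * C / k * (\<bar>g y\<bar> * exp (- (k / 2) * y)))" using gint by auto
      show "(\<lambda>y. \<integral>x. norm (case (y, x) of (y, x) \<Rightarrow> K y x) \<partial>lborel) \<in> borel_measurable lborel"
        unfolding K_def by measurable
      have "\<bar>\<integral>x. norm (K y x) \<partial>lborel\<bar> \<le> \<bar>2 * C / k * (\<bar>g y\<bar> * exp (- (k / 2) * y))\<bar>" for y
      proof -
        have "0 \<le> (\<integral>x. norm (K y x) \<partial>lborel)" by (rule Bochner_Integration.integral_nonneg) simp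
        then show ?thesis using Kbound[of y] by linarith
      qed
      then show "AE y in lborel. norm (\<integral>x. norm (case (y, x) of (y, x) \<Rightarrow> K y x) \<partial>lborel)
          \<le> norm (2 * C / k * (\<bar>g y\<bar> * exp (- (k / 2) * y)))" by simp
    qed
  qed
  have inner_y: "(\<integral>y. K y x \<partial>lborel) = indicator half_line x * (antider u x * \<psi> x)" for x
  proof (cases "0 < x")
    case True
    have "antider u x = (\<integral>y. g y * indicator {..x} y \<partial>half_lebesgue)"
      unfolding antider_eq
      by (intro integral_cong_AE borel_measurable_times rep_l2_measurable gmh borel_measurable_half) (use ug in auto)
    also have "\<dots> = (\<integral>y. indicator half_line y * (g y * indicator {..x} y) \<partial>lborel)"
      by (rule half_lebesgue_integral_borel) measurable
    also have "\<dots> = (\<integral>y. g y * indicator {..x} y \<partial>lborel)"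
      by (intro Bochner_Integration.integral_cong) (auto simp: indicator_def g0)
    finally have "antider u x * \<psi> x = (\<integral>y. g y * indicator {..x} y * \<psi> x \<partial>lborel)" by simp
    also have "\<dots> = (\<integral>y. K y x \<partial>lborel)"
      using True by (intro Bochner_Integration.integral_cong) (auto simp: K_def indicator_def)
    finally show ?thesis using True by simp
  qed (simp add: K_def)
  have inner_x: "(\<integral>x. K y x \<partial>lborel) = indicator half_line y * (g y * \<Psi> y)" for y
  proof (cases "0 < y")
    case True
    have "\<Psi> y = (\<integral>x. indicator {y..} x * \<psi> x \<partial>half_lebesgue)" using tail[OF True] by simp
    also have "\<dots> = (\<integral>x. indicator half_line x * (indicator {y..} x * \<psi> x) \<partial>lborel)"
      by (rule half_lebesgue_integral_borel) measurable
    finally have "g y * \<Psi> y = (\<integral>x. g y * (indicator half_line x * (indicator {y..} x * \<psi> x)) \<partial>lborel)" by simp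
    also have "\<dots> = (\<integral>x. K y x \<partial>lborel)"
      by (intro Bochner_Integration.integral_cong) (auto simp: K_def indicator_def)
    finally show ?thesis using True by simp
  qed (simp add: K_def g0)
  have "(\<integral>x. antider u x * \<psi> x \<partial>half_lebesgue) = (\<integral>x. (\<integral>y. K y x \<partial>lborel) \<partial>lborel)"
    unfolding inner_y by (rule half_lebesgue_integral_borel) measurable
  also have "\<dots> = (\<integral>y. (\<integral>x. K y x \<partial>lborel) \<partial>lborel)"
    using lborel_pair.Fubini_integral[OF Kpair] .
  also have "\<dots> = (\<integral>y. g y * \<Psi> y \<partial>half_lebesgue)"
    unfolding inner_x by (rule half_lebesgue_integral_borel[symmetric]) measurable
  also have "\<dots> = (\<integral>y. rep_l2 u y * \<Psi> y \<partial>half_lebesgue)"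
    by (intro integral_cong_AE borel_measurable_times rep_l2_measurable gmh borel_measurable_half Psi) (use ug in auto)
  finally show ?thesis .
qed

lemma weak_deriv_antider:
  assumes t: "test_fun half_line \<phi>"
  shows "(\<integral>x. antider u x * deriv \<phi> x \<partial>half_lebesgue) = - (\<integral>y. rep_l2 u y * \<phi> y \<partial>half_lebesgue)"
proof -
  obtain C where C: "\<And>x. \<bar>deriv \<phi> x\<bar> \<le> C * exp (- x)"
    using test_fun_exp_bound[OF test_fun_deriv[OF t]] by blast
  have "(\<integral>x. antider u x * deriv \<phi> x \<partial>half_lebesgue) = (\<integral>y. rep_l2 u y * (- \<phi> y) \<partial>half_lebesgue)"
    by (rule antider_fubini[where k = 1 and C = C])
      (use C t tail_integral_deriv_test_fun[OF t] test_fun_deriv[OF t] in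
        \<open>auto simp: test_fun_iff intro!: borel_measurable_continuous_onI smooth_continuous_on continuous_intros\<close>)
  then show ?thesis by simp
qed

section \<open>Uniqueness of weak derivatives and representation by antiderivatives\<close>

lemma weak_deriv_unique:
  assumes "weak_deriv half_line f (rep_l2 g)" "weak_deriv half_line f (rep_l2 h)"
  shows "g = h"
proof (rule l2_eqI)
  have "AE x in half_lebesgue. rep_l2 g x - rep_l2 h x = 0"
  proof (rule fundamental_lemma)
    show "locint (\<lambda>x. rep_l2 g x - rep_l2 h x)" by (intro locint_diff locint_sqint sqint_rep_l2)
    fix \<phi> assume t: "test_fun half_line \<phi>"
    have "(\<integral>x. rep_l2 g x * \<phi> x \<partial>half_lebesgue) = (\<integral>x. rep_l2 h x * \<phi> x \<partial>half_lebesgue)"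
      using assms t by (simp add: weak_deriv_def)
    then show "(\<integral>x. (rep_l2 g x - rep_l2 h x) * \<phi> x \<partial>half_lebesgue) = 0"
      using sqint_mult_integrable[OF sqint_rep_l2 sqint_test_fun[OF t]] by (simp add: left_diff_distrib)
  qed
  then show "AE x in half_lebesgue. rep_l2 g x = rep_l2 h x" by simp
qed

lemma dx_eqI: "weak_deriv half_line (rep_l2 u) (rep_l2 g) \<Longrightarrow> dx u = g"
  unfolding dx_def by (rule the_equality) (auto intro: weak_deriv_unique)

lemma weak_deriv_cong_AE:
  assumes "weak_deriv half_line f g" "AE x in half_lebesgue. f x = f' x" "AE x in half_lebesgue. g x = g' x"
    "f \<in> borel_measurable half_lebesgue" "f' \<in> borel_measurable half_lebesgue"
    "g \<in> borel_measurable half_lebesgue" "g' \<in> borel_measurable half_lebesgue"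
  shows "weak_deriv half_line f' g'"
  unfolding weak_deriv_def
proof (intro allI impI)
  fix \<phi> assume t: "test_fun half_line \<phi>"
  note m = test_fun_measurable[OF t] test_fun_measurable[OF test_fun_deriv[OF t]]
  have "(\<integral>x. f' x * deriv \<phi> x \<partial>half_lebesgue) = (\<integral>x. f x * deriv \<phi> x \<partial>half_lebesgue)"
    by (intro integral_cong_AE borel_measurable_times assms m) (use assms in auto)
  moreover have "(\<integral>x. g' x * \<phi> x \<partial>half_lebesgue) = (\<integral>x. g x * \<phi> x \<partial>half_lebesgue)"
    by (intro integral_cong_AE borel_measurable_times assms m) (use assms in auto)
  ultimately show "(\<integral>x. f' x * deriv \<phi> x \<partial>half_lebesgue) = - (\<integral>x. g' x * \<phi> x \<partial>half_lebesgue)"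
    using assms(1) t by (simp add: weak_deriv_def)
qed

lemma weak_deriv_abs_l2:
  assumes "sqint half_line g" "weak_deriv half_line (rep_l2 u) g"
  shows "weak_deriv half_line (rep_l2 u) (rep_l2 (abs_l2 g))"
  by (rule weak_deriv_cong_AE[OF assms(2)])
    (use assms AE_rep_abs_l2[OF assms(1)] in \<open>auto simp: sqint_def\<close>)

text \<open>The difference of \<open>u\<close> and \<open>antider g\<close> is annihilated by all
  derivatives of test functions. Any test function becomes such a derivative once a multiple of the
  fixed bump \<open>\<eta>0\<close> with the same integral is subtracted, so the difference acts
  like a constant.\<close>

lemma du_bois_reymond:
  assumes w: "weak_deriv half_line (rep_l2 u) (rep_l2 g)"
  obtains c where "AE x in half_lebesgue. rep_l2 u x = c + antider g x"
proof -
  define m where "m x = rep_l2 u x - antider g x" for x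
  have lm: "locint m" unfolding m_def
    by (intro locint_diff locint_sqint sqint_rep_l2 locint_continuous continuous_antider)
  have int: "integrable half_lebesgue (\<lambda>x. m x * \<phi> x)" if l: "locint m" and t: "test_fun half_line \<phi>" for \<phi> m
  proof -
    obtain C where C: "0 \<le> C" "\<And>x. \<bar>\<phi> x\<bar> \<le> C * exp (- x)" using test_fun_exp_bound[OF t] by blast
    obtain a b where ab: "0 < a" "a < b" "\<And>x. x \<notin> {a..b} \<Longrightarrow> \<phi> x = 0" using test_fun_bounded_support[OF t] by blast
    have "\<bar>\<phi> x\<bar> \<le> C" for x
    proof (cases "0 < x")
      case True then show ?thesis using C(2)[of x] mult_left_le[of "exp (- x)" C] C(1) by simp
    qed (use ab C(1) in auto)
    then show ?thesis by (intro locint_mult_integrable[OF l test_fun_measurable[OF t], of C b]) (use ab in auto)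
  qed
  have md: "(\<integral>x. m x * deriv \<phi> x \<partial>half_lebesgue) = 0" if t: "test_fun half_line \<phi>" for \<phi>
  proof -
    note t' = test_fun_deriv[OF t]
    have "(\<integral>x. m x * deriv \<phi> x \<partial>half_lebesgue)
      = (\<integral>x. rep_l2 u x * deriv \<phi> x \<partial>half_lebesgue) - (\<integral>x. antider g x * deriv \<phi> x \<partial>half_lebesgue)"
      unfolding m_def left_diff_distrib
      by (intro Bochner_Integration.integral_diff int t' locint_sqint sqint_rep_l2 locint_continuous continuous_antider)
    also have "\<dots> = 0" using w t by (simp add: weak_deriv_def weak_deriv_antider)
    finally show ?thesis .
  qed
  define \<eta>0 where "\<eta>0 = bump 1 2 0"
  have t0: "test_fun half_line \<eta>0" unfolding \<eta>0_def by (rule test_fun_bump) simp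
  define i0 where "i0 = (\<integral>x. \<eta>0 x \<partial>half_lebesgue)"
  have "i0 \<noteq> 0"
  proof
    assume "i0 = 0"
    then have "AE x in half_lebesgue. \<eta>0 x = 0"
      unfolding i0_def
      by (subst (asm) integral_nonneg_eq_0_iff_AE)
        (auto simp: \<eta>0_def bump_bounds intro!: integrable_test_fun test_fun_bump)
    then have "AE x in half_lebesgue. x \<notin> {1<..<2}"
      by eventually_elim (use bump_pos[of 1 _ 2 0] in \<open>force simp: \<eta>0_def\<close>)
    then show False by (rule not_AE_half_interval[rotated 2]) auto
  qed
  define c where "c = (\<integral>x. m x * \<eta>0 x \<partial>half_lebesgue) / i0"
  have "AE x in half_lebesgue. m x - c = 0"
  proof (rule fundamental_lemma)
    show "locint (\<lambda>x. m x - c)" by (intro locint_diff lm locint_continuous continuous_intros)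
    fix \<psi> assume t: "test_fun half_line \<psi>"
    define r where "r = (\<integral>x. \<psi> x \<partial>half_lebesgue) / i0"
    have t1: "test_fun half_line (\<lambda>x. \<psi> x - r * \<eta>0 x)" by (rule test_fun_lincomb[OF t t0])
    have "(\<integral>x. \<psi> x - r * \<eta>0 x \<partial>half_lebesgue) = 0"
      using integrable_test_fun[OF t] integrable_test_fun[OF t0] \<open>i0 \<noteq> 0\<close>
      by (simp add: r_def i0_def[symmetric])
    then obtain \<phi> where "test_fun half_line \<phi>" "deriv \<phi> = (\<lambda>x. \<psi> x - r * \<eta>0 x)"
      using test_fun_primitive[OF t1] by blast
    then have "(\<integral>x. m x * (\<psi> x - r * \<eta>0 x) \<partial>half_lebesgue) = 0" using md[of \<phi>] by simp
    moreover have "(\<integral>x. m x * (\<psi> x - r * \<eta>0 x) \<partial>half_lebesgue)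
      = (\<integral>x. m x * \<psi> x \<partial>half_lebesgue) - r * (\<integral>x. m x * \<eta>0 x \<partial>half_lebesgue)"
    proof -
      have "(\<integral>x. m x * (\<psi> x - r * \<eta>0 x) \<partial>half_lebesgue) = (\<integral>x. m x * \<psi> x - r * (m x * \<eta>0 x) \<partial>half_lebesgue)"
        by (simp add: algebra_simps)
      also have "\<dots> = (\<integral>x. m x * \<psi> x \<partial>half_lebesgue) - r * (\<integral>x. m x * \<eta>0 x \<partial>half_lebesgue)"
        using int[OF lm t] int[OF lm t0] by simp
      finally show ?thesis .
    qed
    moreover have "(\<integral>x. (m x - c) * \<psi> x \<partial>half_lebesgue) = (\<integral>x. m x * \<psi> x \<partial>half_lebesgue) - c * (\<integral>x. \<psi> x \<partial>half_lebesgue)"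
      using int[OF lm t] integrable_test_fun[OF t] by (simp add: left_diff_distrib)
    ultimately show "(\<integral>x. (m x - c) * \<psi> x \<partial>half_lebesgue) = 0"
      using \<open>i0 \<noteq> 0\<close> by (simp add: c_def r_def field_simps)
  qed
  then have "AE x in half_lebesgue. rep_l2 u x = c + antider g x"
    by eventually_elim (simp add: m_def)
  then show ?thesis by (rule that)
qed

section \<open>Boundary values at the node\<close>

lemma continuous_AE_eq_at_0:
  assumes "continuous_on {0..} f" "continuous_on {0..} g" "AE x in half_lebesgue. f x = (g x :: real)"
  shows "f 0 = g 0"
proof (rule ccontr)
  assume ne: "f 0 \<noteq> g 0"
  have "continuous_on {0..} (\<lambda>x. f x - g x)" by (intro continuous_intros assms)
  then obtain d where d: "0 < d" "\<And>x. x \<in> {0..} \<Longrightarrow> dist x 0 < d \<Longrightarrow> dist (f x - g x) (f 0 - g 0) < \<bar>f 0 - g 0\<bar>"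
    using ne unfolding continuous_on_iff by (metis atLeast_iff order_refl right_minus_eq zero_less_abs_iff)
  have "f x \<noteq> g x" if "x \<in> {0<..<d}" for x
    using d(2)[of x] that by (auto simp: dist_real_def)
  then have "AE x in half_lebesgue. x \<notin> {0<..<d}" using assms(3) by (auto elim: eventually_mono)
  then show False by (rule not_AE_half_interval[rotated 2]) (use d(1) in auto)
qed

text \<open>The description in \<open>trace0\<close> is met by at most one number, because
  continuous representatives that agree almost everywhere agree at 0; the antiderivative supplies
  such a representative.\<close>

lemma trace0_eqI:
  assumes "AE x in half_lebesgue. rep_l2 u x = c + antider g x"
  shows "trace0 u = c"
  unfolding trace0_def
proof (rule the_equality)
  have cont: "continuous_on {0..} (\<lambda>x. c + antider g x)"
    by (intro continuous_intros continuous_on_subset[OF continuous_antider]) auto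
  then show "\<exists>f. continuous_on {0..} f \<and> (AE x in half_lebesgue. f x = rep_l2 u x) \<and> f 0 = c"
    using assms by (intro exI[of _ "\<lambda>x. c + antider g x"]) (auto simp: antider_nonpos)
  fix r assume "\<exists>f. continuous_on {0..} f \<and> (AE x in half_lebesgue. f x = rep_l2 u x) \<and> f 0 = r"
  then obtain f where f: "continuous_on {0..} f" "AE x in half_lebesgue. f x = rep_l2 u x" "f 0 = r" by blast
  have "AE x in half_lebesgue. f x = c + antider g x" using f(2) assms by eventually_elim simp
  from continuous_AE_eq_at_0[OF f(1) cont this] show "r = c" using f(3) by (simp add: antider_nonpos)
qed

definition exp_l2 :: "real \<Rightarrow> l2" where
  "exp_l2 k = abs_l2 (\<lambda>x. exp (- k * x))"

text \<open>Integration by parts against \<open>exp (- k x)\<close>; it shows that the trace is continuous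
  with respect to \<open>u\<close> and its derivative.\<close>

lemma weak_deriv_repr:
  assumes w: "weak_deriv half_line (rep_l2 u) (rep_l2 g)"
  shows "AE x in half_lebesgue. rep_l2 u x = trace0 u + antider g x"
    and "0 < k \<Longrightarrow> trace0 u = k * inner u (exp_l2 k) - inner g (exp_l2 k)"
proof -
  obtain c where c: "AE x in half_lebesgue. rep_l2 u x = c + antider g x" using du_bois_reymond[OF w] .
  then have tr: "trace0 u = c" by (rule trace0_eqI)
  show AE: "AE x in half_lebesgue. rep_l2 u x = trace0 u + antider g x" using c tr by simp
  assume k: "0 < k"
  have me: "(\<lambda>x. exp (- k * x)) \<in> borel_measurable half_lebesgue" by (rule borel_measurable_half) measurable
  have i1: "integrable half_lebesgue (\<lambda>x. rep_l2 u x * (k * exp (- k * x)))"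
    by (intro sqint_mult_integrable sqint_rep_l2 sqint_scale sqint_exp k)
  have i2: "integrable half_lebesgue (\<lambda>x. c * (k * exp (- k * x)))"
    using integral_exp_half_line[OF k] by (simp add: has_bochner_integral_iff)
  have ma: "antider g \<in> borel_measurable half_lebesgue" by (rule borel_measurable_half) measurable
  have "(\<integral>x. antider g x * (k * exp (- k * x)) \<partial>half_lebesgue) = (\<integral>y. rep_l2 g y * exp (- k * y) \<partial>half_lebesgue)"
    by (rule antider_fubini[OF _ k, where C = k]) (use k in \<open>auto simp: tail_integral_exp[OF k, simplified]\<close>)
  moreover have "(\<integral>x. antider g x * (k * exp (- k * x)) \<partial>half_lebesgue)
    = (\<integral>x. rep_l2 u x * (k * exp (- k * x)) - c * (k * exp (- k * x)) \<partial>half_lebesgue)"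
  proof (rule integral_cong_AE)
    show "AE x in half_lebesgue. antider g x * (k * exp (- k * x))
        = rep_l2 u x * (k * exp (- k * x)) - c * (k * exp (- k * x))"
      using c by eventually_elim (simp add: algebra_simps)
  qed (use ma me in auto)
  moreover have "\<dots> = (\<integral>x. rep_l2 u x * (k * exp (- k * x)) \<partial>half_lebesgue) - (\<integral>x. c * (k * exp (- k * x)) \<partial>half_lebesgue)"
    by (rule Bochner_Integration.integral_diff[OF i1 i2])
  moreover have "(\<integral>x. rep_l2 u x * (k * exp (- k * x)) \<partial>half_lebesgue) = k * inner u (exp_l2 k)"
    unfolding exp_l2_def inner_abs_l2_right[OF sqint_exp[OF k]] by (simp add: mult.left_commute)
  moreover have "(\<integral>x. c * (k * exp (- k * x)) \<partial>half_lebesgue) = c"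
    using integral_exp_half_line[OF k] k by (simp add: has_bochner_integral_iff)
  moreover have "inner g (exp_l2 k) = (\<integral>y. rep_l2 g y * exp (- k * y) \<partial>half_lebesgue)"
    unfolding exp_l2_def inner_abs_l2_right[OF sqint_exp[OF k]] ..
  ultimately show "trace0 u = k * inner u (exp_l2 k) - inner g (exp_l2 k)" using tr by linarith
qed

section \<open>The operator of the Klein-Gordon star\<close>

definition wderiv :: "l2 \<Rightarrow> l2 \<Rightarrow> bool" where
  "wderiv u g \<longleftrightarrow> weak_deriv half_line (rep_l2 u) (rep_l2 g)"

text \<open>In this form the condition on \<open>(u, g)\<close> is a family of continuous linear
  equations, so linearity is immediate and the graph of \<open>dx\<close> is closed;
  \<open>variational_solution\<close> relies on the latter.\<close>

lemma wderiv_iff: "wderiv u g \<longleftrightarrow>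
  (\<forall>\<phi>. test_fun half_line \<phi> \<longrightarrow> inner u (abs_l2 (deriv \<phi>)) + inner g (abs_l2 \<phi>) = 0)"
  by (auto simp: wderiv_def weak_deriv_def inner_abs_l2_right sqint_test_fun test_fun_deriv eq_neg_iff_add_eq_0)

lemma wderiv_add: "wderiv u g \<Longrightarrow> wderiv v h \<Longrightarrow> wderiv (u + v) (g + h)"
  unfolding wderiv_iff by (simp add: inner_add_left) (metis add.assoc add.left_commute add.right_neutral)

lemma wderiv_scaleR: "wderiv u g \<Longrightarrow> wderiv (r *\<^sub>R u) (r *\<^sub>R g)"
  unfolding wderiv_iff by (simp add: distrib_left[symmetric])

lemma H1_iff: "u \<in> H1 \<longleftrightarrow> (\<exists>g. wderiv u g)"
  unfolding H1_def sobolev1_def wderiv_def using weak_deriv_abs_l2 sqint_rep_l2 by blast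

lemma dx_eq: "wderiv u g \<Longrightarrow> dx u = g"
  unfolding wderiv_def by (rule dx_eqI)

lemma H1_I: "wderiv u g \<Longrightarrow> u \<in> H1" unfolding H1_iff by blast

lemma wderiv_dx: "u \<in> H1 \<Longrightarrow> wderiv u (dx u)"
  using H1_iff dx_eq by auto

lemma trace0_H1: "u \<in> H1 \<Longrightarrow> 0 < k \<Longrightarrow> trace0 u = k * inner u (exp_l2 k) - inner (dx u) (exp_l2 k)"
  using weak_deriv_repr(2) wderiv_dx unfolding wderiv_def by blast

lemma H1_add: "u \<in> H1 \<Longrightarrow> v \<in> H1 \<Longrightarrow> u + v \<in> H1" and dx_add: "u \<in> H1 \<Longrightarrow> v \<in> H1 \<Longrightarrow> dx (u + v) = dx u + dx v"
  using wderiv_add[OF wderiv_dx wderiv_dx] by (auto intro: H1_I dx_eq)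

lemma H1_scaleR: "u \<in> H1 \<Longrightarrow> r *\<^sub>R u \<in> H1" and dx_scaleR: "u \<in> H1 \<Longrightarrow> dx (r *\<^sub>R u) = r *\<^sub>R dx u"
  using wderiv_scaleR[OF wderiv_dx] by (auto intro: H1_I dx_eq)

lemma trace0_add: "u \<in> H1 \<Longrightarrow> v \<in> H1 \<Longrightarrow> trace0 (u + v) = trace0 u + trace0 v"
  using trace0_H1[of _ 1] by (simp add: H1_add dx_add inner_add_left)

lemma trace0_scaleR: "u \<in> H1 \<Longrightarrow> trace0 (r *\<^sub>R u) = r * trace0 u"
  using trace0_H1[of u 1] trace0_H1[of "r *\<^sub>R u" 1] by (simp add: H1_scaleR dx_scaleR right_diff_distrib)

lemma H1_zero: "0 \<in> H1" and dx_zero: "dx 0 = 0"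
proof -
  have "wderiv 0 0" by (simp add: wderiv_iff)
  then show "0 \<in> H1" "dx 0 = 0" by (auto intro: H1_I dx_eq)
qed

lemma trace0_zero: "trace0 0 = 0"
  using trace0_scaleR[OF H1_zero, of 0] by simp

lemma sobolev1_rep_abs_l2:
  assumes "sobolev1 half_line g"
  shows "abs_l2 g \<in> H1"
proof -
  obtain h where h: "sqint half_line g" "sqint half_line h" "weak_deriv half_line g h"
    using assms by (auto simp: sobolev1_def)
  have "AE x in half_lebesgue. g x = rep_l2 (abs_l2 g) x"
    using AE_rep_abs_l2[OF h(1)] by eventually_elim simp
  then have "weak_deriv half_line (rep_l2 (abs_l2 g)) h"
    by (intro weak_deriv_cong_AE[OF h(3)]) (use h in \<open>auto simp: sqint_def\<close>)
  from weak_deriv_abs_l2[OF h(2) this] show ?thesis unfolding H1_iff wderiv_def by blast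
qed

lemma H2_iff: "u \<in> H2 \<longleftrightarrow> u \<in> H1 \<and> dx u \<in> H1"
proof
  assume "u \<in> H2"
  then obtain g where g: "sobolev1 half_line g" "weak_deriv half_line (rep_l2 u) g"
    by (auto simp: H2_def sobolev2_def)
  then have "wderiv u (abs_l2 g)"
    unfolding wderiv_def by (intro weak_deriv_abs_l2) (auto simp: sobolev1_def)
  then show "u \<in> H1 \<and> dx u \<in> H1" using sobolev1_rep_abs_l2[OF g(1)] dx_eq H1_I by auto
next
  assume "u \<in> H1 \<and> dx u \<in> H1"
  then show "u \<in> H2" using wderiv_dx[of u] by (auto simp: H2_def sobolev2_def wderiv_def H1_def)
qed

section \<open>Test functions and exponentials in \<open>H1\<close>, and first-order
  equations\<close>

lemma integral_deriv_test_fun: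
  assumes t: "test_fun half_line \<phi>" shows "(\<integral>x. deriv \<phi> x \<partial>half_lebesgue) = 0"
proof -
  obtain a b where ab: "0 < a" "a < b" "\<And>x. x \<notin> {a..b} \<Longrightarrow> \<phi> x = 0"
    using test_fun_bounded_support[OF t] by blast
  have z: "deriv \<phi> x = 0" if "x \<notin> {a..b}" for x by (rule deriv_zero_outside[OF ab(3) that])
  have "indicator {a / 2..} x * deriv \<phi> x = deriv \<phi> x" for x
    using z[of x] ab(1) by (cases "a \<le> x") (auto simp: indicator_def)
  then have "(\<lambda>x. indicator {a / 2..} x * deriv \<phi> x) = deriv \<phi>" by (rule ext)
  moreover have "\<phi> (a / 2) = 0" using ab by simp
  ultimately show ?thesis using tail_integral_deriv_test_fun[OF t, of "a / 2"] ab(1) by simp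
qed

lemma test_fun_mult:
  assumes "smooth f" "test_fun half_line \<phi>" shows "test_fun half_line (\<lambda>x. f x * \<phi> x)"
  using assms smooth_mult unfolding test_fun_iff by (metis mult_zero_right)

lemma integration_by_parts_smooth:
  assumes f: "smooth f" and sq: "sqint half_line f" "sqint half_line (deriv f)"
  shows "wderiv (abs_l2 f) (abs_l2 (deriv f))"
  unfolding wderiv_iff
proof (intro allI impI)
  fix \<phi> assume t: "test_fun half_line \<phi>"
  note t' = test_fun_deriv[OF t]
  have "deriv (\<lambda>x. f x * \<phi> x) = (\<lambda>x. f x * deriv \<phi> x + deriv f x * \<phi> x)"
    using t f by (intro ext DERIV_imp_deriv)
      (auto intro!: derivative_eq_intros smooth_DERIV simp: test_fun_iff)
  then have "(\<integral>x. f x * deriv \<phi> x + deriv f x * \<phi> x \<partial>half_lebesgue) = 0"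
    using integral_deriv_test_fun[OF test_fun_mult[OF f t]] by simp
  moreover have "inner (abs_l2 g) (abs_l2 h) = (\<integral>x. g x * h x \<partial>half_lebesgue)"
    if "sqint half_line g" "sqint half_line h" for g h
    using that inner_l2.abs_eq by (simp add: l2_rel_def)
  ultimately show "inner (abs_l2 f) (abs_l2 (deriv \<phi>)) + inner (abs_l2 (deriv f)) (abs_l2 \<phi>) = 0"
    using sq sqint_test_fun[OF t] sqint_test_fun[OF t'] by (simp add: sqint_mult_integrable)
qed

lemma smooth_exp: "smooth (\<lambda>x. exp (- k * x))"
proof (rule smoothI_closed)
  define F where "F = range (\<lambda>c x. c * exp (- k * x) :: real)"
  show "(\<lambda>x. exp (- k * x)) \<in> F" unfolding F_def by (rule range_eqI[of _ _ 1]) simp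
  fix g assume "g \<in> F"
  then obtain c where g: "g = (\<lambda>x. c * exp (- k * x))" by (auto simp: F_def)
  have d: "(g has_real_derivative (- k * c) * exp (- k * x)) (at x)" for x
    unfolding g by (rule derivative_eq_intros refl)+ simp
  show "g differentiable (at x)" for x using d by (auto simp: real_differentiable_def)
  have "deriv g = (\<lambda>x. (- k * c) * exp (- k * x))" using d by (auto intro: DERIV_imp_deriv)
  then show "deriv g \<in> F" unfolding F_def by (rule range_eqI)
qed

lemma wderiv_exp_l2: "0 < k \<Longrightarrow> wderiv (exp_l2 k) ((- k) *\<^sub>R exp_l2 k)"
proof -
  assume k: "0 < k"
  have d: "deriv (\<lambda>x. exp (- k * x)) = (\<lambda>x. (- k) * exp (- k * x))"
    by (intro ext DERIV_imp_deriv) (auto intro!: derivative_eq_intros)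
  have "wderiv (abs_l2 (\<lambda>x. exp (- k * x))) (abs_l2 (deriv (\<lambda>x. exp (- k * x))))"
  proof (rule integration_by_parts_smooth[OF smooth_exp])
    show "sqint half_line (\<lambda>x. exp (- k * x))" by (rule sqint_exp[OF k])
    show "sqint half_line (deriv (\<lambda>x. exp (- k * x)))" unfolding d by (intro sqint_scale sqint_exp k)
  qed
  then show ?thesis unfolding d abs_l2_scaleR[OF sqint_exp[OF k]] exp_l2_def .
qed

lemma wderiv_test_fun:
  assumes "test_fun half_line \<phi>" shows "wderiv (abs_l2 \<phi>) (abs_l2 (deriv \<phi>))"
proof (rule integration_by_parts_smooth)
  show "smooth \<phi>" using assms by (simp add: test_fun_iff)
qed (intro sqint_test_fun test_fun_deriv assms)+

text \<open>For a test function, the trace formula with \<open>k = 1\<close> is the weak derivative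
  equation of \<open>exp_l2 1\<close> tested with that function.\<close>

lemma trace0_test_fun:
  assumes t: "test_fun half_line \<phi>" shows "trace0 (abs_l2 \<phi>) = 0"
proof -
  have "inner (exp_l2 1) (abs_l2 (deriv \<phi>)) + inner ((- 1) *\<^sub>R exp_l2 1) (abs_l2 \<phi>) = 0"
    using wderiv_exp_l2[of 1] t by (simp add: wderiv_iff)
  then show ?thesis
    using trace0_H1[OF H1_I[OF wderiv_test_fun[OF t]], of 1] dx_eq[OF wderiv_test_fun[OF t]]
    by (simp add: inner_commute)
qed

text \<open>Zero trace makes \<open>antider u\<close> a solution of \<open>G' = r * G\<close> with
  \<open>G 0 = 0\<close>, which vanishes by Gronwall for either sign of \<open>r\<close>.\<close>

lemma H1_ode_zero:
  assumes u: "u \<in> H1" and ode: "dx u = r *\<^sub>R u" and tr: "trace0 u = 0"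
  shows "u = 0"
proof -
  have "AE x in half_lebesgue. rep_l2 u x = antider (r *\<^sub>R u) x"
    using weak_deriv_repr(1)[of u "dx u"] wderiv_dx[OF u] tr by (simp add: wderiv_def ode)
  moreover have "antider (r *\<^sub>R u) x = r * antider u x" for x by (simp add: antider_def)
  ultimately have AE: "AE x in half_lebesgue. rep_l2 u x = r * antider u x" by simp
  have cG: "continuous_on X (\<lambda>y. r * antider u y)" for X
    by (intro continuous_intros continuous_on_subset[OF continuous_antider]) auto
  have rm: "(\<lambda>y. r * antider u y) \<in> borel_measurable half_lebesgue" by (rule borel_measurable_half) measurable
  have G: "antider u x = integral {0..x} (\<lambda>y. r * antider u y)" if "0 \<le> x" for x
  proof -
    have "antider u x = (\<integral>y. (r * antider u y) * indicator {..x} y \<partial>half_lebesgue)"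
      unfolding antider_eq[of u x]
      by (intro integral_cong_AE borel_measurable_times rep_l2_measurable rm borel_measurable_half) (use AE in auto)
    also have "\<dots> = (\<integral>y. indicator half_line y *\<^sub>R ((r * antider u y) * indicator {..x} y) \<partial>lebesgue)"
      by (subst integral_restrict_space) auto
    also have "\<dots> = (\<integral>y. indicator {0<..x} y *\<^sub>R (r * antider u y) \<partial>lebesgue)"
      by (intro Bochner_Integration.integral_cong) (auto simp: indicator_def)
    also have "\<dots> = integral {0<..x} (\<lambda>y. r * antider u y)"
    proof -
      have "set_integrable lebesgue {0..x} (\<lambda>y. r * antider u y)"
        by (rule absolutely_integrable_continuous_real[OF cG])
      then have "set_integrable lebesgue {0<..x} (\<lambda>y. r * antider u y)"
        by (rule set_integrable_subset) auto
      from set_lebesgue_integral_eq_integral(2)[OF this] show ?thesis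
        unfolding set_lebesgue_integral_def .
    qed
    also have "\<dots> = integral {0..x} (\<lambda>y. r * antider u y)"
      by (rule integral_spike_set) (auto intro: negligible_subset[of "{0}"])
    finally show ?thesis .
  qed
  have G0: "antider u t = 0" if t: "0 \<le> t" for t
  proof -
    have "norm (antider u t) \<le> exp (\<bar>r\<bar> * t) * norm (antider u 0)"
    proof (rule gronwall_norm_linear[OF t])
      fix s assume s: "s \<in> {0..t}"
      show "(antider u has_vector_derivative r * antider u s) (at s within {0..t})"
        by (rule has_vector_derivative_transform[OF s _ integral_has_vector_derivative[OF cG s]])
          (use G in auto)
      show "inner (r * antider u s) (antider u s) \<le> \<bar>r\<bar> * (norm (antider u s))\<^sup>2"
        by (simp add: power2_eq_square mult.assoc[symmetric] mult_right_mono)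
          (metis abs_ge_self mult.assoc mult_right_mono zero_le_square)
    qed simp
    then show ?thesis by (simp add: antider_nonpos)
  qed
  have "AE x in half_lebesgue. rep_l2 u x = rep_l2 0 x"
    using AE AE_rep_l2_zero AE_space[of half_lebesgue]
    by eventually_elim (auto simp: space_restrict_space G0)
  then show ?thesis by (rule l2_eqI)
qed

text \<open>The factor \<open>w = v' + k v\<close> of \<open>v'' = k\<^sup>2 v\<close> satisfies \<open>w' = k w\<close>; the trace formula
  with the matching exponential shows \<open>w(0) = 0\<close>, so that the growing solution is excluded.\<close>

lemma H2_decaying:
  assumes v: "v \<in> H2" and k: "0 < k" and ode: "dx (dx v) = k\<^sup>2 *\<^sub>R v"
  shows "dx v = (- k) *\<^sub>R v"
proof -
  have v1: "v \<in> H1" "dx v \<in> H1" using v by (auto simp: H2_iff)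
  define w where "w = dx v + k *\<^sub>R v"
  have w1: "w \<in> H1" unfolding w_def by (intro H1_add H1_scaleR v1)
  have dw: "dx w = k *\<^sub>R w"
    unfolding w_def by (simp add: dx_add dx_scaleR H1_scaleR v1 ode power2_eq_square algebra_simps)
  have "trace0 w = 0" using trace0_H1[OF w1 k] by (simp add: dw)
  then have "w = 0" using H1_ode_zero[OF w1 dw] by simp
  then show ?thesis by (simp add: w_def add_eq_0_iff)
qed

section \<open>The quadratic form and the inverse of \<open>opA\<close>\<close>

text \<open>Only continuity at the node is imposed. The condition on the derivatives in
  \<open>domA\<close> reappears as the natural boundary condition of the form.\<close>

definition form_dom :: "H set" where
  "form_dom = {v. fst v \<in> H1 \<and> snd v \<in> H1 \<and> trace0 (fst v) = trace0 (snd v)}"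

definition form :: "real \<Rightarrow> real \<Rightarrow> real \<Rightarrow> H \<Rightarrow> H \<Rightarrow> real" where
  "form c a1 a2 v w = c\<^sup>2 * inner (grad v) (grad w) + a1 * inner (fst v) (fst w) + a2 * inner (snd v) (snd w)"

lemma form_commute: "form c a1 a2 v w = form c a1 a2 w v"
  by (simp add: form_def inner_commute)

lemma domA_iff: "v \<in> domA \<longleftrightarrow> fst v \<in> H1 \<and> dx (fst v) \<in> H1 \<and> snd v \<in> H1 \<and> dx (snd v) \<in> H1 \<and>
    trace0 (fst v) = trace0 (snd v) \<and> trace0 (dx (fst v)) + trace0 (dx (snd v)) = 0"
  by (cases v) (auto simp: domA_def H2_iff)

lemma domA_form_dom: "v \<in> domA \<Longrightarrow> v \<in> form_dom"
  by (simp add: domA_iff form_dom_def)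

lemma opA_eq: "opA c a1 a2 v = (a1 *\<^sub>R fst v - c\<^sup>2 *\<^sub>R dx (dx (fst v)), a2 *\<^sub>R snd v - c\<^sup>2 *\<^sub>R dx (dx (snd v)))"
  by (simp add: opA_def split_beta)

lemma domA_add: "v \<in> domA \<Longrightarrow> w \<in> domA \<Longrightarrow> v + w \<in> domA"
  by (simp add: domA_iff H1_add dx_add trace0_add)

lemma opA_add: "v \<in> domA \<Longrightarrow> w \<in> domA \<Longrightarrow> opA c a1 a2 (v + w) = opA c a1 a2 v + opA c a1 a2 w"
  by (simp add: domA_iff opA_eq H1_add dx_add algebra_simps)

lemma domA_scaleR: "v \<in> domA \<Longrightarrow> r *\<^sub>R v \<in> domA"
  by (simp add: domA_iff H1_scaleR dx_scaleR trace0_scaleR distrib_left[symmetric])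

lemma opA_scaleR: "v \<in> domA \<Longrightarrow> opA c a1 a2 (r *\<^sub>R v) = r *\<^sub>R opA c a1 a2 v"
  by (simp add: domA_iff opA_eq H1_scaleR dx_scaleR algebra_simps)

lemma domA_diff: "v \<in> domA \<Longrightarrow> w \<in> domA \<Longrightarrow> v - w \<in> domA"
  using domA_add[of v "(-1) *\<^sub>R w"] domA_scaleR[of w "-1"] by simp

lemma opA_diff: "v \<in> domA \<Longrightarrow> w \<in> domA \<Longrightarrow> opA c a1 a2 (v - w) = opA c a1 a2 v - opA c a1 a2 w"
  using opA_add[of v "(-1) *\<^sub>R w" c a1 a2] domA_scaleR[of w "-1"] opA_scaleR[of w c a1 a2 "-1"] by simp

text \<open>On each branch a solution of the homogeneous equation decays like
  \<open>exp (- sqrt a * x / c)\<close>, so both derivative traces are negative multiples of the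
  common value at the node. Their sum vanishes only if that value is 0, and then both branches
  vanish.\<close>

lemma opA_injective:
  assumes "0 < c" "0 < a1" "0 < a2" and v: "v \<in> domA" and "opA c a1 a2 v = 0"
  shows "v = 0"
proof -
  have dec: "dx w = (- sqrt a / c) *\<^sub>R w" if "w \<in> H1" "dx w \<in> H1" "a *\<^sub>R w - c\<^sup>2 *\<^sub>R dx (dx w) = 0" "0 < a" for w a
  proof -
    have "c\<^sup>2 *\<^sub>R dx (dx w) = a *\<^sub>R w" using that by simp
    then have "(1 / c\<^sup>2) *\<^sub>R (c\<^sup>2 *\<^sub>R dx (dx w)) = (1 / c\<^sup>2) *\<^sub>R (a *\<^sub>R w)" by simp
    then have "dx (dx w) = (sqrt a / c)\<^sup>2 *\<^sub>R w"
      using \<open>0 < c\<close> that(4) by (simp add: power_divide)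
    then show ?thesis
      using H2_decaying[of w "sqrt a / c"] that \<open>0 < c\<close> by (simp add: H2_iff)
  qed
  have z: "a1 *\<^sub>R fst v - c\<^sup>2 *\<^sub>R dx (dx (fst v)) = 0" "a2 *\<^sub>R snd v - c\<^sup>2 *\<^sub>R dx (dx (snd v)) = 0"
    using assms(5) by (simp_all add: opA_eq zero_prod_def)
  have d1: "dx (fst v) = (- sqrt a1 / c) *\<^sub>R fst v" using dec[OF _ _ z(1)] v assms by (simp add: domA_iff)
  have d2: "dx (snd v) = (- sqrt a2 / c) *\<^sub>R snd v" using dec[OF _ _ z(2)] v assms by (simp add: domA_iff)
  have t: "trace0 (dx (fst v)) = (- sqrt a1 / c) * trace0 (fst v)" "trace0 (dx (snd v)) = (- sqrt a2 / c) * trace0 (snd v)"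
    using arg_cong[OF d1, of trace0] trace0_scaleR[of "fst v" "- sqrt a1 / c"]
      arg_cong[OF d2, of trace0] trace0_scaleR[of "snd v" "- sqrt a2 / c"] v
    by (simp_all only: domA_iff)
  have "(- sqrt a1 / c) * trace0 (fst v) + (- sqrt a2 / c) * trace0 (fst v) = 0"
    using v[unfolded domA_iff] t by metis
  then have "(sqrt a1 / c + sqrt a2 / c) * trace0 (fst v) = 0" by (simp add: algebra_simps)
  moreover have "0 < sqrt a1 / c + sqrt a2 / c" using assms by (intro add_pos_pos) auto
  ultimately have "trace0 (fst v) = 0" by simp
  then have "fst v = 0" "snd v = 0"
    using H1_ode_zero[OF _ d1] H1_ode_zero[OF _ d2] v by (auto simp: domA_iff)
  then show ?thesis by (simp add: prod_eq_iff)
qed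

text \<open>\<open>E\<close> carries weights that turn the form into the inner product of
  \<open>H \<times> H\<close>, so the projection \<open>p = E v\<close> of \<open>z0\<close>
  satisfies \<open>form c a1 a2 v w = inner p (E w) = inner z0 (E w) = inner h w\<close>.\<close>

lemma variational_solution:
  assumes c: "0 < c" "0 < a1" "0 < a2"
  obtains v where "v \<in> form_dom" "\<And>w. w \<in> form_dom \<Longrightarrow> form c a1 a2 v w = inner h w"
proof -
  define e where "e = exp_l2 1"
  \<comment> \<open>After removal of the weights, the first two families say that the second pair
    consists of the weak derivatives of the first, and the last equation is equality of the traces
    by the trace formula with \<open>k = 1\<close>. Continuity of these equations makes
    \<open>W\<close> closed.\<close>
  define W :: "(H \<times> H) set" where "W = {z.
    (\<forall>\<phi>. test_fun half_line \<phi> \<longrightarrow>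
      inner ((1 / sqrt a1) *\<^sub>R fst (fst z)) (abs_l2 (deriv \<phi>)) + inner ((1 / c) *\<^sub>R fst (snd z)) (abs_l2 \<phi>) = 0) \<and>
    (\<forall>\<phi>. test_fun half_line \<phi> \<longrightarrow>
      inner ((1 / sqrt a2) *\<^sub>R snd (fst z)) (abs_l2 (deriv \<phi>)) + inner ((1 / c) *\<^sub>R snd (snd z)) (abs_l2 \<phi>) = 0) \<and>
    inner ((1 / sqrt a1) *\<^sub>R fst (fst z) - (1 / sqrt a2) *\<^sub>R snd (fst z)) e
      - inner ((1 / c) *\<^sub>R fst (snd z) - (1 / c) *\<^sub>R snd (snd z)) e = 0}"
  have closedW: "closed W"
    unfolding W_def
    by (intro closed_Collect_conj closed_Collect_all closed_Collect_imp open_Collect_const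
        closed_Collect_eq continuous_intros)
  have subW: "subspace W"
  proof (rule subspaceI)
    show "0 \<in> W" by (simp add: W_def)
    fix x y and r :: real assume x: "x \<in> W"
    show "r *\<^sub>R x \<in> W"
    proof -
      have eq: "inner ((1 / sqrt a1) *\<^sub>R fst (fst (r *\<^sub>R x))) p + inner ((1 / c) *\<^sub>R fst (snd (r *\<^sub>R x))) q
          = r * (inner ((1 / sqrt a1) *\<^sub>R fst (fst x)) p + inner ((1 / c) *\<^sub>R fst (snd x)) q)"
        "inner ((1 / sqrt a2) *\<^sub>R snd (fst (r *\<^sub>R x))) p + inner ((1 / c) *\<^sub>R snd (snd (r *\<^sub>R x))) q
          = r * (inner ((1 / sqrt a2) *\<^sub>R snd (fst x)) p + inner ((1 / c) *\<^sub>R snd (snd x)) q)"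
        "inner ((1 / sqrt a1) *\<^sub>R fst (fst (r *\<^sub>R x)) - (1 / sqrt a2) *\<^sub>R snd (fst (r *\<^sub>R x))) p
          - inner ((1 / c) *\<^sub>R fst (snd (r *\<^sub>R x)) - (1 / c) *\<^sub>R snd (snd (r *\<^sub>R x))) q
          = r * (inner ((1 / sqrt a1) *\<^sub>R fst (fst x) - (1 / sqrt a2) *\<^sub>R snd (fst x)) p
          - inner ((1 / c) *\<^sub>R fst (snd x) - (1 / c) *\<^sub>R snd (snd x)) q)" for p q
        by (simp_all add: inner_diff_left algebra_simps)
      show ?thesis unfolding W_def mem_Collect_eq eq
        using x[unfolded W_def mem_Collect_eq]
        by (intro conjI allI impI) (simp_all only: mult_zero_right simp_thms)
    qed
    assume y: "y \<in> W"
    show "x + y \<in> W"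
    proof -
      have eq: "inner ((1 / sqrt a1) *\<^sub>R fst (fst (x + y))) p + inner ((1 / c) *\<^sub>R fst (snd (x + y))) q
          = (inner ((1 / sqrt a1) *\<^sub>R fst (fst x)) p + inner ((1 / c) *\<^sub>R fst (snd x)) q)
          + (inner ((1 / sqrt a1) *\<^sub>R fst (fst y)) p + inner ((1 / c) *\<^sub>R fst (snd y)) q)"
        "inner ((1 / sqrt a2) *\<^sub>R snd (fst (x + y))) p + inner ((1 / c) *\<^sub>R snd (snd (x + y))) q
          = (inner ((1 / sqrt a2) *\<^sub>R snd (fst x)) p + inner ((1 / c) *\<^sub>R snd (snd x)) q)
          + (inner ((1 / sqrt a2) *\<^sub>R snd (fst y)) p + inner ((1 / c) *\<^sub>R snd (snd y)) q)"
        "inner ((1 / sqrt a1) *\<^sub>R fst (fst (x + y)) - (1 / sqrt a2) *\<^sub>R snd (fst (x + y))) p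
          - inner ((1 / c) *\<^sub>R fst (snd (x + y)) - (1 / c) *\<^sub>R snd (snd (x + y))) q
          = (inner ((1 / sqrt a1) *\<^sub>R fst (fst x) - (1 / sqrt a2) *\<^sub>R snd (fst x)) p
          - inner ((1 / c) *\<^sub>R fst (snd x) - (1 / c) *\<^sub>R snd (snd x)) q)
          + (inner ((1 / sqrt a1) *\<^sub>R fst (fst y) - (1 / sqrt a2) *\<^sub>R snd (fst y)) p
          - inner ((1 / c) *\<^sub>R fst (snd y) - (1 / c) *\<^sub>R snd (snd y)) q)" for p q
        by (simp_all add: inner_diff_left inner_add_left algebra_simps)
      show ?thesis unfolding W_def mem_Collect_eq eq
        using x[unfolded W_def mem_Collect_eq] y[unfolded W_def mem_Collect_eq]
        by (intro conjI allI impI) (simp_all only: add_0_right simp_thms)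
    qed
  qed
  define E where "E w = (((sqrt a1 *\<^sub>R fst w, sqrt a2 *\<^sub>R snd w), (c *\<^sub>R dx (fst w), c *\<^sub>R dx (snd w))) :: H \<times> H)" for w
  have E_W: "E w \<in> W" if "w \<in> form_dom" for w
  proof -
    have w: "fst w \<in> H1" "snd w \<in> H1" "trace0 (fst w) = trace0 (snd w)" using that by (auto simp: form_dom_def)
    have "inner (fst w) (abs_l2 (deriv \<phi>)) + inner (dx (fst w)) (abs_l2 \<phi>) = 0"
      "inner (snd w) (abs_l2 (deriv \<phi>)) + inner (dx (snd w)) (abs_l2 \<phi>) = 0" if "test_fun half_line \<phi>" for \<phi>
      using wderiv_dx[OF w(1)] wderiv_dx[OF w(2)] that by (auto simp: wderiv_iff)
    moreover have "inner (fst w - snd w) e - inner (dx (fst w) - dx (snd w)) e = 0"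
      using trace0_H1[OF w(1), of 1] trace0_H1[OF w(2), of 1] w(3) by (simp add: e_def inner_diff_left)
    ultimately show ?thesis using c by (simp add: W_def E_def)
  qed
  \<comment> \<open>Scaled so that \<open>inner z0 (E w) = inner h w\<close>.\<close>
  define z0 :: "H \<times> H" where "z0 = (((1 / sqrt a1) *\<^sub>R fst h, (1 / sqrt a2) *\<^sub>R snd h), 0)"
  obtain p where p: "p \<in> W" "\<And>w. w \<in> W \<Longrightarrow> inner (z0 - p) w = 0"
    using closed_subspace_projection[OF closedW subW] by metis
  define v where "v = ((1 / sqrt a1) *\<^sub>R fst (fst p), (1 / sqrt a2) *\<^sub>R snd (fst p))"
  have w1: "wderiv (fst v) ((1 / c) *\<^sub>R fst (snd p))" and w2: "wderiv (snd v) ((1 / c) *\<^sub>R snd (snd p))"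
    using p(1) unfolding W_def v_def wderiv_iff by simp_all
  note d = dx_eq[OF w1] dx_eq[OF w2] and h1 = H1_I[OF w1] H1_I[OF w2]
  have "trace0 (fst v) - trace0 (snd v) = 0"
    using trace0_H1[OF h1(1), of 1] trace0_H1[OF h1(2), of 1] p(1)
    unfolding W_def d by (simp add: v_def e_def inner_diff_left)
  then have vf: "v \<in> form_dom" using h1 by (simp add: form_dom_def)
  have pE: "p = E v" unfolding E_def d using c by (simp add: v_def prod_eq_iff)
  have scaled: "inner ((1 / sqrt a) *\<^sub>R g - sqrt a *\<^sub>R x) (sqrt a *\<^sub>R y) = inner g y - a * inner x y"
    if "0 < a" for a and g x y :: l2
  proof -
    have "sqrt a * (sqrt a * r) = a * r" for r using that by (simp flip: mult.assoc)
    then show ?thesis using that by (simp add: inner_diff_left right_diff_distrib)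
  qed
  have "form c a1 a2 v w = inner h w" if "w \<in> form_dom" for w
  proof -
    have "0 = inner (z0 - E v) (E w)" using p(2)[OF E_W[OF that]] pE by simp
    also have "\<dots> = inner ((1 / sqrt a1) *\<^sub>R fst h - sqrt a1 *\<^sub>R fst v) (sqrt a1 *\<^sub>R fst w)
        + inner ((1 / sqrt a2) *\<^sub>R snd h - sqrt a2 *\<^sub>R snd v) (sqrt a2 *\<^sub>R snd w)
        + (inner (- (c *\<^sub>R dx (fst v))) (c *\<^sub>R dx (fst w)) + inner (- (c *\<^sub>R dx (snd v))) (c *\<^sub>R dx (snd w)))"
      by (simp only: inner_prod_def z0_def E_def fst_diff snd_diff fst_conv snd_conv fst_zero snd_zero diff_0 fst_uminus snd_uminus)
    also have "\<dots> = inner h w - form c a1 a2 v w"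
      unfolding scaled[OF c(2)] scaled[OF c(3)]
      by (simp add: form_def grad_def inner_prod_def power2_eq_square algebra_simps)
    finally show ?thesis by simp
  qed
  with vf show ?thesis by (rule that)
qed

text \<open>Testing the form identity with \<open>(\<phi>, 0)\<close> and \<open>(0, \<phi>)\<close>
  identifies the second weak derivatives; testing it with a pair \<open>(e, e)\<close> that does not
  vanish at the node yields the condition on the derivatives.\<close>

lemma opA_solvable:
  assumes c: "0 < c" "0 < a1" "0 < a2"
  obtains v where "v \<in> domA" "opA c a1 a2 v = h" "\<And>w. w \<in> form_dom \<Longrightarrow> form c a1 a2 v w = inner h w"
proof -
  obtain v where v: "v \<in> form_dom" "\<And>w. w \<in> form_dom \<Longrightarrow> form c a1 a2 v w = inner h w"
    using variational_solution[OF c, where h = h] by blast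
  have vH: "fst v \<in> H1" "snd v \<in> H1" "trace0 (fst v) = trace0 (snd v)" using v(1) by (auto simp: form_dom_def)
  have c2: "c\<^sup>2 \<noteq> 0" using c by simp
  have w1: "wderiv (dx (fst v)) ((1 / c\<^sup>2) *\<^sub>R (a1 *\<^sub>R fst v - fst h))"
    unfolding wderiv_iff
  proof (intro allI impI)
    fix \<phi> assume t: "test_fun half_line \<phi>"
    have "(abs_l2 \<phi>, 0) \<in> form_dom"
      using trace0_test_fun[OF t] H1_I[OF wderiv_test_fun[OF t]] by (simp add: form_dom_def H1_zero trace0_zero)
    from v(2)[OF this] have "c\<^sup>2 * inner (dx (fst v)) (abs_l2 (deriv \<phi>)) + a1 * inner (fst v) (abs_l2 \<phi>) = inner (fst h) (abs_l2 \<phi>)"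
      by (simp add: form_def grad_def inner_prod_def dx_zero dx_eq[OF wderiv_test_fun[OF t]])
    then show "inner (dx (fst v)) (abs_l2 (deriv \<phi>)) + inner ((1 / c\<^sup>2) *\<^sub>R (a1 *\<^sub>R fst v - fst h)) (abs_l2 \<phi>) = 0"
      using c2 by (simp add: inner_diff_left field_simps)
  qed
  have w2: "wderiv (dx (snd v)) ((1 / c\<^sup>2) *\<^sub>R (a2 *\<^sub>R snd v - snd h))"
    unfolding wderiv_iff
  proof (intro allI impI)
    fix \<phi> assume t: "test_fun half_line \<phi>"
    have "(0, abs_l2 \<phi>) \<in> form_dom"
      using trace0_test_fun[OF t] H1_I[OF wderiv_test_fun[OF t]] by (simp add: form_dom_def H1_zero trace0_zero)
    from v(2)[OF this] have "c\<^sup>2 * inner (dx (snd v)) (abs_l2 (deriv \<phi>)) + a2 * inner (snd v) (abs_l2 \<phi>) = inner (snd h) (abs_l2 \<phi>)"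
      by (simp add: form_def grad_def inner_prod_def dx_zero dx_eq[OF wderiv_test_fun[OF t]])
    then show "inner (dx (snd v)) (abs_l2 (deriv \<phi>)) + inner ((1 / c\<^sup>2) *\<^sub>R (a2 *\<^sub>R snd v - snd h)) (abs_l2 \<phi>) = 0"
      using c2 by (simp add: inner_diff_left field_simps)
  qed
  note d = dx_eq[OF w1] dx_eq[OF w2] and h1 = H1_I[OF w1] H1_I[OF w2]
  define e where "e = exp_l2 1"
  have we: "wderiv e ((- 1) *\<^sub>R e)" using wderiv_exp_l2[of 1] by (simp add: e_def)
  have "(e, e) \<in> form_dom" using H1_I[OF we] by (simp add: form_dom_def)
  from v(2)[OF this]
  have eq: "- (c\<^sup>2 * (inner (dx (fst v)) e + inner (dx (snd v)) e)) + a1 * inner (fst v) e + a2 * inner (snd v) e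
      = inner (fst h) e + inner (snd h) e"
    using dx_eq[OF we] by (simp add: form_def grad_def inner_prod_def algebra_simps)
  \<comment> \<open>The trace formula with \<open>k = 1\<close> expresses both derivative traces by
    inner products with \<open>e\<close>, and the identity \<open>eq\<close> cancels them.\<close>
  have "c\<^sup>2 * (trace0 (dx (fst v)) + trace0 (dx (snd v))) = 0"
    using eq c2 trace0_H1[OF h1(1), of 1] trace0_H1[OF h1(2), of 1]
    by (simp add: d e_def[symmetric] inner_diff_left field_simps)
  then have "trace0 (dx (fst v)) + trace0 (dx (snd v)) = 0" using c2 by simp
  then have "v \<in> domA" using vH h1 by (simp add: domA_iff)
  moreover have "opA c a1 a2 v = h" using c2 by (simp add: opA_eq d prod_eq_iff)
  ultimately show ?thesis using v(2) that by blast
qed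

text \<open>This is Green's formula, obtained without integrating by parts: the variational solution
  \<open>v'\<close> with the same image satisfies it by construction, and injectivity gives
  \<open>v' = v\<close>.\<close>

lemma opA_form:
  assumes c: "0 < c" "0 < a1" "0 < a2" and v: "v \<in> domA" and w: "w \<in> form_dom"
  shows "inner (opA c a1 a2 v) w = form c a1 a2 v w"
proof -
  obtain v' where v': "v' \<in> domA" "opA c a1 a2 v' = opA c a1 a2 v"
    "\<And>w. w \<in> form_dom \<Longrightarrow> form c a1 a2 v' w = inner (opA c a1 a2 v) w"
    using opA_solvable[OF c, where h = "opA c a1 a2 v"] by blast
  have "v' - v = 0"
    by (rule opA_injective[OF c domA_diff[OF v'(1) v]]) (simp add: opA_diff v'(1,2) v)
  then show ?thesis using v'(3)[OF w] by simp
qed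

lemma form_self: "form c a1 a2 v v = c\<^sup>2 * (norm (grad v))\<^sup>2 + a1 * (norm (fst v))\<^sup>2 + a2 * (norm (snd v))\<^sup>2"
  by (simp add: form_def power2_norm_eq_inner)

lemma norm_prod_sq: "(norm v)\<^sup>2 = (norm (fst v))\<^sup>2 + (norm (snd v))\<^sup>2"
  by (simp add: norm_prod_def)

lemma form_coercive:
  assumes "0 < a1" "0 < a2"
  shows "min a1 a2 * (norm v)\<^sup>2 \<le> form c a1 a2 v v"
proof -
  have "min a1 a2 * (norm (fst v))\<^sup>2 \<le> a1 * (norm (fst v))\<^sup>2" "min a1 a2 * (norm (snd v))\<^sup>2 \<le> a2 * (norm (snd v))\<^sup>2"
    by (auto intro: mult_right_mono)
  moreover have "0 \<le> c\<^sup>2 * (norm (grad v))\<^sup>2" by simp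
  ultimately show ?thesis unfolding form_self norm_prod_sq[of v] distrib_left by linarith
qed

text \<open>Symmetry and the lower bound come from the form, since \<open>inner x (Q y)\<close> is
  its value at \<open>Q x\<close> and \<open>Q y\<close>. The lower bound is the hypothesis of
  \<open>operator_sqrt\<close> with \<open>m = min a1 a2\<close>.\<close>

lemma inverse_opA:
  assumes c: "0 < c" "0 < a1" "0 < a2"
  obtains Q where "bounded_linear Q" "\<And>x y. inner (Q x) y = inner x (Q y)"
    "\<And>x. min a1 a2 * (norm (Q x))\<^sup>2 \<le> inner (Q x) x"
    "\<And>h. Q h \<in> domA" "\<And>h. opA c a1 a2 (Q h) = h" "\<And>v. v \<in> domA \<Longrightarrow> Q (opA c a1 a2 v) = v"
proof -
  have "\<exists>v. v \<in> domA \<and> opA c a1 a2 v = h" for h using opA_solvable[OF c, of h] by metis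
  then obtain Q where Q: "\<And>h. Q h \<in> domA" "\<And>h. opA c a1 a2 (Q h) = h" by metis
  have uniq: "v = w" if "v \<in> domA" "w \<in> domA" "opA c a1 a2 v = opA c a1 a2 w" for v w
    using opA_injective[OF c domA_diff[OF that(1,2)]] that by (simp add: opA_diff)
  have QA: "Q (opA c a1 a2 v) = v" if "v \<in> domA" for v by (rule uniq) (use Q that in auto)
  have form: "inner x (Q y) = form c a1 a2 (Q x) (Q y)" for x y
    using opA_form[OF c Q(1) domA_form_dom[OF Q(1)], of x y] by (simp add: Q(2))
  have sym: "inner (Q x) y = inner x (Q y)" for x y
    using form[of x y] form[of y x] by (simp add: inner_commute form_commute)
  have co: "min a1 a2 * (norm (Q x))\<^sup>2 \<le> inner (Q x) x" for x
    using form_coercive[OF c(2,3), of "Q x" c] form[of x x] by (simp add: sym)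
  have "bounded_linear Q"
  proof (rule bounded_linear_intro)
    fix x y and r :: real
    show "Q (x + y) = Q x + Q y" by (rule uniq) (auto simp: Q domA_add opA_add)
    show "Q (r *\<^sub>R x) = r *\<^sub>R Q x" by (rule uniq) (auto simp: Q domA_scaleR opA_scaleR)
    define m where "m = min a1 a2"
    have m: "0 < m" using c by (simp add: m_def)
    have "m * (norm (Q x))\<^sup>2 \<le> norm (Q x) * norm x"
      using co[of x] norm_cauchy_schwarz[of "Q x" x] by (simp add: m_def)
    then have "norm (Q x) * (m * norm (Q x)) \<le> norm (Q x) * norm x" by (simp add: power2_eq_square mult_ac)
    then have "m * norm (Q x) \<le> norm x" by (cases "Q x = 0") auto
    then show "norm (Q x) \<le> norm x * (1 / min a1 a2)" using m by (simp add: m_def field_simps)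
  qed
  then show ?thesis using that sym co Q QA by blast
qed

section \<open>The nonlinear wave equation\<close>

text \<open>A representative of the zero class may take arbitrary values on a null set, and
  \<open>F\<close> is at first an arbitrary function. Completeness of Lebesgue measure still makes
  the composite measurable.\<close>

lemma AE_zero_half_measurable:
  fixes h :: "real \<Rightarrow> real"
  assumes "AE x in half_lebesgue. h x = 0" shows "h \<in> borel_measurable half_lebesgue"
proof -
  have "AE x in lebesgue. x \<in> half_line \<longrightarrow> h x = 0"
    using assms by (subst (asm) AE_restrict_space_iff) auto
  then have "AE x in lebesgue. 0 = indicator half_line x *\<^sub>R h x"
    by eventually_elim (auto simp: indicator_def)
  from borel_measurable_AE[OF _ this] have "(\<lambda>x. indicator half_line x *\<^sub>R h x) \<in> borel_measurable lebesgue"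
    by simp
  then show ?thesis by (subst borel_measurable_restrict_space_iff) auto
qed

lemma sqint_AE_zero: "AE x in half_lebesgue. h x = (0::real) \<Longrightarrow> sqint half_line h"
  by (rule sqintI_bound[OF AE_zero_half_measurable sqint_zero]) auto

lemma nemytskii_zero:
  assumes "F 0 = 0"
  shows "in_H (nemytskii F 0)" and "to_H (nemytskii F 0) = 0"
proof -
  have AE: "AE x in half_lebesgue. F (rep_l2 0 x) = 0"
    using AE_rep_l2_zero by eventually_elim (simp add: assms)
  have s: "sqint half_line (\<lambda>x. F (rep_l2 0 x))" using AE by (rule sqint_AE_zero)
  then show "in_H (nemytskii F 0)" by (simp add: in_H_def nemytskii_def)
  have "abs_l2 (\<lambda>x. F (rep_l2 0 x)) = abs_l2 (\<lambda>x. 0)"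
    by (rule abs_l2_eqI) (use s AE in \<open>simp add: l2_rel_def\<close>)
  then show "to_H (nemytskii F 0) = 0" by (simp add: to_H_def nemytskii_def abs_l2_zero zero_prod_def)
qed

text \<open>The composite with the zero class is almost everywhere the constant \<open>F 0\<close>,
  which represents the zero class only if it is 0.\<close>

lemma J_zero_imp:
  assumes "J_zero F" shows "F 0 = 0"
proof (rule ccontr)
  assume ne: "F 0 \<noteq> 0"
  have s: "sqint half_line (\<lambda>x. F (rep_l2 0 x))"
    using assms by (simp add: J_zero_def J_in_X_def in_H_def nemytskii_def)
  have z: "abs_l2 (\<lambda>x. F (rep_l2 0 x)) = 0"
    using assms by (simp add: J_zero_def J_def to_H_def nemytskii_def zero_prod_def)
  have "AE x in half_lebesgue. F (rep_l2 0 x) = 0"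
    using AE_rep_abs_l2[OF s, unfolded z] AE_rep_l2_zero by eventually_elim simp
  then have "AE x in half_lebesgue. x \<notin> {0<..<1}"
    using AE_rep_l2_zero by eventually_elim (use ne in auto)
  then show False by (rule not_AE_half_interval[rotated 2]) auto
qed

lemma in_H_nemytskii:
  assumes "F 0 = 0" "in_H (nemytskii_diff F u 0)" shows "in_H (nemytskii F u)"
  using assms(2) nemytskii_zero(1)[where F = F, OF assms(1)]
    sqint_add[of half_line "\<lambda>x. F (rep_l2 (fst u) x) - F (rep_l2 0 x)" "\<lambda>x. F (rep_l2 0 x)"]
    sqint_add[of half_line "\<lambda>x. F (rep_l2 (snd u) x) - F (rep_l2 0 x)" "\<lambda>x. F (rep_l2 0 x)"]
  by (simp add: in_H_def nemytskii_diff_def nemytskii_def)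

lemma to_H_nemytskii_diff:
  assumes "in_H (nemytskii F u)" "in_H (nemytskii F v)"
  shows "in_H (nemytskii_diff F u v)"
    and "to_H (nemytskii_diff F u v) = to_H (nemytskii F u) - to_H (nemytskii F v)"
  using assms by (auto simp: in_H_def nemytskii_diff_def nemytskii_def to_H_def abs_l2_diff sqint_diff)

lemma norm_indicator_l2:
  assumes "0 < e" shows "norm (abs_l2 (\<lambda>x. indicator {..e} x)) = sqrt e"
proof -
  have "(norm (abs_l2 (\<lambda>x. indicator {..e} x)))\<^sup>2 = (\<integral>x. (indicator {..e} x)\<^sup>2 \<partial>half_lebesgue)"
    by (rule norm_abs_l2_sq) (rule sqint_indicator)
  also have "\<dots> = (\<integral>x. indicator {..e} x \<partial>half_lebesgue)"
    by (intro Bochner_Integration.integral_cong) (auto simp: indicator_def)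
  also have "\<dots> = (\<integral>x. indicator half_line x * indicator {..e} x \<partial>lborel)"
    by (rule half_lebesgue_integral_borel) simp
  also have "\<dots> = (\<integral>x. indicator {0<..e} x \<partial>lborel)"
    by (intro Bochner_Integration.integral_cong) (auto simp: indicator_def)
  also have "\<dots> = e" using assms by simp
  finally show ?thesis by (metis norm_ge_zero real_sqrt_unique)
qed

lemma norm_fst_bound: "norm (fst z) \<le> norm z" and norm_snd_bound: "norm (snd z) \<le> norm z"
  by (cases z; simp add: norm_fst_le norm_snd_le)+

text \<open>Testing the bound on multiples of indicator functions of short intervals, whose norms are
  arbitrarily small, shows that \<open>F\<close> itself is Lipschitz continuous.\<close>

lemma lipschitz_H_imp_lipschitz:
  assumes "lipschitz_H F" "F 0 = 0"
  obtains L where "0 \<le> L" "\<And>r s. \<bar>F r - F s\<bar> \<le> L * \<bar>r - s\<bar>"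
proof -
  obtain C where C: "incr2 C" "\<And>u v. in_H (nemytskii_diff F u v) \<and>
     norm (to_H (nemytskii_diff F u v)) \<le> C (norm u) (norm v) * norm (u - v)"
    using assms by (auto simp: lipschitz_H_def)
  have "\<bar>F r - F s\<bar> \<le> max 0 (C 1 1) * \<bar>r - s\<bar>" for r s
  proof -
    \<comment> \<open>This length makes \<open>\<bar>r\<bar> * sqrt e\<close> and
      \<open>\<bar>s\<bar> * sqrt e\<close> at most 1, so the bounding function stays below
      \<open>C 1 1\<close>, a constant independent of \<open>r\<close> and \<open>s\<close>.\<close>
    define e where "e = 1 / (1 + r\<^sup>2 + s\<^sup>2)"
    have pos: "0 < 1 + r\<^sup>2 + s\<^sup>2" by (simp add: add_pos_nonneg)
    then have e: "0 < e" by (simp add: e_def)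
    have small: "\<bar>t\<bar> * sqrt e \<le> 1" if "t\<^sup>2 \<le> 1 + r\<^sup>2 + s\<^sup>2" for t
    proof (rule power2_le_imp_le)
      show "(\<bar>t\<bar> * sqrt e)\<^sup>2 \<le> 1\<^sup>2" using that pos by (simp add: power_mult_distrib e_def)
    qed simp
    define i where "i = abs_l2 (\<lambda>x. indicator {..e} x)"
    have ni: "norm i = sqrt e" unfolding i_def by (rule norm_indicator_l2[OF e])
    define u v where "u = (r *\<^sub>R i, 0 :: l2)" and "v = (s *\<^sub>R i, 0 :: l2)"
    have nuv: "norm u = \<bar>r\<bar> * sqrt e" "norm v = \<bar>s\<bar> * sqrt e" "norm (u - v) = \<bar>r - s\<bar> * sqrt e"
      using e by (simp_all add: u_def v_def norm_Pair ni abs_mult scaleR_diff_left[symmetric] del: scaleR_diff_left)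
    let ?d = "\<lambda>x. F (rep_l2 (fst u) x) - F (rep_l2 (fst v) x)"
    have sd: "sqint half_line ?d" using C(2)[of u v] by (simp add: in_H_def nemytskii_diff_def)
    have rep: "AE x in half_lebesgue. rep_l2 (t *\<^sub>R i) x = t * indicator {..e} x" for t
      using AE_rep_l2_scaleR[of t i] AE_rep_abs_l2[OF sqint_indicator[of e]] unfolding i_def
      by eventually_elim simp
    have "AE x in half_lebesgue. ?d x = (F r - F s) * indicator {..e} x"
      using rep[of r] rep[of s] by eventually_elim (auto simp: u_def v_def indicator_def)
    then have "abs_l2 ?d = abs_l2 (\<lambda>x. (F r - F s) * indicator {..e} x)"
      using sd sqint_scale[OF sqint_indicator] by (intro abs_l2_eqI) (simp add: l2_rel_def)
    also have "\<dots> = (F r - F s) *\<^sub>R i" unfolding i_def by (rule abs_l2_scaleR[OF sqint_indicator])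
    finally have "norm (abs_l2 ?d) = \<bar>F r - F s\<bar> * sqrt e" by (simp add: ni)
    moreover have "norm (abs_l2 ?d) \<le> norm (to_H (nemytskii_diff F u v))"
      by (metis fst_conv nemytskii_diff_def norm_fst_le prod.collapse to_H_def)
    moreover have "norm (to_H (nemytskii_diff F u v)) \<le> C (norm u) (norm v) * norm (u - v)" using C(2) by blast
    moreover have "C (norm u) (norm v) \<le> C 1 1"
      using C(1)[unfolded incr2_def, rule_format, of "norm u" 1 "norm v" 1] small[of r] small[of s] e by (simp add: nuv)
    then have "C (norm u) (norm v) * norm (u - v) \<le> max 0 (C 1 1) * norm (u - v)" by (intro mult_right_mono) auto
    ultimately have "\<bar>F r - F s\<bar> * sqrt e \<le> (max 0 (C 1 1) * \<bar>r - s\<bar>) * sqrt e" by (simp add: nuv mult.assoc)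
    then show ?thesis using e by simp
  qed
  then show ?thesis using that[of "max 0 (C 1 1)"] by simp
qed

lemma lipschitz_nemytskii:
  assumes L: "0 \<le> L" "\<And>r s. \<bar>F r - F s\<bar> \<le> L * \<bar>r - s\<bar>" and F0: "F (0::real) = 0"
  shows "in_H (nemytskii F u)"
    and "norm (to_H (nemytskii F u) - to_H (nemytskii F v)) \<le> L * norm (u - v)"
proof -
  have "continuous_on UNIV F"
    by (rule lipschitz_on_continuous_on[of L]) (use L in \<open>auto simp: lipschitz_on_def dist_real_def\<close>)
  then have [measurable]: "F \<in> borel_measurable borel" by (rule borel_measurable_continuous_onI)
  have s: "sqint half_line (\<lambda>x. F (rep_l2 w x))" for w
  proof (rule sqintI_bound)
    show "(\<lambda>x. F (rep_l2 w x)) \<in> borel_measurable half_lebesgue" by measurable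
    show "sqint half_line (\<lambda>x. L * rep_l2 w x)" by (intro sqint_scale sqint_rep_l2)
    show "AE x in half_lebesgue. \<bar>F (rep_l2 w x)\<bar> \<le> \<bar>L * rep_l2 w x\<bar>"
      using L(2)[of _ 0] L(1) by (simp add: F0 abs_mult)
  qed
  then show inH: "in_H (nemytskii F u)" by (simp add: in_H_def nemytskii_def)
  have c: "norm (abs_l2 (\<lambda>x. F (rep_l2 w x)) - abs_l2 (\<lambda>x. F (rep_l2 z x))) \<le> L * norm (w - z)" for w z
  proof (rule power2_le_imp_le)
    have "(norm (abs_l2 (\<lambda>x. F (rep_l2 w x)) - abs_l2 (\<lambda>x. F (rep_l2 z x))))\<^sup>2
        = (\<integral>x. (F (rep_l2 w x) - F (rep_l2 z x))\<^sup>2 \<partial>half_lebesgue)"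
      unfolding abs_l2_diff[OF s s, symmetric] by (rule norm_abs_l2_sq) (intro sqint_diff s)
    also have "\<dots> \<le> (\<integral>x. (L * rep_l2 (w - z) x)\<^sup>2 \<partial>half_lebesgue)"
    proof (rule integral_mono_AE)
      show "integrable half_lebesgue (\<lambda>x. (F (rep_l2 w x) - F (rep_l2 z x))\<^sup>2)"
        using sqint_diff[OF s s] by (simp add: sqint_def)
      show "integrable half_lebesgue (\<lambda>x. (L * rep_l2 (w - z) x)\<^sup>2)"
        using sqint_scale[OF sqint_rep_l2] by (simp add: sqint_def)
      show "AE x in half_lebesgue. (F (rep_l2 w x) - F (rep_l2 z x))\<^sup>2 \<le> (L * rep_l2 (w - z) x)\<^sup>2"
        using AE_rep_l2_diff[of w z]
      proof eventually_elim
        case (elim x)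
        have "\<bar>F (rep_l2 w x) - F (rep_l2 z x)\<bar> \<le> \<bar>L * rep_l2 (w - z) x\<bar>"
          using L(2)[of "rep_l2 w x" "rep_l2 z x"] L(1) by (simp add: elim abs_mult)
        then show ?case by (simp add: abs_le_square_iff)
      qed
    qed
    also have "\<dots> = (norm (abs_l2 (\<lambda>x. L * rep_l2 (w - z) x)))\<^sup>2"
      by (rule norm_abs_l2_sq[symmetric]) (intro sqint_scale sqint_rep_l2)
    also have "\<dots> = (L * norm (w - z))\<^sup>2"
      using L(1) by (simp add: abs_l2_scaleR abs_l2_rep_l2)
    finally show "(norm (abs_l2 (\<lambda>x. F (rep_l2 w x)) - abs_l2 (\<lambda>x. F (rep_l2 z x))))\<^sup>2 \<le> (L * norm (w - z))\<^sup>2" .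
  qed (use L in simp)
  show "norm (to_H (nemytskii F u) - to_H (nemytskii F v)) \<le> L * norm (u - v)"
  proof (rule power2_le_imp_le)
    have "(norm (to_H (nemytskii F u) - to_H (nemytskii F v)))\<^sup>2 \<le> (L * norm (fst (u - v)))\<^sup>2 + (L * norm (snd (u - v)))\<^sup>2"
      unfolding norm_prod_sq[of "to_H _ - to_H _"] by (intro add_mono power_mono) (simp_all add: to_H_def nemytskii_def c)
    also have "\<dots> = (L * norm (u - v))\<^sup>2" by (simp add: power_mult_distrib norm_prod_sq[of "u - v"] distrib_left)
    finally show "(norm (to_H (nemytskii F u) - to_H (nemytskii F v)))\<^sup>2 \<le> (L * norm (u - v))\<^sup>2" .
  qed (use L in simp)
qed

section \<open>The energy norm and the conditions on \<open>J\<close>\<close>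

text \<open>\<open>Q\<close> and \<open>S\<close> stand for the inverses of the operator and of its
  square root. The assumption \<open>sqrt_graph\<close> is the link to the definite description in
  \<open>op_sqrt\<close>.\<close>

locale wave_system =
  fixes c a1 a2 :: real and Q S :: "H \<Rightarrow> H"
  assumes pos: "0 < c" "0 < a1" "0 < a2"
    and Q_domA: "Q h \<in> domA" and A_Q: "opA c a1 a2 (Q h) = h"
    and Q_A: "v \<in> domA \<Longrightarrow> Q (opA c a1 a2 v) = v"
    and bounded_linear_S: "bounded_linear S" and S_sym: "inner (S x) y = inner x (S y)"
    and S_S: "S (S x) = Q x"
    and sqrt_graph: "op_sqrt (graphA c a1 a2) = range (\<lambda>h. (S h, h))"
begin

sublocale S: bounded_linear S by (rule bounded_linear_S)

abbreviation A where "A \<equiv> opA c a1 a2"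
abbreviation B where "B \<equiv> sqrtA c a1 a2"
abbreviation dB where "dB \<equiv> dom_sqrtA c a1 a2"

lemma domA_0: "0 \<in> domA" using domA_diff[OF Q_domA[of 0] Q_domA[of 0]] by simp

lemma A_0: "A 0 = 0" using opA_scaleR[OF domA_0, of c a1 a2 0] by simp

lemma S_0: "S x = 0 \<Longrightarrow> x = 0"
  using S_S[of x] A_Q[of x] A_0 S.zero by simp

lemma S_inj: "S x = S y \<Longrightarrow> x = y"
  using S_0[of "x - y"] by (simp add: S.diff)

lemma dB_range: "dB = range S"
  by (auto simp: dom_sqrtA_def sqrt_graph)

lemma B_S [simp]: "B (S h) = h"
  unfolding sqrtA_def app_def sqrt_graph by (rule the_equality) (auto dest: S_inj)

lemma S_dB [simp]: "S h \<in> dB" by (simp add: dB_range)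

lemma S_B: "u \<in> dB \<Longrightarrow> S (B u) = u" by (auto simp: dB_range)

lemma dB_diff: "u \<in> dB \<Longrightarrow> v \<in> dB \<Longrightarrow> u - v \<in> dB" and B_diff: "u \<in> dB \<Longrightarrow> v \<in> dB \<Longrightarrow> B (u - v) = B u - B v"
  using B_S[of "B u - B v"] S_dB[of "B u - B v"] by (simp_all add: S.diff S_B)

lemma dB_scaleR: "u \<in> dB \<Longrightarrow> r *\<^sub>R u \<in> dB" and B_scaleR: "u \<in> dB \<Longrightarrow> B (r *\<^sub>R u) = r *\<^sub>R B u"
  using B_S[of "r *\<^sub>R B u"] S_dB[of "r *\<^sub>R B u"] by (simp_all add: S.scaleR S_B)

lemma dB_0 [simp]: "0 \<in> dB" and B_0 [simp]: "B 0 = 0"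
  using B_S[of 0] S_dB[of 0] by (simp_all add: S.zero)

lemma B_minus: "u \<in> dB \<Longrightarrow> B (- u) = - B u"
  using B_scaleR[of u "-1"] by simp

lemma domA_SS: "v \<in> domA \<Longrightarrow> v = S (S (A v))" by (simp add: S_S Q_A)

lemma domA_dB: "v \<in> domA \<Longrightarrow> v \<in> dB" using domA_SS S_dB by metis

lemma B_domA: "v \<in> domA \<Longrightarrow> B v = S (A v)" using domA_SS B_S by metis

lemma norm_B_domA: "v \<in> domA \<Longrightarrow> (norm (B v))\<^sup>2 = form c a1 a2 v v"
proof -
  assume v: "v \<in> domA"
  have "(norm (B v))\<^sup>2 = inner (A v) (S (S (A v)))" by (simp add: B_domA[OF v] power2_norm_eq_inner S_sym)
  also have "\<dots> = form c a1 a2 v v" using opA_form[OF pos v domA_form_dom[OF v]] domA_SS[OF v] by simp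
  finally show ?thesis .
qed

text \<open>For \<open>v\<close> in \<open>domA\<close> the square of \<open>norm (B v)\<close> is
  the form, which dominates \<open>min a1 a2 * (norm v)\<^sup>2\<close> and
  \<open>c\<^sup>2 * (norm (grad v))\<^sup>2\<close>; the two entries are the resulting
  constants.\<close>

definition \<kappa> where "\<kappa> = max (1 / sqrt (min a1 a2)) (1 / c)"

lemma kappa_nonneg: "0 \<le> \<kappa>" using pos by (auto simp: \<kappa>_def max_def)

lemma energy_bounds:
  assumes v: "v \<in> domA" shows "norm v \<le> \<kappa> * norm (B v)" "norm (grad v) \<le> \<kappa> * norm (B v)"
proof -
  have m: "0 < min a1 a2" using pos by simp
  have "(sqrt (min a1 a2) * norm v)\<^sup>2 \<le> (norm (B v))\<^sup>2"
    using form_coercive[of a1 a2 v c] pos m by (simp add: norm_B_domA[OF v] power_mult_distrib)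
  then have "sqrt (min a1 a2) * norm v \<le> norm (B v)" by (rule power2_le_imp_le) simp
  then have "norm v \<le> 1 / sqrt (min a1 a2) * norm (B v)" using m by (simp add: field_simps)
  also have "\<dots> \<le> \<kappa> * norm (B v)" by (intro mult_right_mono) (auto simp: \<kappa>_def)
  finally show "norm v \<le> \<kappa> * norm (B v)" .
  have "(c * norm (grad v))\<^sup>2 \<le> (norm (B v))\<^sup>2"
    using pos unfolding norm_B_domA[OF v] form_self by (simp add: power_mult_distrib)
  then have "c * norm (grad v) \<le> norm (B v)" by (rule power2_le_imp_le) simp
  then have "norm (grad v) \<le> 1 / c * norm (B v)" using pos by (simp add: field_simps)
  also have "\<dots> \<le> \<kappa> * norm (B v)" by (intro mult_right_mono) (auto simp: \<kappa>_def)
  finally show "norm (grad v) \<le> \<kappa> * norm (B v)" .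
qed

text \<open>\<open>normX\<close> is not the norm of a type; this map turns it into the product norm of \<open>H \<times> H\<close>.\<close>

definition emb :: "H \<times> H \<Rightarrow> H \<times> H" where "emb \<phi> = (B (fst \<phi>), snd \<phi>)"

lemma normX_emb: "normX c a1 a2 \<phi> = norm (emb \<phi>)"
  by (simp add: normX_def emb_def norm_Pair)

lemma normX_ge: "norm (B (fst \<phi>)) \<le> normX c a1 a2 \<phi>" "norm (snd \<phi>) \<le> normX c a1 a2 \<phi>"
  unfolding normX_emb using norm_fst_bound[of "emb \<phi>"] norm_snd_bound[of "emb \<phi>"] by (auto simp: emb_def)

lemma normX_zero_left: "normX c a1 a2 (0, w) = norm w" and normX_zero_right: "normX c a1 a2 (w, 0) = norm (B w)"
  by (simp_all add: normX_def)

text \<open>The energy norm controls \<open>norm u\<close> and \<open>norm (grad u)\<close> through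
  \<open>\<kappa>\<close>, so monotonicity turns the given bounding function into one of energy
  norms.\<close>

lemma lipschitz_energy_imp_H0L:
  assumes "F 0 = 0" "lipschitz_energy c a1 a2 F" shows "H0L c a1 a2 F"
proof -
  obtain C where C: "incr4 C" "\<And>u v. u \<in> domA \<Longrightarrow> v \<in> domA \<Longrightarrow> in_H (nemytskii_diff F u v) \<and>
     norm (to_H (nemytskii_diff F u v)) \<le> C (norm u) (norm (grad u)) (norm v) (norm (grad v)) * norm (B u - B v)"
    using assms(2) unfolding lipschitz_energy_def by blast
  \<comment> \<open>\<open>C\<close> may take negative values; the maximum keeps the factor
    nonnegative when the norm it multiplies is enlarged.\<close>
  define D where "D x y = max 0 (C (\<kappa> * x) (\<kappa> * x) (\<kappa> * y) (\<kappa> * y))" for x y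
  have "incr2 D"
    unfolding incr2_def D_def
  proof (intro allI impI max.mono order_refl)
    fix x1 x2 y1 y2 :: real assume "0 \<le> x1 \<and> x1 \<le> y1 \<and> 0 \<le> x2 \<and> x2 \<le> y2"
    then show "C (\<kappa> * x1) (\<kappa> * x1) (\<kappa> * x2) (\<kappa> * x2) \<le> C (\<kappa> * y1) (\<kappa> * y1) (\<kappa> * y2) (\<kappa> * y2)"
      using kappa_nonneg by (intro C(1)[unfolded incr4_def, rule_format]) (auto intro: mult_left_mono)
  qed
  moreover have "J_in_X F \<phi>" if "\<phi> \<in> dom_calA c a1 a2" for \<phi>
    using that C(2)[OF _ domA_0, of "fst \<phi>"] in_H_nemytskii[where F = F, OF assms(1), of "fst \<phi>"]
    by (auto simp: J_in_X_def dom_calA_def)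
  moreover have "normX c a1 a2 (J F \<phi> - J F \<psi>) \<le> D (normX c a1 a2 \<phi>) (normX c a1 a2 \<psi>) * normX c a1 a2 (\<phi> - \<psi>)"
    if p: "\<phi> \<in> dom_calA c a1 a2" "\<psi> \<in> dom_calA c a1 a2" for \<phi> \<psi>
  proof -
    let ?u = "fst \<phi>" and ?v = "fst \<psi>"
    have uv: "?u \<in> domA" "?v \<in> domA" using p by (auto simp: dom_calA_def)
    have "J F \<phi> - J F \<psi> = (0, to_H (nemytskii_diff F ?u ?v))"
      using calculation(2)[OF p(1)] calculation(2)[OF p(2)]
      by (simp add: J_def J_in_X_def to_H_nemytskii_diff)
    then have "normX c a1 a2 (J F \<phi> - J F \<psi>) \<le> C (norm ?u) (norm (grad ?u)) (norm ?v) (norm (grad ?v)) * norm (B ?u - B ?v)"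
      using C(2)[OF uv] by (simp add: normX_zero_left)
    also have "\<dots> \<le> D (normX c a1 a2 \<phi>) (normX c a1 a2 \<psi>) * norm (B ?u - B ?v)"
    proof (rule mult_right_mono)
      have b: "\<kappa> * norm (B (fst \<xi>)) \<le> \<kappa> * normX c a1 a2 \<xi>" for \<xi>
        by (intro mult_left_mono normX_ge kappa_nonneg)
      have "C (norm ?u) (norm (grad ?u)) (norm ?v) (norm (grad ?v))
          \<le> C (\<kappa> * normX c a1 a2 \<phi>) (\<kappa> * normX c a1 a2 \<phi>) (\<kappa> * normX c a1 a2 \<psi>) (\<kappa> * normX c a1 a2 \<psi>)"
        using energy_bounds[OF uv(1)] energy_bounds[OF uv(2)] b[of \<phi>] b[of \<psi>]
        by (intro C(1)[unfolded incr4_def, rule_format]) auto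
      then show "C (norm ?u) (norm (grad ?u)) (norm ?v) (norm (grad ?v)) \<le> D (normX c a1 a2 \<phi>) (normX c a1 a2 \<psi>)"
        by (simp add: D_def)
    qed simp
    also have "\<dots> \<le> D (normX c a1 a2 \<phi>) (normX c a1 a2 \<psi>) * normX c a1 a2 (\<phi> - \<psi>)"
      using normX_ge(1)[of "\<phi> - \<psi>"] uv by (intro mult_left_mono) (auto simp: B_diff domA_dB D_def)
    finally show ?thesis .
  qed
  ultimately show ?thesis unfolding H0L_def by blast
qed

text \<open>The difference of the values of \<open>J\<close> has first component 0, so the generator
  sends it to minus its second component, measured by \<open>B\<close>. On the right,
  \<open>A (u - v)\<close> is one component of the difference of the images.\<close>

lemma lipschitz_graph_imp_H1L:
  assumes "F 0 = 0" "lipschitz_graph c a1 a2 F" shows "H1L c a1 a2 F"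
proof -
  obtain C where C: "incr4 C" "\<And>u v. u \<in> domA \<Longrightarrow> v \<in> domA \<Longrightarrow> in_H (nemytskii_diff F u v) \<and>
     to_H (nemytskii_diff F u v) \<in> dB \<and>
     norm (B (to_H (nemytskii_diff F u v))) \<le> C (norm u) (norm (grad u)) (norm v) (norm (grad v)) * norm (A (u - v))"
    using assms(2) unfolding lipschitz_graph_def by blast
  define D where "D x (x'::real) y (y'::real) = max 0 (C (\<kappa> * x) (\<kappa> * x) (\<kappa> * y) (\<kappa> * y))" for x x' y y'
  have "incr4 D"
    unfolding incr4_def D_def
  proof (intro allI impI max.mono order_refl)
    fix x1 x2 x3 x4 y1 y2 y3 y4 :: real
    assume "0 \<le> x1 \<and> x1 \<le> y1 \<and> 0 \<le> x2 \<and> x2 \<le> y2 \<and> 0 \<le> x3 \<and> x3 \<le> y3 \<and> 0 \<le> x4 \<and> x4 \<le> y4"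
    then show "C (\<kappa> * x1) (\<kappa> * x1) (\<kappa> * x3) (\<kappa> * x3) \<le> C (\<kappa> * y1) (\<kappa> * y1) (\<kappa> * y3) (\<kappa> * y3)"
      using kappa_nonneg by (intro C(1)[unfolded incr4_def, rule_format]) (auto intro: mult_left_mono)
  qed
  moreover have inX: "J_in_X F \<phi>" if "\<phi> \<in> dom_calA c a1 a2" for \<phi>
    using that C(2)[OF _ domA_0, of "fst \<phi>"] in_H_nemytskii[where F = F, OF assms(1), of "fst \<phi>"]
    by (auto simp: J_in_X_def dom_calA_def)
  moreover have "J F \<phi> - J F \<psi> \<in> dom_calA c a1 a2 \<and>
      normX c a1 a2 (i_calA c a1 a2 (J F \<phi> - J F \<psi>))
      \<le> D (normX c a1 a2 \<phi>) (normX c a1 a2 (i_calA c a1 a2 \<phi>)) (normX c a1 a2 \<psi>) (normX c a1 a2 (i_calA c a1 a2 \<psi>))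
        * normX c a1 a2 (i_calA c a1 a2 \<phi> - i_calA c a1 a2 \<psi>)"
    if p: "\<phi> \<in> dom_calA c a1 a2" "\<psi> \<in> dom_calA c a1 a2" for \<phi> \<psi>
  proof -
    let ?u = "fst \<phi>" and ?v = "fst \<psi>"
    let ?D = "D (normX c a1 a2 \<phi>) (normX c a1 a2 (i_calA c a1 a2 \<phi>)) (normX c a1 a2 \<psi>) (normX c a1 a2 (i_calA c a1 a2 \<psi>))"
    have uv: "?u \<in> domA" "?v \<in> domA" using p by (auto simp: dom_calA_def)
    have eq: "J F \<phi> - J F \<psi> = (0, to_H (nemytskii_diff F ?u ?v))"
      using inX[OF p(1)] inX[OF p(2)] by (simp add: J_def J_in_X_def to_H_nemytskii_diff)
    have "normX c a1 a2 (i_calA c a1 a2 (J F \<phi> - J F \<psi>)) = norm (B (to_H (nemytskii_diff F ?u ?v)))"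
      using C(2)[OF uv] by (simp add: eq i_calA_def A_0 normX_zero_right B_minus)
    also have "\<dots> \<le> C (norm ?u) (norm (grad ?u)) (norm ?v) (norm (grad ?v)) * norm (A (?u - ?v))"
      using C(2)[OF uv] by blast
    also have "\<dots> \<le> ?D * norm (A (?u - ?v))"
    proof (rule mult_right_mono)
      have b: "\<kappa> * norm (B (fst \<xi>)) \<le> \<kappa> * normX c a1 a2 \<xi>" for \<xi>
        by (intro mult_left_mono normX_ge kappa_nonneg)
      have "C (norm ?u) (norm (grad ?u)) (norm ?v) (norm (grad ?v))
          \<le> C (\<kappa> * normX c a1 a2 \<phi>) (\<kappa> * normX c a1 a2 \<phi>) (\<kappa> * normX c a1 a2 \<psi>) (\<kappa> * normX c a1 a2 \<psi>)"
        using energy_bounds[OF uv(1)] energy_bounds[OF uv(2)] b[of \<phi>] b[of \<psi>]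
        by (intro C(1)[unfolded incr4_def, rule_format]) auto
      then show "C (norm ?u) (norm (grad ?u)) (norm ?v) (norm (grad ?v)) \<le> ?D" by (simp add: D_def)
    qed simp
    also have "\<dots> \<le> ?D * normX c a1 a2 (i_calA c a1 a2 \<phi> - i_calA c a1 a2 \<psi>)"
      using normX_ge(2)[of "i_calA c a1 a2 \<phi> - i_calA c a1 a2 \<psi>"] uv
      by (intro mult_left_mono) (auto simp: i_calA_def opA_diff D_def)
    finally show ?thesis using C(2)[OF uv] by (simp add: eq dom_calA_def domA_0)
  qed
  ultimately show ?thesis unfolding H1L_def by blast
qed

end

section \<open>Flows of the first-order system: uniqueness and bounds\<close>

locale wave_nonlinearity = wave_system +
  fixes F :: "real \<Rightarrow> real" and L :: real
  assumes F_0: "F 0 = 0" and L_nonneg: "0 \<le> L" and F_lipschitz: "\<bar>F r - F s\<bar> \<le> L * \<bar>r - s\<bar>"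
    and graph: "lipschitz_graph c a1 a2 F"
begin

definition f :: "H \<Rightarrow> H" where "f u = to_H (nemytskii F u)"

lemma in_H_F: "in_H (nemytskii F u)"
  by (rule lipschitz_nemytskii(1)[OF L_nonneg F_lipschitz F_0])

lemma f_lipschitz: "norm (f u - f v) \<le> L * norm (u - v)"
  unfolding f_def by (rule lipschitz_nemytskii(2)[OF L_nonneg F_lipschitz F_0])

lemma f_0: "f 0 = 0" unfolding f_def by (rule nemytskii_zero(2)[where F = F, OF F_0])

lemma nemytskii_diff_f: "to_H (nemytskii_diff F u v) = f u - f v"
  unfolding f_def by (rule to_H_nemytskii_diff(2)[OF in_H_F in_H_F])

lemma f_dB: "u \<in> domA \<Longrightarrow> f u \<in> dB"
proof -
  assume "u \<in> domA"
  then have "to_H (nemytskii_diff F u 0) \<in> dB"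
    using graph domA_0 unfolding lipschitz_graph_def by blast
  then show ?thesis by (simp add: nemytskii_diff_f f_0)
qed

definition rhs :: "H \<times> H \<Rightarrow> H \<times> H" where
  "rhs \<phi> = (snd \<phi>, f (fst \<phi>) - A (fst \<phi>))"

text \<open>Stated through \<open>emb\<close>, so that derivatives in the product norm are
  derivatives in the energy norm. Initial value and continuity of the derivative are kept apart,
  which makes restriction to subsets immediate.\<close>

definition flow_on :: "real set \<Rightarrow> (real \<Rightarrow> H \<times> H) \<Rightarrow> bool" where
  "flow_on I \<phi> \<longleftrightarrow> (\<forall>t\<in>I. \<phi> t \<in> dom_calA c a1 a2 \<and>
     ((\<lambda>s. emb (\<phi> s)) has_vector_derivative emb (rhs (\<phi> t))) (at t within I))"

lemma emb_0: "emb 0 = 0"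
  by (simp only: emb_def fst_zero snd_zero B_0) (simp add: zero_prod_def)

lemma emb_diff: "fst \<phi> \<in> dB \<Longrightarrow> fst \<psi> \<in> dB \<Longrightarrow> emb (\<phi> - \<psi>) = emb \<phi> - emb \<psi>"
  by (simp add: emb_def B_diff)

lemma dom_calA_fst: "\<phi> \<in> dom_calA c a1 a2 \<Longrightarrow> fst \<phi> \<in> dB"
  by (auto simp: dom_calA_def domA_dB)

lemma rhs_fst: "\<phi> \<in> dom_calA c a1 a2 \<Longrightarrow> fst (rhs \<phi>) \<in> dB"
  by (auto simp: dom_calA_def rhs_def)

text \<open>The equation forces the derivative on \<open>I\<close> to be \<open>rhs\<close>, and
  \<open>emb\<close> is linear on the spaces in question, so limits in \<open>normX\<close>
  translate into limits of \<open>emb\<close>.\<close>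

lemma solves_Q_iff: "solves_Q c a1 a2 F \<Phi> I \<phi> \<longleftrightarrow>
    flow_on I \<phi> \<and> continuous_on I (\<lambda>t. emb (rhs (\<phi> t))) \<and> \<phi> 0 = (\<Phi>, 0)"
proof -
  have eqn: "d + i_calA c a1 a2 \<psi> = J F \<psi> \<longleftrightarrow> d = rhs \<psi>" for d \<psi>
  proof -
    have "J F \<psi> - i_calA c a1 a2 \<psi> = rhs \<psi>" by (simp add: J_def i_calA_def rhs_def f_def)
    then show ?thesis by (metis add_diff_cancel_right' diff_add_cancel)
  qed
  have der: "has_derivX c a1 a2 \<phi> (rhs (\<phi> t)) t I \<longleftrightarrow>
      ((\<lambda>s. emb (\<phi> s)) has_vector_derivative emb (rhs (\<phi> t))) (at t within I)"
    if d: "\<And>s. s \<in> I \<Longrightarrow> \<phi> s \<in> dom_calA c a1 a2" and t: "t \<in> I" for t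
  proof -
    have "normX c a1 a2 ((\<phi> s - \<phi> t) /\<^sub>R (s - t) - rhs (\<phi> t))
        = norm ((emb (\<phi> s) - emb (\<phi> t)) /\<^sub>R (s - t) - emb (rhs (\<phi> t)))" if "s \<in> I" for s
    proof -
      note D = dom_calA_fst[OF d[OF that]] dom_calA_fst[OF d[OF t]] rhs_fst[OF d[OF t]]
      have "emb ((\<phi> s - \<phi> t) /\<^sub>R (s - t) - rhs (\<phi> t)) = (emb (\<phi> s) - emb (\<phi> t)) /\<^sub>R (s - t) - emb (rhs (\<phi> t))"
        using D by (simp add: emb_def B_diff B_scaleR dB_diff dB_scaleR)
      then show ?thesis by (simp add: normX_emb)
    qed
    then show ?thesis
      unfolding has_derivX_def has_vector_derivative_iff_quotient
      by (intro filterlim_cong) (auto simp: eventually_at_filter)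
  qed
  have cont: "continuousX c a1 a2 I (\<lambda>t. rhs (\<phi> t)) \<longleftrightarrow> continuous_on I (\<lambda>t. emb (rhs (\<phi> t)))"
    if d: "\<And>s. s \<in> I \<Longrightarrow> \<phi> s \<in> dom_calA c a1 a2"
  proof -
    have "((\<lambda>s. normX c a1 a2 (rhs (\<phi> s) - rhs (\<phi> t))) \<longlongrightarrow> 0) (at t within I) \<longleftrightarrow>
        ((\<lambda>s. emb (rhs (\<phi> s))) \<longlongrightarrow> emb (rhs (\<phi> t))) (at t within I)" if t: "t \<in> I" for t
    proof -
      have "((\<lambda>s. normX c a1 a2 (rhs (\<phi> s) - rhs (\<phi> t))) \<longlongrightarrow> 0) (at t within I) \<longleftrightarrow>
          ((\<lambda>s. norm (emb (rhs (\<phi> s)) - emb (rhs (\<phi> t)))) \<longlongrightarrow> 0) (at t within I)"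
        by (intro filterlim_cong)
          (use d t in \<open>auto simp: eventually_at_filter normX_emb emb_diff rhs_fst\<close>)
      then show ?thesis by (simp add: tendsto_norm_zero_iff LIM_zero_iff)
    qed
    then show ?thesis by (simp add: continuousX_def continuous_on_def)
  qed
  show ?thesis
  proof
    assume "solves_Q c a1 a2 F \<Phi> I \<phi>"
    then obtain \<phi>' where s: "\<And>t. t \<in> I \<Longrightarrow> \<phi> t \<in> dom_calA c a1 a2" "\<And>t. t \<in> I \<Longrightarrow> \<phi>' t = rhs (\<phi> t)"
      "\<And>t. t \<in> I \<Longrightarrow> has_derivX c a1 a2 \<phi> (\<phi>' t) t I" "continuousX c a1 a2 I \<phi>'" "\<phi> 0 = (\<Phi>, 0)"
      unfolding solves_Q_def eqn by blast
    have "continuousX c a1 a2 I (\<lambda>t. rhs (\<phi> t))"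
      unfolding continuousX_def
    proof
      fix t assume t: "t \<in> I"
      have "((\<lambda>s. normX c a1 a2 (\<phi>' s - \<phi>' t)) \<longlongrightarrow> 0) (at t within I)"
        using s(4) t by (simp add: continuousX_def)
      then show "((\<lambda>s. normX c a1 a2 (rhs (\<phi> s) - rhs (\<phi> t))) \<longlongrightarrow> 0) (at t within I)"
        by (rule Lim_transform_eventually) (use s(2) t in \<open>auto simp: eventually_at_filter\<close>)
    qed
    then show "flow_on I \<phi> \<and> continuous_on I (\<lambda>t. emb (rhs (\<phi> t))) \<and> \<phi> 0 = (\<Phi>, 0)"
      using s der[OF s(1)] cont[OF s(1)] by (simp add: flow_on_def)
  next
    assume a: "flow_on I \<phi> \<and> continuous_on I (\<lambda>t. emb (rhs (\<phi> t))) \<and> \<phi> 0 = (\<Phi>, 0)"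
    then have d: "\<And>t. t \<in> I \<Longrightarrow> \<phi> t \<in> dom_calA c a1 a2" by (simp add: flow_on_def)
    show "solves_Q c a1 a2 F \<Phi> I \<phi>"
      unfolding solves_Q_def eqn
      using a d der[OF d] cont[OF d]
      by (intro exI[of _ "\<lambda>t. rhs (\<phi> t)"])
        (auto simp: flow_on_def J_in_X_def in_H_F spaceX_def mem_Times_iff rhs_fst)
  qed
qed

text \<open>Applying the bounded \<open>S\<close> to the first component of \<open>emb\<close>
  undoes \<open>B\<close> and turns differentiability in the energy norm into differentiability in
  \<open>H\<close>.\<close>

lemma flow_derivs:
  assumes "flow_on I \<phi>" "t \<in> I"
  shows "((\<lambda>s. fst (\<phi> s)) has_vector_derivative snd (\<phi> t)) (at t within I)"
    and "((\<lambda>s. snd (\<phi> s)) has_vector_derivative f (fst (\<phi> t)) - A (fst (\<phi> t))) (at t within I)"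
proof -
  have d: "\<And>t. t \<in> I \<Longrightarrow> \<phi> t \<in> dom_calA c a1 a2"
    and x: "((\<lambda>s. emb (\<phi> s)) has_vector_derivative emb (rhs (\<phi> t))) (at t within I)"
    using assms by (auto simp: flow_on_def)
  have D: "((\<lambda>s. S (fst (emb (\<phi> s)))) has_vector_derivative S (fst (emb (rhs (\<phi> t))))) (at t within I)"
    by (rule S.has_vector_derivative[OF bounded_linear.has_vector_derivative[OF bounded_linear_fst x]])
  have eq: "S (fst (emb (rhs (\<phi> t)))) = snd (\<phi> t)"
    using d[OF assms(2)] by (auto simp: emb_def rhs_def S_B dom_calA_def)
  have "fst (\<phi> s) = S (fst (emb (\<phi> s)))" if "s \<in> I" for s
    using S_B[OF dom_calA_fst[OF d[OF that]]] by (simp add: emb_def)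
  from has_vector_derivative_transform[OF assms(2) this D]
  show "((\<lambda>s. fst (\<phi> s)) has_vector_derivative snd (\<phi> t)) (at t within I)" unfolding eq .
  show "((\<lambda>s. snd (\<phi> s)) has_vector_derivative f (fst (\<phi> t)) - A (fst (\<phi> t))) (at t within I)"
    using bounded_linear.has_vector_derivative[OF bounded_linear_snd x] by (simp add: emb_def rhs_def)
qed

lemma solves_Q_imp_solves_P:
  assumes "solves_Q c a1 a2 F \<Phi> I \<phi>" shows "solves_P c a1 a2 F \<Phi> I (\<lambda>t. fst (\<phi> t))"
proof -
  have s: "flow_on I \<phi>" "continuous_on I (\<lambda>t. emb (rhs (\<phi> t)))" "\<phi> 0 = (\<Phi>, 0)"
    using assms by (auto simp: solves_Q_iff)
  have "continuous_on I (\<lambda>t. f (fst (\<phi> t)) - A (fst (\<phi> t)))"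
    using continuous_on_snd[OF s(2)] by (simp add: emb_def rhs_def)
  moreover have "fst (\<phi> t) \<in> domA" if "t \<in> I" for t using s(1) that by (auto simp: flow_on_def dom_calA_def)
  ultimately show ?thesis
    unfolding solves_P_def using s flow_derivs[OF s(1)]
    by (intro exI[of _ "\<lambda>t. snd (\<phi> t)"] exI[of _ "\<lambda>t. f (fst (\<phi> t)) - A (fst (\<phi> t))"])
      (auto simp: in_H_F f_def[symmetric])
qed

text \<open>\<open>L\<close> times a bound for \<open>S\<close>: as \<open>u = S (B u)\<close>, this
  is a Lipschitz constant of the nonlinearity measured in the energy norm.\<close>

definition growth :: real where "growth = L * (SOME k. 0 < k \<and> (\<forall>x. norm (S x) \<le> norm x * k))"

lemma growth: "0 \<le> growth" "L * norm (S x) \<le> growth * norm x"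
proof -
  define k where "k = (SOME k. 0 < k \<and> (\<forall>x. norm (S x) \<le> norm x * k))"
  have "0 < k \<and> (\<forall>x. norm (S x) \<le> norm x * k)"
    unfolding k_def by (rule someI_ex) (use S.pos_bounded in blast)
  then have k: "0 < k" "norm (S x) \<le> norm x * k" for x by blast+
  show "0 \<le> growth" unfolding growth_def k_def[symmetric] using k(1) L_nonneg by simp
  show "L * norm (S x) \<le> growth * norm x"
    unfolding growth_def k_def[symmetric] using mult_left_mono[OF k(2) L_nonneg, of x] by (simp add: mult_ac)
qed

text \<open>The generator is skew-symmetric in the energy inner product, so only the
  Lipschitz nonlinearity contributes to the distance of two flows.\<close>

lemma flow_distance:
  assumes "0 \<le> t" "flow_on I \<phi>" "flow_on I \<psi>" "{0..t} \<subseteq> I"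
  shows "norm (emb (\<phi> t) - emb (\<psi> t)) \<le> exp (growth * t) * norm (emb (\<phi> 0) - emb (\<psi> 0))"
proof (rule gronwall_norm_linear[OF assms(1) growth(1)])
  fix s assume "s \<in> {0..t}"
  then have s: "s \<in> I" using assms by auto
  show "((\<lambda>s. emb (\<phi> s) - emb (\<psi> s)) has_vector_derivative emb (rhs (\<phi> s)) - emb (rhs (\<psi> s))) (at s within {0..t})"
    using assms s unfolding flow_on_def
    by (intro has_vector_derivative_diff) (auto intro: has_vector_derivative_within_subset)
  have "\<phi> s \<in> dom_calA c a1 a2" "\<psi> s \<in> dom_calA c a1 a2" using assms s by (auto simp: flow_on_def)
  then have d: "fst (\<phi> s) \<in> domA" "fst (\<psi> s) \<in> domA" "snd (\<phi> s) \<in> dB" "snd (\<psi> s) \<in> dB"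
    by (auto simp: dom_calA_def)
  define u v g where "u = fst (\<phi> s) - fst (\<psi> s)" and "v = snd (\<phi> s) - snd (\<psi> s)"
    and "g = f (fst (\<phi> s)) - f (fst (\<psi> s))"
  have u: "u \<in> domA" and v: "v \<in> dB" using d by (auto simp: u_def v_def domA_diff dB_diff)
  have x: "emb (\<phi> s) - emb (\<psi> s) = (B u, v)"
    using d by (simp add: emb_def u_def v_def B_diff domA_dB)
  have x': "emb (rhs (\<phi> s)) - emb (rhs (\<psi> s)) = (B v, g - A u)"
    using d by (simp add: emb_def rhs_def u_def v_def g_def B_diff opA_diff algebra_simps)
  have "inner (A u) v = inner (A u) (S (B v))" by (simp add: S_B[OF v])
  also have "\<dots> = inner (B u) (B v)" by (simp add: S_sym[symmetric] B_domA[OF u])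
  finally have "inner (emb (rhs (\<phi> s)) - emb (rhs (\<psi> s))) (emb (\<phi> s) - emb (\<psi> s)) = inner g v"
    unfolding x x' by (simp add: inner_diff_left) (simp add: inner_commute)
  also have "\<dots> \<le> norm g * norm v" by (rule norm_cauchy_schwarz)
  also have "\<dots> \<le> (growth * norm (B u)) * norm v"
  proof (rule mult_right_mono)
    have "norm g \<le> L * norm u" unfolding g_def u_def by (rule f_lipschitz)
    then show "norm g \<le> growth * norm (B u)" using growth(2)[of "B u"] by (simp add: S_B[OF domA_dB[OF u]])
  qed simp
  also have "\<dots> \<le> growth * norm (B u, v) * norm (B u, v)"
    using norm_fst_bound[of "(B u, v)"] norm_snd_bound[of "(B u, v)"] growth(1)
    by (intro mult_mono mult_left_mono) auto
  finally show "inner (emb (rhs (\<phi> s)) - emb (rhs (\<psi> s))) (emb (\<phi> s) - emb (\<psi> s))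
      \<le> growth * (norm (emb (\<phi> s) - emb (\<psi> s)))\<^sup>2"
    unfolding x by (simp add: power2_eq_square mult.assoc)
qed

lemma flow_unique:
  assumes "0 \<le> t" "flow_on I \<phi>" "flow_on I \<psi>" "{0..t} \<subseteq> I" "\<phi> 0 = \<psi> 0"
  shows "\<phi> t = \<psi> t"
proof -
  have "emb (\<phi> t) = emb (\<psi> t)" using flow_distance[OF assms(1-4)] assms(5) by simp
  then have e: "B (fst (\<phi> t)) = B (fst (\<psi> t))" "snd (\<phi> t) = snd (\<psi> t)" by (simp_all add: emb_def)
  have "t \<in> I" using assms(1,4) by auto
  then have "fst (\<phi> t) \<in> dB" "fst (\<psi> t) \<in> dB"
    using assms(2,3) dom_calA_fst by (simp_all add: flow_on_def)
  then have "fst (\<phi> t) = fst (\<psi> t)" using S_B e(1) by metis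
  then show ?thesis using e(2) by (rule prod_eqI)
qed

lemma flow_zero: "flow_on I (\<lambda>_. 0)"
proof -
  have "rhs 0 = 0" by (simp only: rhs_def fst_zero snd_zero f_0 A_0 diff_self) (simp add: zero_prod_def)
  moreover have "0 \<in> dom_calA c a1 a2" using domA_0 dB_0 by (simp add: dom_calA_def mem_Times_iff)
  moreover note emb_0
  ultimately show ?thesis by (simp add: flow_on_def)
qed

lemma flow_subset: "flow_on I \<phi> \<Longrightarrow> K \<subseteq> I \<Longrightarrow> flow_on K \<phi>"
  unfolding flow_on_def by (blast intro: has_vector_derivative_within_subset)

text \<open>The solution is compared with the zero flow, which exists because
  \<open>F 0 = 0\<close>.\<close>

lemma flow_bounded:
  assumes "flow_on {0..<T} \<phi>"
  shows "\<exists>M. \<forall>t\<in>{0..<T}. normX c a1 a2 (\<phi> t) \<le> M"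
proof (intro exI ballI)
  fix t assume t: "t \<in> {0..<T}"
  have "norm (emb (\<phi> t) - emb 0) \<le> exp (growth * t) * norm (emb (\<phi> 0) - emb 0)"
    by (rule flow_distance[OF _ assms flow_zero]) (use t in auto)
  moreover have "exp (growth * t) * norm (emb (\<phi> 0)) \<le> exp (growth * T) * norm (emb (\<phi> 0))"
    using t growth(1) by (intro mult_right_mono) (auto intro: mult_left_mono)
  ultimately show "normX c a1 a2 (\<phi> t) \<le> exp (growth * T) * norm (emb (\<phi> 0))" by (simp add: normX_emb emb_0)
qed

section \<open>Existence of flows\<close>

definition R :: "H \<times> H \<Rightarrow> H \<times> H" where "R y = (- S (snd y), S (fst y))"

lemma skew_inverse_R: "skew_inverse R"
proof (rule skew_inverse.intro)
  show "bounded_linear R" unfolding R_def[abs_def]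
    by (intro bounded_linear_Pair bounded_linear_minus bounded_linear_compose[OF bounded_linear_S]
        bounded_linear_fst bounded_linear_snd)
  show "inner (R x) y = - inner x (R y)" for x y
  proof -
    have "inner z w = inner (fst z) (fst w) + inner (snd z) (snd w)" for z w :: "H \<times> H"
      by (rule inner_prod_def)
    then show ?thesis
      by (simp only: R_def fst_conv snd_conv inner_minus_left inner_minus_right S_sym)
  qed
  show "x = 0" if "R x = 0" for x
  proof (rule prod_eqI)
    have "fst (R x) = 0" "snd (R x) = 0" by (simp_all only: that fst_zero snd_zero)
    then have "S (snd x) = 0" "S (fst x) = 0" by (simp_all only: R_def fst_conv snd_conv neg_equal_0_iff_equal)
    then show "fst x = fst 0" "snd x = snd 0" by (simp_all only: S_0 fst_zero snd_zero)
  qed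
qed

sublocale R: skew_inverse R by (rule skew_inverse_R)

text \<open>This is \<open>K (j (R y))\<close> with \<open>j (p, q) = (0, f (S p))\<close> and
  \<open>K (p, q) = (B q, - B p)\<close>: the first component of \<open>R y\<close> is
  \<open>- S (snd y)\<close>, which \<open>S\<close> maps to \<open>- Q (snd y)\<close>. That
  element lies in \<open>domA\<close>, so \<open>B\<close> may be applied to its image under
  \<open>f\<close>.\<close>

definition N :: "H \<times> H \<Rightarrow> H \<times> H" where "N y = (B (f (- Q (snd y))), 0)"

lemma minus_Q_domA: "- Q h \<in> domA"
  using domA_diff[OF domA_0 Q_domA] by simp

lemma A_minus_Q: "A (- Q h) = - h"
  using opA_diff[OF domA_0 Q_domA, of c a1 a2 h] by (simp add: A_0 A_Q)

lemma B_minus_Q: "B (- Q h) = - S h"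
  by (simp add: B_domA[OF minus_Q_domA] A_minus_Q S.neg)

lemma R_N: "R (N y) = (0, f (- Q (snd y)))"
  by (simp add: R_def N_def S.zero S_B f_dB minus_Q_domA)

text \<open>With \<open>u = - Q (snd y)\<close> one has \<open>A u = - snd y\<close>, so distances
  of \<open>y\<close> dominate distances in the graph norm, while a bound on \<open>R y\<close>
  bounds the energy of \<open>u\<close> and thereby all arguments of \<open>C\<close>.\<close>

lemma N_local_lipschitz:
  "\<exists>K. \<forall>y z. norm (R y) \<le> \<rho> \<longrightarrow> norm (R z) \<le> \<rho> \<longrightarrow> norm (N y - N z) \<le> K * norm (y - z)"
proof -
  obtain C where C: "incr4 C" "\<And>u v. u \<in> domA \<Longrightarrow> v \<in> domA \<Longrightarrow>
     norm (B (to_H (nemytskii_diff F u v))) \<le> C (norm u) (norm (grad u)) (norm v) (norm (grad v)) * norm (A (u - v))"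
    using graph unfolding lipschitz_graph_def by blast
  define r where "r = \<kappa> * \<rho>"
  have "norm (N y - N z) \<le> max 0 (C r r r r) * norm (y - z)" if "norm (R y) \<le> \<rho>" "norm (R z) \<le> \<rho>" for y z
  proof -
    define u v where "u = - Q (snd y)" and "v = - Q (snd z)"
    have uv: "u \<in> domA" "v \<in> domA" by (simp_all add: u_def v_def minus_Q_domA)
    have small: "norm (- Q (snd w)) \<le> r" "norm (grad (- Q (snd w))) \<le> r" if "norm (R w) \<le> \<rho>" for w
    proof -
      have "norm (B (- Q (snd w))) \<le> \<rho>"
        using norm_fst_bound[of "R w"] that by (simp add: B_minus_Q R_def)
      then have "\<kappa> * norm (B (- Q (snd w))) \<le> r" unfolding r_def by (rule mult_left_mono[OF _ kappa_nonneg])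
      then show "norm (- Q (snd w)) \<le> r" "norm (grad (- Q (snd w))) \<le> r"
        using energy_bounds[OF minus_Q_domA, of "snd w"] by linarith+
    qed
    have "norm (N y - N z) = norm (B (to_H (nemytskii_diff F u v)))"
      using uv by (simp add: N_def u_def[symmetric] v_def[symmetric] nemytskii_diff_f B_diff f_dB norm_Pair)
    also have "\<dots> \<le> C (norm u) (norm (grad u)) (norm v) (norm (grad v)) * norm (A (u - v))" by (rule C(2)[OF uv])
    also have "\<dots> \<le> max 0 (C r r r r) * norm (y - z)"
    proof (rule mult_mono)
      have "C (norm u) (norm (grad u)) (norm v) (norm (grad v)) \<le> C r r r r"
        using small[OF that(1)] small[OF that(2)]
        by (intro C(1)[unfolded incr4_def, rule_format]) (auto simp: u_def v_def)
      then show "C (norm u) (norm (grad u)) (norm v) (norm (grad v)) \<le> max 0 (C r r r r)" by simp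
      have "A (u - v) = - snd (y - z)" using uv by (simp add: opA_diff) (simp add: u_def v_def A_minus_Q)
      then show "norm (A (u - v)) \<le> norm (y - z)" using norm_snd_bound[of "y - z"] by (simp add: norm_minus_commute)
    qed auto
    finally show ?thesis .
  qed
  then show ?thesis by blast
qed

text \<open>Here the global Lipschitz constant of \<open>F\<close> enters, so the rate holds for
  energies of any size; it serves as \<open>L0\<close> in \<open>local_evolution\<close>.\<close>

lemma R_N_bound: "norm (R (N y)) \<le> growth * norm (R y)"
proof -
  have "norm (R (N y)) = norm (f (- Q (snd y)))" by (simp add: R_N norm_Pair)
  also have "\<dots> \<le> L * norm (- Q (snd y))" using f_lipschitz[of "- Q (snd y)" 0] by (simp add: f_0)
  also have "\<dots> = L * norm (S (- S (snd y)))" by (simp add: S.neg S_S)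
  also have "\<dots> \<le> growth * norm (- S (snd y))" by (rule growth(2))
  also have "\<dots> \<le> growth * norm (R y)"
    using norm_fst_bound[of "R y"] growth(1) by (intro mult_left_mono) (auto simp: R_def)
  finally show ?thesis .
qed

lemma flow_exists:
  assumes "\<Phi> \<in> domA" "0 \<le> T"
  obtains \<phi> where "flow_on {0..T} \<phi>" "continuous_on {0..T} (\<lambda>t. emb (rhs (\<phi> t)))" "\<phi> 0 = (\<Phi>, 0)"
proof -
  \<comment> \<open>The initial value is chosen so that
    \<open>R (0, - A \<Phi>) = (B \<Phi>, 0)\<close>, the image of \<open>(\<Phi>, 0)\<close> under
    \<open>emb\<close>.\<close>
  obtain y where y: "continuous_on {0..T} y" "y 0 = (0, - A \<Phi>)"
    "\<And>t. t \<in> {0..T} \<Longrightarrow> ((\<lambda>t. R (y t)) has_vector_derivative y t + R (N (y t))) (at t within {0..T})"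
    by (rule R.local_evolution[OF N_local_lipschitz assms(2) growth(1) R_N_bound, where ?y0.0 = "(0, - A \<Phi>)"])
      (rule that)
  \<comment> \<open>The preimage of \<open>R (y t)\<close> under \<open>emb\<close>.\<close>
  define \<phi> where "\<phi> t = (- Q (snd (y t)), S (fst (y t)))" for t
  have e: "emb (\<phi> t) = R (y t)" for t by (simp add: emb_def \<phi>_def R_def B_minus_Q)
  have e': "emb (rhs (\<phi> t)) = y t + R (N (y t))" for t
    by (simp add: emb_def rhs_def \<phi>_def R_N A_minus_Q prod_eq_iff)
  have "\<phi> t \<in> dom_calA c a1 a2" for t by (simp add: \<phi>_def dom_calA_def minus_Q_domA)
  then have 1: "flow_on {0..T} \<phi>" using y(3) by (simp add: flow_on_def e e')
  have "continuous_on {0..T} (\<lambda>t. f (- Q (snd (y t))))"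
  proof -
    have cf: "continuous_on UNIV f"
      by (rule lipschitz_on_continuous_on[of L]) (use f_lipschitz L_nonneg in \<open>auto simp: lipschitz_on_def dist_norm\<close>)
    have "continuous_on {0..T} (\<lambda>t. - S (S (snd (y t))))"
      by (intro continuous_intros S.continuous_on y(1))
    then have "continuous_on {0..T} (\<lambda>t. f (- S (S (snd (y t)))))"
      by (rule continuous_on_compose2[OF cf]) auto
    then show ?thesis by (simp add: S_S)
  qed
  then have 2: "continuous_on {0..T} (\<lambda>t. emb (rhs (\<phi> t)))"
    unfolding e' R_N by (intro continuous_intros y(1))
  have 3: "\<phi> 0 = (\<Phi>, 0)"
    using y(2) assms(1) S_S[symmetric] by (simp add: \<phi>_def S.zero S.neg) (simp add: S_S Q_A)
  show ?thesis by (rule that[OF 1 2 3])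
qed

text \<open>Flows exist on \<open>{0..n}\<close> for every \<open>n\<close> and agree on common
  intervals by uniqueness, so they glue together.\<close>

lemma global_flow_exists:
  assumes "\<Phi> \<in> domA"
  obtains \<phi> where "flow_on {0..} \<phi>" "continuous_on {0..} (\<lambda>t. emb (rhs (\<phi> t)))" "\<phi> 0 = (\<Phi>, 0)"
proof -
  have "\<exists>\<phi>. flow_on {0..real n} \<phi> \<and> continuous_on {0..real n} (\<lambda>t. emb (rhs (\<phi> t))) \<and> \<phi> 0 = (\<Phi>, 0)" for n
    using flow_exists[OF assms, of "real n"] by (metis of_nat_0_le_iff)
  then obtain p where p: "\<And>n. flow_on {0..real n} (p n)"
    "\<And>n. continuous_on {0..real n} (\<lambda>t. emb (rhs (p n t)))" "\<And>n. p n 0 = (\<Phi>, 0)" by metis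
  define \<phi> where "\<phi> t = p (nat \<lceil>t\<rceil>) t" for t
  have eq: "\<phi> t = p n t" if "0 \<le> t" "t \<le> real n" for t n
  proof -
    define m where "m = nat \<lceil>t\<rceil>"
    have m: "t \<le> real m" by (simp add: m_def real_nat_ceiling_ge)
    have "flow_on {0..t} (p m)" "flow_on {0..t} (p n)" using m that by (auto intro: flow_subset[OF p(1)])
    from flow_unique[OF that(1) this] show ?thesis by (simp add: p(3) \<phi>_def m_def)
  qed
  have ex: "\<exists>n. t < real n" for t using reals_Archimedean2 .
  show ?thesis
  proof (rule that)
    show "flow_on {0..} \<phi>"
      unfolding flow_on_def
    proof (intro ballI)
      fix t :: real assume "t \<in> {0..}"
      then have t: "0 \<le> t" by simp
      \<comment> \<open>Strict, so that \<open>{0..n}\<close> is a neighbourhood of \<open>t\<close>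
        in the ray and the derivative there is the derivative on the ray.\<close>
      obtain n where n: "t < real n" using ex by blast
      have tn: "t \<in> {0..real n}" using t n by simp
      have D: "((\<lambda>s. emb (p n s)) has_vector_derivative emb (rhs (p n t))) (at t within {0..real n})"
        using p(1)[of n] tn unfolding flow_on_def by blast
      have "emb (\<phi> s) = emb (p n s)" if "s \<in> {0..real n}" for s using eq[of s n] that by simp
      from has_vector_derivative_transform[OF tn this D]
      have "((\<lambda>s. emb (\<phi> s)) has_vector_derivative emb (rhs (p n t))) (at t within {0..real n})" .
      moreover have "p n t \<in> dom_calA c a1 a2" using p(1)[of n] tn unfolding flow_on_def by blast
      ultimately show "\<phi> t \<in> dom_calA c a1 a2 \<and> ((\<lambda>s. emb (\<phi> s)) has_vector_derivative emb (rhs (\<phi> t))) (at t within {0..})"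
        using eq[OF t less_imp_le[OF n]] at_within_ray[OF t n] by simp
    qed
    show "continuous_on {0..} (\<lambda>t. emb (rhs (\<phi> t)))"
      unfolding continuous_on_eq_continuous_within
    proof
      fix t :: real assume "t \<in> {0..}"
      then have t: "0 \<le> t" by simp
      obtain n where n: "t < real n" using ex by blast
      have "continuous_on {0..real n} (\<lambda>t. emb (rhs (p n t))) \<longleftrightarrow> continuous_on {0..real n} (\<lambda>t. emb (rhs (\<phi> t)))"
        by (rule continuous_on_cong) (use eq in auto)
      then have "continuous_on {0..real n} (\<lambda>t. emb (rhs (\<phi> t)))" using p(2) by simp
      then have "continuous (at t within {0..real n}) (\<lambda>t. emb (rhs (\<phi> t)))"
        unfolding continuous_on_eq_continuous_within using t n by simp
      then show "continuous (at t within {0..}) (\<lambda>t. emb (rhs (\<phi> t)))"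
        using at_within_ray[OF t n] by simp
    qed
    show "\<phi> 0 = (\<Phi>, 0)" using eq[of 0 0] p(3) by simp
  qed
qed

text \<open>The global flow restricted to a short interval provides a local solution, and
  \<open>flow_unique\<close> shows that every local solution is such a restriction.\<close>

lemma well_posed:
  assumes "\<Phi> \<in> domA"
  shows "(\<exists>T>0. \<exists>\<phi>. solves_Q c a1 a2 F \<Phi> {0..<T} \<phi>) \<and>
         (\<forall>T>0. \<forall>\<phi>. solves_Q c a1 a2 F \<Phi> {0..<T} \<phi> \<longrightarrow>
            solves_P c a1 a2 F \<Phi> {0..<T} (\<lambda>t. fst (\<phi> t)) \<and>
            (\<forall>t\<in>{0..<T}. ((\<lambda>s. fst (\<phi> s)) has_vector_derivative snd (\<phi> t)) (at t within {0..<T})) \<and>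
            (\<exists>M. \<forall>t\<in>{0..<T}. normX c a1 a2 (\<phi> t) \<le> M)) \<and>
         (\<exists>\<phi>. solves_Q c a1 a2 F \<Phi> {0..} \<phi> \<and>
            solves_P c a1 a2 F \<Phi> {0..} (\<lambda>t. fst (\<phi> t)) \<and>
            (\<forall>t\<ge>0. ((\<lambda>s. fst (\<phi> s)) has_vector_derivative snd (\<phi> t)) (at t within {0..})) \<and>
            (\<forall>T>0. \<forall>\<psi>. solves_Q c a1 a2 F \<Phi> {0..<T} \<psi> \<longrightarrow> (\<forall>t\<in>{0..<T}. \<psi> t = \<phi> t)))"
proof -
  obtain \<phi> where \<phi>: "flow_on {0..} \<phi>" "continuous_on {0..} (\<lambda>t. emb (rhs (\<phi> t)))" "\<phi> 0 = (\<Phi>, 0)"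
    using global_flow_exists[OF assms] by blast
  have sub: "{0..<1} \<subseteq> {0::real..}" by auto
  have Q1: "solves_Q c a1 a2 F \<Phi> {0..<1} \<phi>"
    unfolding solves_Q_iff using flow_subset[OF \<phi>(1) sub] continuous_on_subset[OF \<phi>(2) sub] \<phi>(3) by blast
  have Qg: "solves_Q c a1 a2 F \<Phi> {0..} \<phi>" unfolding solves_Q_iff using \<phi> by blast
  have uniq: "\<psi> t = \<phi> t" if "solves_Q c a1 a2 F \<Phi> {0..<T} \<psi>" "t \<in> {0..<T}" for T \<psi> t
  proof (rule flow_unique)
    show "0 \<le> t" "{0..t} \<subseteq> {0..<T}" using that(2) by auto
    show "flow_on {0..<T} \<psi>" "\<psi> 0 = \<phi> 0" using that(1) \<phi>(3) by (auto simp: solves_Q_iff)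
    show "flow_on {0..<T} \<phi>" by (rule flow_subset[OF \<phi>(1)]) auto
  qed
  show ?thesis
  proof (intro conjI allI impI)
    show "\<exists>T>0. \<exists>\<phi>. solves_Q c a1 a2 F \<Phi> {0..<T} \<phi>" using Q1 zero_less_one by blast
    show "\<exists>\<phi>. solves_Q c a1 a2 F \<Phi> {0..} \<phi> \<and> solves_P c a1 a2 F \<Phi> {0..} (\<lambda>t. fst (\<phi> t)) \<and>
        (\<forall>t\<ge>0. ((\<lambda>s. fst (\<phi> s)) has_vector_derivative snd (\<phi> t)) (at t within {0..})) \<and>
        (\<forall>T>0. \<forall>\<psi>. solves_Q c a1 a2 F \<Phi> {0..<T} \<psi> \<longrightarrow> (\<forall>t\<in>{0..<T}. \<psi> t = \<phi> t))"
      using Qg solves_Q_imp_solves_P[OF Qg] flow_derivs(1)[OF \<phi>(1)] uniq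
      by (intro exI[of _ \<phi>] conjI) auto
    fix T :: real and \<psi> assume "0 < T" and s: "solves_Q c a1 a2 F \<Phi> {0..<T} \<psi>"
    then have fl: "flow_on {0..<T} \<psi>" by (simp add: solves_Q_iff)
    show "solves_P c a1 a2 F \<Phi> {0..<T} (\<lambda>t. fst (\<psi> t))" by (rule solves_Q_imp_solves_P[OF s])
    show "\<forall>t\<in>{0..<T}. ((\<lambda>s. fst (\<psi> s)) has_vector_derivative snd (\<psi> t)) (at t within {0..<T})"
      using flow_derivs(1)[OF fl] by blast
    show "\<exists>M. \<forall>t\<in>{0..<T}. normX c a1 a2 (\<psi> t) \<le> M" by (rule flow_bounded[OF fl])
  qed
qed

end

text \<open>The graph of the operator is written as the pairs \<open>(Q h, h)\<close>, the shape to
  which \<open>op_sqrt_eq\<close> applies.\<close>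

lemma wave_system_exists:
  assumes "0 < c" "0 < a1" "0 < a2"
  obtains Q S where "wave_system c a1 a2 Q S"
proof -
  obtain Q where Q: "bounded_linear Q" "\<And>x y. inner (Q x) y = inner x (Q y)"
    "\<And>x. min a1 a2 * (norm (Q x))\<^sup>2 \<le> inner (Q x) x"
    "\<And>h. Q h \<in> domA" "\<And>h. opA c a1 a2 (Q h) = h" "\<And>v. v \<in> domA \<Longrightarrow> Q (opA c a1 a2 v) = v"
    by (rule inverse_opA[OF assms]) (rule that)
  have m: "0 < min a1 a2" using assms by simp
  obtain S where S: "bounded_linear S" "\<And>x y. inner (S x) y = inner x (S y)" "\<And>x. 0 \<le> inner (S x) x"
    "\<And>x. S (S x) = Q x" "\<And>P x. bounded_linear P \<Longrightarrow> (\<And>x. P (Q x) = Q (P x)) \<Longrightarrow> P (S x) = S (P x)"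
    by (rule operator_sqrt[OF Q(1,2) m Q(3)]) (rule that, assumption+, blast)
  have inj: "x = 0" if "Q x = 0" for x
  proof -
    have "opA c a1 a2 0 = 0"
      using opA_scaleR[OF Q(4)[of 0], of c a1 a2 0] by simp
    then show ?thesis using Q(5)[of x] that by simp
  qed
  have "graphA c a1 a2 = range (\<lambda>h. (Q h, h))"
  proof (intro set_eqI iffI)
    fix z assume "z \<in> graphA c a1 a2"
    then obtain v where v: "v \<in> domA" "z = (v, opA c a1 a2 v)" unfolding graphA_def by blast
    then show "z \<in> range (\<lambda>h. (Q h, h))" by (intro range_eqI[of _ _ "opA c a1 a2 v"]) (simp only: Q(6))
  next
    fix z assume "z \<in> range (\<lambda>h. (Q h, h))"
    then obtain h where "z = (Q h, opA c a1 a2 (Q h))" by (auto simp only: Q(5))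
    then show "z \<in> graphA c a1 a2" unfolding graphA_def using Q(4) by blast
  qed
  moreover have "op_sqrt (range (\<lambda>h. (Q h, h))) = range (\<lambda>h. (S h, h))"
  proof (rule op_sqrt_eq[OF S(1-4)])
    show "P (S x) = S (P x)" if "bounded_linear P" "\<And>x. P (Q x) = Q (P x)" for P x
      using that by (rule S(5))
    show "x = 0" if "Q x = 0" for x using that by (rule inj)
  qed
  ultimately have "op_sqrt (graphA c a1 a2) = range (\<lambda>h. (S h, h))" by (simp only:)
  then have "wave_system c a1 a2 Q S"
    by (intro wave_system.intro assms Q(4-6) S(1,2,4))
  then show ?thesis by (rule that)
qed

theorem proposition1:
  fixes c a1 a2 :: real and F :: "real \<Rightarrow> real"
  assumes "c > 0" and "a1 > 0" and "a2 > 0" and "a2 > a1"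
  shows
    "(J_zero F \<and> H0L c a1 a2 F \<and> H1L c a1 a2 F \<longrightarrow> F 0 = 0)
   \<and> (F 0 = 0 \<and> lipschitz_energy c a1 a2 F \<and> lipschitz_graph c a1 a2 F \<longrightarrow>
        J_zero F \<and> H0L c a1 a2 F \<and> H1L c a1 a2 F)
   \<and> (F 0 = 0 \<and> lipschitz_energy c a1 a2 F \<and> lipschitz_graph c a1 a2 F \<and>
      continuous_on UNIV F \<and> lipschitz_H F \<and>
      (\<forall>w. primitive F w \<le> 0) \<and>
      (\<forall>\<Omega> f. open \<Omega> \<and> is_interval \<Omega> \<and> sobolev2 \<Omega> f \<longrightarrow>
         integrable (lebesgue_on \<Omega>) (\<lambda>x. primitive F (f x))) \<longrightarrow>
      (\<forall>\<Phi>\<in>domA.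
         (\<exists>T>0. \<exists>\<phi>. solves_Q c a1 a2 F \<Phi> {0..<T} \<phi>) \<and>
         (\<forall>T>0. \<forall>\<phi>. solves_Q c a1 a2 F \<Phi> {0..<T} \<phi> \<longrightarrow>
            solves_P c a1 a2 F \<Phi> {0..<T} (\<lambda>t. fst (\<phi> t)) \<and>
            (\<forall>t\<in>{0..<T}. ((\<lambda>s. fst (\<phi> s)) has_vector_derivative snd (\<phi> t)) (at t within {0..<T})) \<and>
            (\<exists>M. \<forall>t\<in>{0..<T}. normX c a1 a2 (\<phi> t) \<le> M)) \<and>
         (\<exists>\<phi>. solves_Q c a1 a2 F \<Phi> {0..} \<phi> \<and>
            solves_P c a1 a2 F \<Phi> {0..} (\<lambda>t. fst (\<phi> t)) \<and>
            (\<forall>t\<ge>0. ((\<lambda>s. fst (\<phi> s)) has_vector_derivative snd (\<phi> t)) (at t within {0..})) \<and>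
            (\<forall>T>0. \<forall>\<psi>. solves_Q c a1 a2 F \<Phi> {0..<T} \<psi> \<longrightarrow> (\<forall>t\<in>{0..<T}. \<psi> t = \<phi> t)))))"
proof -
  obtain Q S where "wave_system c a1 a2 Q S" using wave_system_exists[OF assms(1-3)] .
  then interpret wave_system c a1 a2 Q S .
  show ?thesis
  proof (intro conjI impI ballI)
    assume "J_zero F \<and> H0L c a1 a2 F \<and> H1L c a1 a2 F"
    then show "F 0 = 0" using J_zero_imp by blast
  next
    assume h: "F 0 = 0 \<and> lipschitz_energy c a1 a2 F \<and> lipschitz_graph c a1 a2 F"
    show "J_zero F" using nemytskii_zero[of F] h by (simp add: J_zero_def J_in_X_def J_def zero_prod_def)
    show "H0L c a1 a2 F" using lipschitz_energy_imp_H0L h by blast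
    show "H1L c a1 a2 F" using lipschitz_graph_imp_H1L h by blast
  next
    fix \<Phi>
    assume h: "F 0 = 0 \<and> lipschitz_energy c a1 a2 F \<and> lipschitz_graph c a1 a2 F \<and>
      continuous_on UNIV F \<and> lipschitz_H F \<and> (\<forall>w. primitive F w \<le> 0) \<and>
      (\<forall>\<Omega> f. open \<Omega> \<and> is_interval \<Omega> \<and> sobolev2 \<Omega> f \<longrightarrow>
         integrable (lebesgue_on \<Omega>) (\<lambda>x. primitive F (f x)))"
      and \<Phi>: "\<Phi> \<in> domA"
    obtain L where L: "0 \<le> L" "\<And>r s. \<bar>F r - F s\<bar> \<le> L * \<bar>r - s\<bar>"
      using lipschitz_H_imp_lipschitz[of F] h by blast
    interpret wave_nonlinearity c a1 a2 Q S F L by unfold_locales (use h L in auto)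
    note w = well_posed[OF \<Phi>]
    show "\<exists>T>0. \<exists>\<phi>. solves_Q c a1 a2 F \<Phi> {0..<T} \<phi>" using w by (rule conjunct1)
    show "\<forall>T>0. \<forall>\<phi>. solves_Q c a1 a2 F \<Phi> {0..<T} \<phi> \<longrightarrow>
            solves_P c a1 a2 F \<Phi> {0..<T} (\<lambda>t. fst (\<phi> t)) \<and>
            (\<forall>t\<in>{0..<T}. ((\<lambda>s. fst (\<phi> s)) has_vector_derivative snd (\<phi> t)) (at t within {0..<T})) \<and>
            (\<exists>M. \<forall>t\<in>{0..<T}. normX c a1 a2 (\<phi> t) \<le> M)" using w by (rule conjunct2[THEN conjunct1])
    show "\<exists>\<phi>. solves_Q c a1 a2 F \<Phi> {0..} \<phi> \<and>
            solves_P c a1 a2 F \<Phi> {0..} (\<lambda>t. fst (\<phi> t)) \<and>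
            (\<forall>t\<ge>0. ((\<lambda>s. fst (\<phi> s)) has_vector_derivative snd (\<phi> t)) (at t within {0..})) \<and>
            (\<forall>T>0. \<forall>\<psi>. solves_Q c a1 a2 F \<Phi> {0..<T} \<psi> \<longrightarrow> (\<forall>t\<in>{0..<T}. \<psi> t = \<phi> t))"
      using w by (rule conjunct2[THEN conjunct2])
  qed
qed

end
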